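(* Let $T>0$, $H\in(1/2,1)$, let $b:[0,T]\times\mathbb{R}^d\to\mathbb{R}^d$ be differentiable in the space variable and $\sigma:[0,T]\to\mathbb{R}^d\otimes\mathbb{R}^d$ ($d\times d$-matrix valued, with $\sigma(t)$ invertible for each $t$). Assume: (i) there are constants $L_1,L_2,L_3>0$ such that (a) for some $\gamma$ with $H-\frac12<\gamma\le 1$: $|b(t,x)-b(s,x)|+|\nabla b(t,\cdot)(x)-\nabla b(s,\cdot)(x)|\le L_1|t-s|^\gamma$ for all $t,s\in[0,T]$, $x\in\mathbb{R}^d$; (b) for some $\rho$ with $1-\frac1{2H}<\rho<1$: $|\nabla b(t,\cdot)(x)-\nabla b(t,\cdot)(y)|\le L_2|x-y|^\rho$ for all $x,y\in\mathbb{R}^d$, $t\in[0,T]$; (c) $|\nabla b(t,\cdot)(x)|\le L_3$ for all $x\in\mathbb{R}^d$, $t\in[0,T]$; (ii) for some $\delta$ with $(1-H)\vee(H-\frac12)<\delta\le1$ and some $K>0$: $|\sigma(t)-\sigma(s)|\le K|t-s|^\delta$ for all $t,s\in[0,T]$, and $\sigma^{-1}$ is bounded on $[0,T]$. Let $x\in\mathbb{R}^d$ and let $X$ be the solution of $$\mathrm{d}X_t=b(t,X_t)\,\mathrm{d}t+\sigma(t)\,\mathrm{d}B^H_t,\quad X_0=x,\quad t\in[0,T],$$ where $B^H$ is a $d$-dimensional fractional Brownian motion with Hurst parameter $H$. Then for every $t\in(0,T]$ the law of $X_t$ is absolutely continuous with respect to the Lebesgue measure on $\mathbb{R}^d$.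
   Context: $B^H=(B^H_t)_{t\in[0,T]}$ is a $d$-dimensional fractional Brownian motion on a probability space $(\Omega,\mathscr F,\mathbb P)$: a centered Gaussian process with $\mathbb{E}(B^{H,i}_tB^{H,j}_s)=R_H(t,s)\delta_{ij}$, $R_H(t,s)=\frac12(t^{2H}+s^{2H}-|t-s|^{2H})$. The equation is understood with pathwise integral with respect to $B^H$; under the stated assumptions it has a unique solution, whose paths are Hölder continuous of every order less than $H$. $\nabla b(t,\cdot)(x)$ is the gradient of $b(t,\cdot)$ at $x$; $u\vee v=\max(u,v)$. *)

theory Defs
  imports "HOL-Analysis.Analysis" "HOL-Probability.Probability"
begin

text \<open>Real Gaussian random variables; the second disjunct is the degenerate case of variance 0.\<close>

definition gaussian_rv :: "'a measure \<Rightarrow> ('a \<Rightarrow> real) \<Rightarrow> bool" where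
  "gaussian_rv M Y \<longleftrightarrow>
     (\<exists>\<mu> s. s > 0 \<and> distributed M lborel Y (normal_density \<mu> s)) \<or>
     (\<exists>\<mu>. Y \<in> borel_measurable M \<and> distr M borel Y = return borel \<mu>)"

definition gaussian_process ::
  "'a measure \<Rightarrow> 'i set \<Rightarrow> ('i \<Rightarrow> 'a \<Rightarrow> 'b::euclidean_space) \<Rightarrow> bool" where
  "gaussian_process M I Z \<longleftrightarrow>
     (\<forall>t\<in>I. Z t \<in> borel_measurable M) \<and>
     (\<forall>S c. finite S \<longrightarrow> S \<subseteq> I \<longrightarrow> gaussian_rv M (\<lambda>\<omega>. \<Sum>t\<in>S. inner (c t) (Z t \<omega>)))"

definition fbm_cov :: "real \<Rightarrow> real \<Rightarrow> real \<Rightarrow> real" where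
  "fbm_cov H t s = (t powr (2 * H) + s powr (2 * H) - \<bar>t - s\<bar> powr (2 * H)) / 2"

definition fractional_brownian_motion ::
  "'a measure \<Rightarrow> real \<Rightarrow> real \<Rightarrow> (real \<Rightarrow> 'a \<Rightarrow> real ^ 'n) \<Rightarrow> bool" where
  "fractional_brownian_motion M T H B \<longleftrightarrow>
     gaussian_process M {0..T} B \<and>
     (\<forall>t\<in>{0..T}. \<forall>i. integral\<^sup>L M (\<lambda>\<omega>. B t \<omega> $ i) = 0) \<and>
     (\<forall>t\<in>{0..T}. \<forall>s\<in>{0..T}. \<forall>i j.
        integral\<^sup>L M (\<lambda>\<omega>. B t \<omega> $ i * B s \<omega> $ j) = (if i = j then fbm_cov H t s else 0))"

text \<open>
  The pathwise (Riemann--Stieltjes, in the sense of Young) integral of a matrix-valued function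
  \<open>f\<close> against a vector-valued path \<open>g\<close> over \<open>[a, b]\<close>: the limit of the sums
  \<open>\<Sum> f(\<xi>) (g(v) - g(u))\<close> over tagged partitions into intervals \<open>[u, v] \<ni> \<xi>\<close> as the mesh tends
  to 0. The gauge is constant, so this is Riemann--Stieltjes and not Henstock--Stieltjes. The
  integral exists whenever \<open>f\<close> and \<open>g\<close> are Hoelder continuous with exponents of sum greater than 1.
\<close>

definition has_pathwise_integral ::
  "(real \<Rightarrow> real ^ 'n ^ 'm) \<Rightarrow> (real \<Rightarrow> real ^ 'n) \<Rightarrow> real \<Rightarrow> real \<Rightarrow> real ^ 'm \<Rightarrow> bool" where
  "has_pathwise_integral f g a b J \<longleftrightarrow>
     (\<forall>e>0. \<exists>d>0. \<forall>p. p tagged_division_of {a..b} \<longrightarrow> (\<lambda>\<xi>. ball \<xi> d) fine p \<longrightarrow>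
        norm ((\<Sum>(\<xi>, K)\<in>p. f \<xi> *v (g (Sup K) - g (Inf K))) - J) < e)"

text \<open>
  Continuous solutions on \<open>[0, T]\<close> of \<open>dX\<^sub>t = b(t, X\<^sub>t) dt + \<sigma>(t) dB\<^sub>t\<close>, \<open>X\<^sub>0 = x\<close>, driven path by
  path by \<open>B\<close>. The exceptional null set does not depend on \<open>t\<close>; at \<open>t = 0\<close> both integrals vanish,
  which gives the initial condition.
\<close>

definition pathwise_sde_solution ::
  "'a measure \<Rightarrow> real \<Rightarrow> (real \<Rightarrow> real ^ 'n \<Rightarrow> real ^ 'n) \<Rightarrow> (real \<Rightarrow> real ^ 'n ^ 'n) \<Rightarrow>
   (real \<Rightarrow> 'a \<Rightarrow> real ^ 'n) \<Rightarrow> real ^ 'n \<Rightarrow> (real \<Rightarrow> 'a \<Rightarrow> real ^ 'n) \<Rightarrow> bool" where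
  "pathwise_sde_solution M T b \<sigma> B x X \<longleftrightarrow>
     (\<forall>t\<in>{0..T}. X t \<in> borel_measurable M) \<and>
     (AE \<omega> in M. continuous_on {0..T} (\<lambda>t. X t \<omega>)) \<and>
     (AE \<omega> in M. \<forall>t\<in>{0..T}. \<exists>I J.
        ((\<lambda>s. b s (X s \<omega>)) has_integral I) {0..t} \<and>
        has_pathwise_integral \<sigma> (\<lambda>s. B s \<omega>) 0 t J \<and>
        X t \<omega> = x + I + J)"

end

theory Submission
  imports Defs
begin

text \<open>
  Split \<open>B\<close> along the Gaussian vector \<open>\<xi> = B\<^sub>t - 2 B\<^bsub>t-e\<^esub> + B\<^bsub>t-2e\<^esub>\<close>: \<open>B\<^sub>s = \<phi>(s) \<xi> + W\<^sub>s\<close> with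
  \<open>W\<close> independent of \<open>\<xi>\<close>. A second difference is used because, unlike an increment, it decorrelates
  from the past as \<open>e \<rightarrow> 0\<close>: \<open>\<phi>\<close> concentrates near \<open>t\<close>, while \<open>\<phi>(t)\<close> tends to a nonzero constant since
  \<open>H \<noteq> 1/2\<close>. For fixed \<open>W\<close>, two solutions with parameters \<open>\<xi>, \<xi>'\<close> differ at time \<open>t\<close> by
  \<open>\<integral>\<^sub>0\<^sup>t \<sigma> d\<phi> (\<xi> - \<xi>')\<close>, which is close to \<open>\<phi>(t) \<sigma>(t) (\<xi> - \<xi>')\<close>, up to a Gronwall term that is small
  because \<open>\<phi>\<close> is small away from \<open>t\<close>. Hence \<open>\<xi> \<mapsto> X\<^sub>t\<close> expands distances, and conditionally on \<open>W\<close> the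
  probability of \<open>X\<^sub>t\<close> lying in a ball of radius \<open>r\<close> is at most \<open>C r\<^sup>n\<close>. Running the argument for the
  Euler schemes, uniformly in the mesh, only involves finite-dimensional Gaussian vectors, and the
  ball estimate survives the limit.
\<close>

subsection \<open>Joint laws from characteristic functions\<close>

text \<open>Powers of e decide the choice of \<xi>. An increment over [t - e, t] has covariance of
  order e with a fixed past value and variance e^(2H), so for 2H > 1 its regression coefficient
  blows up like e^(1 - 2H). A second difference gains one order: e^2 against e^(2H), and e^(2 - 2H)
  tends to 0. Since \<phi> is small only before a window of length \<eta> ending at t, and merely
  bounded inside it, the constants are chosen in the order \<eta>, e, mesh. A short window tames the
  oscillation of \<sigma> and the Gronwall term there; a small e makes the variation of \<phi>
  before the window negligible; the mesh has to resolve the window but not e, because sums against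
  \<phi> are estimated through its total variation. Gaussianity is given for linear combinations,
  some of them degenerate, so there is no joint density to factorize. Independence of \<xi> and W
  comes from characteristic functions instead, and conditioning on W becomes Fubini on two copies of
  the probability space.\<close>

lemma weighted_char_eqI:
  fixes V h :: "'a \<Rightarrow> real" and U g :: "'b \<Rightarrow> real"
  assumes "finite_measure M" "finite_measure N"
    and [measurable]: "V \<in> borel_measurable M" "h \<in> borel_measurable M"
      "U \<in> borel_measurable N" "g \<in> borel_measurable N"
    and h: "\<And>x. 0 \<le> h x" "\<And>x. h x \<le> C" and g: "\<And>x. 0 \<le> g x" "\<And>x. g x \<le> C"
    and eq: "\<And>s. (CLINT x|M. h x *\<^sub>R iexp (s * V x)) = (CLINT x|N. g x *\<^sub>R iexp (s * U x))"
    and A: "A \<in> sets borel"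
  shows "(LINT x|M. h x * indicator A (V x)) = (LINT x|N. g x * indicator A (U x))"
proof -
  interpret M: finite_measure M by fact
  interpret N: finite_measure N by fact
  have [measurable]: "A \<in> sets borel" by fact
  have ih: "integrable M h" by (rule M.integrable_const_bound[of _ C]) (use h in auto)
  have ig: "integrable N g" by (rule N.integrable_const_bound[of _ C]) (use g in auto)
  define m where "m = integral\<^sup>L M h"
  have "complex_of_real (integral\<^sup>L M h) = complex_of_real (integral\<^sup>L N g)"
    using eq[of 0] by (simp add: scaleR_conv_of_real)
  then have mN: "integral\<^sup>L N g = m" by (simp add: m_def)
  have m0: "m \<ge> 0" unfolding m_def using h by simp
  show ?thesis
  proof (cases "m = 0")
    case True
    have "AE x in M. h x = 0" using True ih h integral_nonneg_eq_0_iff_AE[OF ih] by (simp add: m_def)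
    then have 1: "(LINT x|M. h x * indicator A (V x)) = 0" by (intro integral_eq_zero_AE) auto
    have "AE x in N. g x = 0" using True mN ig g integral_nonneg_eq_0_iff_AE[OF ig] by simp
    then have 2: "(LINT x|N. g x * indicator A (U x)) = 0" by (intro integral_eq_zero_AE) auto
    show ?thesis using 1 2 by simp
  next
    case False
    then have m: "m > 0" using m0 by simp
    \<comment> \<open>Division by the common mass \<open>m\<close> turns both weighted measures into
      probability measures, to which uniqueness of characteristic functions applies. The type of
      \<open>Q\<close> is free, so that the fact serves \<open>M\<close> and
      \<open>N\<close>.\<close>
    have gen: "real_distribution (distr (density Q (\<lambda>x. ennreal (k x / m))) borel W)
        \<and> (\<forall>s. char (distr (density Q (\<lambda>x. ennreal (k x / m))) borel W) s
            = (CLINT x|Q. k x *\<^sub>R iexp (s * W x)) / m)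
        \<and> measure (distr (density Q (\<lambda>x. ennreal (k x / m))) borel W) A
            = (LINT x|Q. k x * indicator A (W x)) / m"
      if ik: "integrable Q k" "\<And>x. 0 \<le> k x" "integral\<^sup>L Q k = m"
        and [measurable]: "W \<in> borel_measurable Q" for Q :: "'c measure" and k W
    proof (intro conjI allI)
      have [measurable]: "k \<in> borel_measurable Q" using ik by auto
      let ?D = "density Q (\<lambda>x. ennreal (k x / m))"
      have "emeasure ?D (space ?D) = (\<integral>\<^sup>+x. ennreal (k x / m) \<partial>Q)"
        by (simp add: emeasure_density cong: nn_integral_cong)
      also have "\<dots> = ennreal (\<integral>x. k x / m \<partial>Q)"
        by (rule nn_integral_eq_integral) (use ik m in auto)
      finally have "emeasure ?D (space ?D) = 1" using ik m by simp
      then interpret D: prob_space ?D by (rule prob_spaceI)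
      show "real_distribution (distr ?D borel W)" by (rule D.real_distribution_distr) simp
      show "char (distr ?D borel W) s = (CLINT x|Q. k x *\<^sub>R iexp (s * W x)) / m" for s
      proof -
        have "char (distr ?D borel W) s = (CLINT x|?D. iexp (s * W x))"
          unfolding char_def by (subst integral_distr) auto
        also have "\<dots> = (CLINT x|Q. (k x / m) *\<^sub>R iexp (s * W x))"
          by (subst integral_density) (use ik m in auto)
        also have "\<dots> = (CLINT x|Q. (k x *\<^sub>R iexp (s * W x)) / m)"
          by (intro Bochner_Integration.integral_cong) (auto simp: scaleR_conv_of_real)
        finally show ?thesis by simp
      qed
      have "measure (distr ?D borel W) A = (LINT x|distr ?D borel W. indicator A x)" by simp
      also have "\<dots> = (LINT x|?D. indicator A (W x))" by (subst integral_distr) auto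
      also have "\<dots> = (LINT x|Q. (k x / m) *\<^sub>R indicator A (W x))"
        by (subst integral_density) (use ik m in auto)
      also have "\<dots> = (LINT x|Q. (k x * indicator A (W x)) / m)"
        by (intro Bochner_Integration.integral_cong) auto
      finally show "measure (distr ?D borel W) A = (LINT x|Q. k x * indicator A (W x)) / m" by simp
    qed
    have GM: "real_distribution (distr (density M (\<lambda>x. ennreal (h x / m))) borel V)"
      "\<And>s. char (distr (density M (\<lambda>x. ennreal (h x / m))) borel V) s
            = (CLINT x|M. h x *\<^sub>R iexp (s * V x)) / m"
      "measure (distr (density M (\<lambda>x. ennreal (h x / m))) borel V) A
            = (LINT x|M. h x * indicator A (V x)) / m"
      using gen[OF ih h(1), of V] by (auto simp: m_def)
    have GN: "real_distribution (distr (density N (\<lambda>x. ennreal (g x / m))) borel U)"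
      "\<And>s. char (distr (density N (\<lambda>x. ennreal (g x / m))) borel U) s
            = (CLINT x|N. g x *\<^sub>R iexp (s * U x)) / m"
      "measure (distr (density N (\<lambda>x. ennreal (g x / m))) borel U) A
            = (LINT x|N. g x * indicator A (U x)) / m"
      using gen[OF ig g(1) mN, of U] by auto
    have "distr (density M (\<lambda>x. ennreal (h x / m))) borel V = distr (density N (\<lambda>x. ennreal (g x / m))) borel U"
      by (rule Levy_uniqueness[OF GM(1) GN(1)]) (simp only: fun_eq_iff GM(2) GN(2) eq simp_thms)
    then show ?thesis using GM(3) GN(3) m by simp
  qed
qed

lemma integrable_scaleR_iexp:
  fixes p S :: "'a \<Rightarrow> real"
  assumes "finite_measure M" and [measurable]: "p \<in> borel_measurable M" "S \<in> borel_measurable M"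
    and "\<And>x. \<bar>p x\<bar> \<le> C"
  shows "integrable M (\<lambda>x. p x *\<^sub>R iexp (S x))"
proof -
  interpret finite_measure M by fact
  show ?thesis
    by (rule integrable_const_bound[of _ C]) (use assms in auto)
qed

text \<open>Euler's formulas in both directions. The first two reduce trigonometric weights to
  transforms of \<open>p\<close>, at \<open>R\<close> and at \<open>R\<close> shifted by plus or
  minus \<open>S\<close>; the third recovers a transform of \<open>p\<close> from real integrals
  with the nonnegative weights \<open>1 + cos\<close> and \<open>1 + sin\<close>.\<close>

lemma
  fixes p S R :: "'a \<Rightarrow> real"
  assumes M: "finite_measure M" and [measurable]: "p \<in> borel_measurable M"
    "S \<in> borel_measurable M" "R \<in> borel_measurable M" and p: "\<And>x. \<bar>p x\<bar> \<le> C"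
  shows integral_cos_weight_iexp: "(CLINT x|M. (p x * (1 + cos (S x))) *\<^sub>R iexp (R x)) =
      (CLINT x|M. p x *\<^sub>R iexp (R x)) + ((CLINT x|M. p x *\<^sub>R iexp (S x + R x))
        + (CLINT x|M. p x *\<^sub>R iexp (- S x + R x))) / 2"
    and integral_sin_weight_iexp: "(CLINT x|M. (p x * (1 + sin (S x))) *\<^sub>R iexp (R x)) =
      (CLINT x|M. p x *\<^sub>R iexp (R x)) + ((CLINT x|M. p x *\<^sub>R iexp (S x + R x))
        - (CLINT x|M. p x *\<^sub>R iexp (- S x + R x))) / (2 * \<i>)"
    and integral_iexp_trig_weights: "(CLINT x|M. p x *\<^sub>R iexp (S x)) =
      of_real ((LINT x|M. p x * (1 + cos (S x))) - (LINT x|M. p x)) +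
      \<i> * of_real ((LINT x|M. p x * (1 + sin (S x))) - (LINT x|M. p x))"
proof -
  interpret finite_measure M by fact
  note int = integrable_scaleR_iexp[OF M _ _ p]
  have i1: "integrable M (\<lambda>x. p x *\<^sub>R iexp (R x))"
    and i2: "integrable M (\<lambda>x. p x *\<^sub>R iexp (S x + R x))"
    and i3: "integrable M (\<lambda>x. p x *\<^sub>R iexp (- S x + R x))"
    by (intro int; measurable)+
  have "(p x * (1 + cos (S x))) *\<^sub>R iexp (R x) =
      p x *\<^sub>R iexp (R x) + (p x *\<^sub>R iexp (S x + R x) + p x *\<^sub>R iexp (- S x + R x)) / 2" for x
    by (auto simp: complex_eq_iff Re_exp Im_exp cos_add sin_add cos_diff sin_diff field_simps)
  then have "(CLINT x|M. (p x * (1 + cos (S x))) *\<^sub>R iexp (R x)) =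
     (CLINT x|M. p x *\<^sub>R iexp (R x) + (p x *\<^sub>R iexp (S x + R x) + p x *\<^sub>R iexp (- S x + R x)) / 2)"
    by (simp only:)
  also have "\<dots> = (CLINT x|M. p x *\<^sub>R iexp (R x)) + ((CLINT x|M. p x *\<^sub>R iexp (S x + R x))
        + (CLINT x|M. p x *\<^sub>R iexp (- S x + R x))) / 2"
    using i1 i2 i3 by (simp del: of_real_add of_real_minus)
  finally show "(CLINT x|M. (p x * (1 + cos (S x))) *\<^sub>R iexp (R x)) =
      (CLINT x|M. p x *\<^sub>R iexp (R x)) + ((CLINT x|M. p x *\<^sub>R iexp (S x + R x))
        + (CLINT x|M. p x *\<^sub>R iexp (- S x + R x))) / 2" .
  have "(p x * (1 + sin (S x))) *\<^sub>R iexp (R x) =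
      p x *\<^sub>R iexp (R x) + (p x *\<^sub>R iexp (S x + R x) - p x *\<^sub>R iexp (- S x + R x)) / (2 * \<i>)" for x
    by (auto simp: complex_eq_iff Re_exp Im_exp cos_add sin_add cos_diff sin_diff field_simps
        Re_divide Im_divide)
  then have "(CLINT x|M. (p x * (1 + sin (S x))) *\<^sub>R iexp (R x)) =
     (CLINT x|M. p x *\<^sub>R iexp (R x) + (p x *\<^sub>R iexp (S x + R x) - p x *\<^sub>R iexp (- S x + R x)) / (2 * \<i>))"
    by (simp only:)
  also have "\<dots> = (CLINT x|M. p x *\<^sub>R iexp (R x)) + ((CLINT x|M. p x *\<^sub>R iexp (S x + R x))
        - (CLINT x|M. p x *\<^sub>R iexp (- S x + R x))) / (2 * \<i>)"
    using i1 i2 i3 by (simp del: of_real_add of_real_minus)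
  finally show "(CLINT x|M. (p x * (1 + sin (S x))) *\<^sub>R iexp (R x)) =
      (CLINT x|M. p x *\<^sub>R iexp (R x)) + ((CLINT x|M. p x *\<^sub>R iexp (S x + R x))
        - (CLINT x|M. p x *\<^sub>R iexp (- S x + R x))) / (2 * \<i>)" .
  have C: "0 \<le> C" using p[of undefined] by linarith
  have b: "\<bar>p x * cos (S x)\<bar> \<le> C" "\<bar>p x * sin (S x)\<bar> \<le> C" for x
    using mult_mono[OF p[of x] abs_cos_le_one[of "S x"]] mult_mono[OF p[of x] abs_sin_le_one[of "S x"]] C
    by (simp_all add: abs_mult)
  have j1: "integrable M p" by (rule integrable_const_bound[of _ C]) (use p in auto)
  have j2: "integrable M (\<lambda>x. p x * cos (S x))" by (rule integrable_const_bound[of _ C]) (use b in auto)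
  have j3: "integrable M (\<lambda>x. p x * sin (S x))" by (rule integrable_const_bound[of _ C]) (use b in auto)
  have "p x *\<^sub>R iexp (S x) = of_real (p x * cos (S x)) + \<i> * of_real (p x * sin (S x))" for x
    by (auto simp: complex_eq_iff Re_exp Im_exp)
  then have "(CLINT x|M. p x *\<^sub>R iexp (S x)) =
      (CLINT x|M. of_real (p x * cos (S x)) + \<i> * of_real (p x * sin (S x)))"
    by (simp only:)
  also have "\<dots> = of_real (LINT x|M. p x * cos (S x)) + \<i> * of_real (LINT x|M. p x * sin (S x))"
    using j2 j3 by (simp del: of_real_mult)
  also have "(LINT x|M. p x * cos (S x)) = (LINT x|M. p x * (1 + cos (S x))) - (LINT x|M. p x)"
    using j1 j2 by (simp add: distrib_left)
  also have "(LINT x|M. p x * sin (S x)) = (LINT x|M. p x * (1 + sin (S x))) - (LINT x|M. p x)"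
    using j1 j3 by (simp add: distrib_left)
  finally show "(CLINT x|M. p x *\<^sub>R iexp (S x)) =
      of_real ((LINT x|M. p x * (1 + cos (S x))) - (LINT x|M. p x)) +
      \<i> * of_real ((LINT x|M. p x * (1 + sin (S x))) - (LINT x|M. p x))" .
qed

lemma prod_indicator_bounds:
  "0 \<le> (\<Prod>j\<in>J. indicator (A j) (V j) :: real)" "(\<Prod>j\<in>J. indicator (A j) (V j) :: real) \<le> 1"
  by (auto intro!: prod_nonneg prod_le_1 simp: indicator_def)

text \<open>One-dimensional uniqueness is applied to one coordinate at a time. The nonnegative weights
  \<open>1 + cos S\<close> and \<open>1 + sin S\<close> keep the measures positive while carrying the characteristic function
  of the remaining coordinates.\<close>

lemma joint_char_eq_step:
  fixes V :: "'i \<Rightarrow> 'a \<Rightarrow> real" and U :: "'i \<Rightarrow> 'b \<Rightarrow> real"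
  assumes M: "finite_measure M" and N: "finite_measure N" and I: "finite I"
    and mV: "\<And>i. i \<in> I \<Longrightarrow> V i \<in> borel_measurable M"
    and mU: "\<And>i. i \<in> I \<Longrightarrow> U i \<in> borel_measurable N"
    and mp: "p \<in> borel_measurable M" "\<And>x. 0 \<le> p x" "\<And>x. p x \<le> 1"
    and mq: "q \<in> borel_measurable N" "\<And>x. 0 \<le> q x" "\<And>x. q x \<le> 1"
    and eq: "\<And>c. (CLINT x|M. p x *\<^sub>R iexp (\<Sum>i\<in>I. c i * V i x)) = (CLINT x|N. q x *\<^sub>R iexp (\<Sum>i\<in>I. c i * U i x))"
    and j: "j \<in> I" and A: "A \<in> sets borel"
  shows "(CLINT x|M. (p x * indicator A (V j x)) *\<^sub>R iexp (\<Sum>i\<in>I. c i * V i x)) =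
    (CLINT x|N. (q x * indicator A (U j x)) *\<^sub>R iexp (\<Sum>i\<in>I. c i * U i x))"
proof -
  note [measurable] = mp(1) mq(1) A mV[OF j] mU[OF j]
  define S where "S = (\<lambda>x. \<Sum>i\<in>I. c i * V i x)"
  define R where "R = (\<lambda>x. \<Sum>i\<in>I. c i * U i x)"
  have [measurable]: "S \<in> borel_measurable M" "R \<in> borel_measurable N"
    unfolding S_def R_def using mV mU by measurable
  \<comment> \<open>Frequencies \<open>d * c\<close> plus \<open>s\<close> in coordinate
    \<open>j\<close>: \<open>d = 0\<close> gives the plain weight, \<open>d = 1\<close> and
    \<open>d = -1\<close> give the two exponentials of which cosine and sine consist.\<close>
  have upd: "(\<Sum>i\<in>I. (d * c i + (if i = j then s else 0)) * W i) = d * (\<Sum>i\<in>I. c i * W i) + s * W j"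
    for d s and W :: "'i \<Rightarrow> real"
    using I j by (simp add: distrib_right sum.distrib sum_distrib_left mult.assoc if_distrib[of "\<lambda>x. x * _"] cong: if_cong)
  have e: "(CLINT x|M. p x *\<^sub>R iexp (d * S x + s * V j x)) = (CLINT x|N. q x *\<^sub>R iexp (d * R x + s * U j x))" for d s
    using eq[of "\<lambda>i. d * c i + (if i = j then s else 0)"] unfolding upd S_def R_def .
  have e0: "(CLINT x|M. p x *\<^sub>R iexp (s * V j x)) = (CLINT x|N. q x *\<^sub>R iexp (s * U j x))" for s
    using e[of 0 s] by (simp only: mult_zero_left add_0)
  have e1: "(CLINT x|M. p x *\<^sub>R iexp (S x + s * V j x)) = (CLINT x|N. q x *\<^sub>R iexp (R x + s * U j x))" for s
    using e[of 1 s] by (simp only: mult_1)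
  have e2: "(CLINT x|M. p x *\<^sub>R iexp (- S x + s * V j x)) = (CLINT x|N. q x *\<^sub>R iexp (- R x + s * U j x))" for s
    using e[of "-1" s] by (simp only: mult_minus1)
  have ap: "\<bar>p x\<bar> \<le> 1" for x using mp(2)[of x] mp(3)[of x] by simp
  have aq: "\<bar>q x\<bar> \<le> 1" for x using mq(2)[of x] mq(3)[of x] by simp
  have w1: "(LINT x|M. p x * indicator A (V j x)) = (LINT x|N. q x * indicator A (U j x))"
    by (rule weighted_char_eqI[OF M N, where C = 1]) (use mp mq e0 A in auto)
  have bd: "0 \<le> r * (1 + t)" "r * (1 + t) \<le> 2" if "0 \<le> r" "r \<le> 1" "-1 \<le> t" "t \<le> 1" for r t :: real
    using that mult_mono[of r 1 "1 + t" 2] by auto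
  have w2: "(LINT x|M. p x * (1 + cos (S x)) * indicator A (V j x)) = (LINT x|N. q x * (1 + cos (R x)) * indicator A (U j x))"
  proof (rule weighted_char_eqI[OF M N, where C = 2])
    fix s
    show "(CLINT x|M. (p x * (1 + cos (S x))) *\<^sub>R iexp (s * V j x)) =
         (CLINT x|N. (q x * (1 + cos (R x))) *\<^sub>R iexp (s * U j x))"
    proof -
      have "(CLINT x|M. (p x * (1 + cos (S x))) *\<^sub>R iexp (s * V j x)) =
          (CLINT x|M. p x *\<^sub>R iexp (s * V j x)) + ((CLINT x|M. p x *\<^sub>R iexp (S x + s * V j x))
            + (CLINT x|M. p x *\<^sub>R iexp (- S x + s * V j x))) / 2"
        by (rule integral_cos_weight_iexp[OF M _ _ _ ap]) measurable
      also have "\<dots> = (CLINT x|N. q x *\<^sub>R iexp (s * U j x)) + ((CLINT x|N. q x *\<^sub>R iexp (R x + s * U j x))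
            + (CLINT x|N. q x *\<^sub>R iexp (- R x + s * U j x))) / 2"
        by (simp only: e0 e1 e2)
      also have "\<dots> = (CLINT x|N. (q x * (1 + cos (R x))) *\<^sub>R iexp (s * U j x))"
        by (rule integral_cos_weight_iexp[OF N _ _ _ aq, symmetric]) measurable
      finally show ?thesis .
    qed
  qed (use mp mq A in \<open>auto intro!: bd\<close>)
  have w3: "(LINT x|M. p x * (1 + sin (S x)) * indicator A (V j x)) = (LINT x|N. q x * (1 + sin (R x)) * indicator A (U j x))"
  proof (rule weighted_char_eqI[OF M N, where C = 2])
    fix s
    show "(CLINT x|M. (p x * (1 + sin (S x))) *\<^sub>R iexp (s * V j x)) =
         (CLINT x|N. (q x * (1 + sin (R x))) *\<^sub>R iexp (s * U j x))"
    proof -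
      have "(CLINT x|M. (p x * (1 + sin (S x))) *\<^sub>R iexp (s * V j x)) =
          (CLINT x|M. p x *\<^sub>R iexp (s * V j x)) + ((CLINT x|M. p x *\<^sub>R iexp (S x + s * V j x))
            - (CLINT x|M. p x *\<^sub>R iexp (- S x + s * V j x))) / (2 * \<i>)"
        by (rule integral_sin_weight_iexp[OF M _ _ _ ap]) measurable
      also have "\<dots> = (CLINT x|N. q x *\<^sub>R iexp (s * U j x)) + ((CLINT x|N. q x *\<^sub>R iexp (R x + s * U j x))
            - (CLINT x|N. q x *\<^sub>R iexp (- R x + s * U j x))) / (2 * \<i>)"
        by (simp only: e0 e1 e2)
      also have "\<dots> = (CLINT x|N. (q x * (1 + sin (R x))) *\<^sub>R iexp (s * U j x))"
        by (rule integral_sin_weight_iexp[OF N _ _ _ aq, symmetric]) measurable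
      finally show ?thesis .
    qed
  qed (use mp mq A in \<open>auto intro!: bd\<close>)
  have m1: "(\<lambda>x. p x * indicator A (V j x)) \<in> borel_measurable M"
    and m2: "(\<lambda>x. q x * indicator A (U j x)) \<in> borel_measurable N"
    by measurable
  have ap': "\<bar>p x * indicator A (V j x)\<bar> \<le> 1" for x using ap[of x] by (auto simp: indicator_def)
  have aq': "\<bar>q x * indicator A (U j x)\<bar> \<le> 1" for x using aq[of x] by (auto simp: indicator_def)
  have "(CLINT x|M. (p x * indicator A (V j x)) *\<^sub>R iexp (S x)) =
      (CLINT x|N. (q x * indicator A (U j x)) *\<^sub>R iexp (R x))"
    unfolding integral_iexp_trig_weights[OF M m1 \<open>S \<in> _\<close> \<open>S \<in> _\<close> ap']
      integral_iexp_trig_weights[OF N m2 \<open>R \<in> _\<close> \<open>R \<in> _\<close> aq']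
    using w1 w2 w3 by (simp add: mult_ac)
  then show ?thesis by (simp only: S_def R_def)
qed

text \<open>One indicator after another moves into the weight. The exponential keeps all
  coordinates, also those already boxed, and \<open>c\<close> stays arbitrary, because the next step
  needs the full transform of the new weight.\<close>

lemma joint_char_eq_box:
  fixes V :: "'i \<Rightarrow> 'a \<Rightarrow> real" and U :: "'i \<Rightarrow> 'b \<Rightarrow> real"
  assumes M: "finite_measure M" and N: "finite_measure N" and I: "finite I"
    and mV: "\<And>i. i \<in> I \<Longrightarrow> V i \<in> borel_measurable M"
    and mU: "\<And>i. i \<in> I \<Longrightarrow> U i \<in> borel_measurable N"
    and eq: "\<And>c. (CLINT x|M. iexp (\<Sum>i\<in>I. c i * V i x)) = (CLINT x|N. iexp (\<Sum>i\<in>I. c i * U i x))"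
    and A: "\<And>i. i \<in> I \<Longrightarrow> A i \<in> sets borel" and J: "J \<subseteq> I"
  shows "(CLINT x|M. (\<Prod>j\<in>J. indicator (A j) (V j x)) *\<^sub>R iexp (\<Sum>i\<in>I. c i * V i x)) =
    (CLINT x|N. (\<Prod>j\<in>J. indicator (A j) (U j x)) *\<^sub>R iexp (\<Sum>i\<in>I. c i * U i x))"
proof -
  have "finite J" using I J finite_subset by blast
  then show ?thesis using J
  proof (induction J arbitrary: c)
    case empty
    then show ?case using eq by simp
  next
    case (insert j J)
    have 1: "(\<lambda>x. \<Prod>j\<in>J. indicator (A j) (V j x) :: real) \<in> borel_measurable M"
      by (intro borel_measurable_prod measurable_compose[OF mV borel_measurable_indicator[OF A]])
         (use insert.prems in auto)
    have 2: "(\<lambda>x. \<Prod>j\<in>J. indicator (A j) (U j x) :: real) \<in> borel_measurable N"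
      by (intro borel_measurable_prod measurable_compose[OF mU borel_measurable_indicator[OF A]])
         (use insert.prems in auto)
    show ?case
      using joint_char_eq_step[OF M N I mV mU 1 prod_indicator_bounds 2 prod_indicator_bounds insert.IH, where j = j and A = "A j" and c = c] insert A
      by (simp add: mult.commute)
  qed
qed

text \<open>Uniqueness in finitely many dimensions: \<open>joint_char_eq_box\<close> with every
  indicator in place and frequency 0 compares both laws on rectangles, which generate the product
  and are stable under intersection.\<close>

lemma distr_PiM_eqI_char:
  fixes V :: "'i \<Rightarrow> 'a \<Rightarrow> real" and U :: "'i \<Rightarrow> 'b \<Rightarrow> real"
  assumes M: "prob_space M" and N: "prob_space N" and I: "finite I"
    and mV: "\<And>i. i \<in> I \<Longrightarrow> V i \<in> borel_measurable M"
    and mU: "\<And>i. i \<in> I \<Longrightarrow> U i \<in> borel_measurable N"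
    and eq: "\<And>c. (CLINT x|M. iexp (\<Sum>i\<in>I. c i * V i x)) = (CLINT x|N. iexp (\<Sum>i\<in>I. c i * U i x))"
  shows "distr M (PiM I (\<lambda>_. borel)) (\<lambda>x. \<lambda>i\<in>I. V i x) = distr N (PiM I (\<lambda>_. borel)) (\<lambda>x. \<lambda>i\<in>I. U i x)"
proof -
  interpret M: prob_space M by fact
  interpret N: prob_space N by fact
  have mV': "(\<lambda>x. \<lambda>i\<in>I. V i x) \<in> measurable M (PiM I (\<lambda>_. borel))"
    using mV by (intro measurable_restrict) auto
  have mU': "(\<lambda>x. \<lambda>i\<in>I. U i x) \<in> measurable N (PiM I (\<lambda>_. borel))"
    using mU by (intro measurable_restrict) auto
  interpret MV: prob_space "distr M (PiM I (\<lambda>_. borel)) (\<lambda>x. \<lambda>i\<in>I. V i x)"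
    by (rule M.prob_space_distr) (rule mV')
  show ?thesis
  proof (rule measure_eqI_PiM_finite[OF I])
    fix A assume A: "\<And>i. i \<in> I \<Longrightarrow> A i \<in> sets (borel :: real measure)"
    have box: "emeasure (distr Q (PiM I (\<lambda>_. borel)) (\<lambda>x. \<lambda>i\<in>I. W i x)) (Pi\<^sub>E I A)
       = ennreal (LINT x|Q. (\<Prod>j\<in>I. indicator (A j) (W j x)))"
      if "prob_space Q" and mW: "(\<lambda>x. \<lambda>i\<in>I. W i x) \<in> measurable Q (PiM I (\<lambda>_. borel))"
      for Q :: "'c measure" and W :: "'i \<Rightarrow> 'c \<Rightarrow> real"
    proof -
      interpret Q: prob_space Q by fact
      have s: "Pi\<^sub>E I A \<in> sets (PiM I (\<lambda>_. borel))"
        using A I by (intro sets_PiM_I_finite) auto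
      have "(LINT x|Q. (\<Prod>j\<in>I. indicator (A j) (W j x))) =
          (LINT x|Q. indicat_real ((\<lambda>x. \<lambda>i\<in>I. W i x) -` Pi\<^sub>E I A \<inter> space Q) x)"
      proof (rule Bochner_Integration.integral_cong[OF refl])
        fix x assume x: "x \<in> space Q"
        show "(\<Prod>j\<in>I. indicator (A j) (W j x)) =
            (indicator ((\<lambda>x. \<lambda>i\<in>I. W i x) -` Pi\<^sub>E I A \<inter> space Q) x :: real)"
        proof (cases "\<forall>i\<in>I. W i x \<in> A i")
          case True
          then show ?thesis using x by (auto simp: PiE_iff)
        next
          case False
          then obtain i where i: "i \<in> I" "W i x \<notin> A i" by auto
          then have "(\<Prod>j\<in>I. indicator (A j) (W j x)) = (0::real)"
            by (intro prod_zero[OF I] bexI[of _ i]) auto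
          then show ?thesis using i by (auto simp: PiE_iff indicator_def)
        qed
      qed
      also have "\<dots> = measure Q ((\<lambda>x. \<lambda>i\<in>I. W i x) -` Pi\<^sub>E I A \<inter> space Q)"
        by simp
      finally have "(LINT x|Q. (\<Prod>j\<in>I. indicator (A j) (W j x))) =
          measure Q ((\<lambda>x. \<lambda>i\<in>I. W i x) -` Pi\<^sub>E I A \<inter> space Q)" .
      then show ?thesis
        by (simp only: emeasure_distr[OF mW s] Q.emeasure_eq_measure)
    qed
    have "complex_of_real (LINT x|M. (\<Prod>j\<in>I. indicator (A j) (V j x))) = of_real (LINT x|N. (\<Prod>j\<in>I. indicator (A j) (U j x)))"
      using joint_char_eq_box[OF M.finite_measure_axioms N.finite_measure_axioms I mV mU eq A order_refl, where c = "\<lambda>_. 0"]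
      by (simp add: scaleR_conv_of_real del: of_real_prod)
    then show "emeasure (distr M (PiM I (\<lambda>_. borel)) (\<lambda>x. \<lambda>i\<in>I. V i x)) (Pi\<^sub>E I A)
       = emeasure (distr N (PiM I (\<lambda>_. borel)) (\<lambda>x. \<lambda>i\<in>I. U i x)) (Pi\<^sub>E I A)"
      by (simp add: box[OF M mV'] box[OF N mU'] del: of_real_prod)
  next
    show "range (\<lambda>n::nat. Pi\<^sub>E I (\<lambda>_. UNIV :: real set)) \<subseteq> prod_algebra I (\<lambda>_. borel)"
      using I by (auto intro!: prod_algebraI_finite)
  qed (auto simp: space_PiM)
qed

subsection \<open>Centered Gaussian families\<close>

text \<open>For a centered variable the second moment alone fixes the characteristic function, also
  at variance 0, where centering forces \<open>Y = 0\<close> almost everywhere. This is how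
  covariances come to determine joint laws.\<close>

lemma gaussian_rv_char:
  assumes "prob_space M" and Y: "gaussian_rv M Y" and mean: "integral\<^sup>L M Y = 0"
  shows gaussian_rv_measurable: "Y \<in> borel_measurable M"
    and gaussian_rv_integrable: "integrable M Y"
    and gaussian_rv_integrable_square: "integrable M (\<lambda>x. (Y x)\<^sup>2)"
    and "(CLINT x|M. iexp (Y x)) = exp (- (LINT x|M. (Y x)\<^sup>2) / 2)"
    and gaussian_rv_distributed: "(LINT x|M. (Y x)\<^sup>2) > 0 \<Longrightarrow>
      distributed M lborel Y (normal_density 0 (sqrt (LINT x|M. (Y x)\<^sup>2)))"
proof -
  interpret prob_space M by fact
  have "Y \<in> borel_measurable M \<and> integrable M Y \<and> integrable M (\<lambda>x. (Y x)\<^sup>2) \<and>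
    (CLINT x|M. iexp (Y x)) = exp (- (LINT x|M. (Y x)\<^sup>2) / 2) \<and>
    ((LINT x|M. (Y x)\<^sup>2) > 0 \<longrightarrow> distributed M lborel Y (normal_density 0 (sqrt (LINT x|M. (Y x)\<^sup>2))))"
    using Y unfolding gaussian_rv_def
  proof (elim disjE exE conjE)
    fix \<mu> s :: real assume s: "s > 0" and D: "distributed M lborel Y (\<lambda>x. ennreal (normal_density \<mu> s x))"
    have \<mu>: "\<mu> = 0" using normal_distributed_expectation[OF s D] mean by simp
    note D = D[unfolded \<mu>]
    have [measurable]: "Y \<in> borel_measurable M" using D by (simp add: distributed_def)
    have i2: "integrable M (\<lambda>x. (Y x)\<^sup>2)"
      using integrable_normal_moment[OF s, of 0 2] distributed_integrable[OF D, of "\<lambda>x. x\<^sup>2"] s by simp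
    have i1: "integrable M Y"
      using integrable_normal_moment[OF s, of 0 1] distributed_integrable[OF D, of "\<lambda>x. x"] s by simp
    have v: "(LINT x|M. (Y x)\<^sup>2) = s\<^sup>2" using normal_distributed_variance[OF s D] mean by simp
    have "distributed M lborel (\<lambda>x. Y x / s) std_normal_density"
      using D normal_standard_normal_convert[OF s, of Y 0] by simp
    then have Z: "distr M borel (\<lambda>x. Y x / s) = std_normal_distribution"
      unfolding distributed_def by (metis distr_cong sets_lborel)
    have "exp (- (s\<^sup>2) / 2) = char (distr M borel (\<lambda>x. Y x / s)) s"
      unfolding Z by (simp add: char_std_normal_distribution)
    also have "\<dots> = (CLINT x|M. iexp (s * (Y x / s)))"
      unfolding char_def by (subst integral_distr) auto
    also have "\<dots> = (CLINT x|M. iexp (Y x))" using s by simp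
    finally show ?thesis using i1 i2 v D s by (simp add: real_sqrt_abs)
  next
    fix \<mu> :: real assume [measurable]: "Y \<in> borel_measurable M" and D: "distr M borel Y = return borel \<mu>"
    have "AE y in distr M borel Y. y = \<mu>" unfolding D by (simp add: AE_return)
    then have AE: "AE x in M. Y x = \<mu>" by (subst (asm) AE_distr_iff) auto
    then have "integral\<^sup>L M Y = (LINT x|M. \<mu>)" by (intro integral_cong_AE) auto
    then have \<mu>: "\<mu> = 0" using mean by (simp add: prob_space)
    have AE: "AE x in M. Y x = 0" using AE \<mu> by simp
    have "integrable M Y \<longleftrightarrow> integrable M (\<lambda>x. 0::real)" using AE by (intro integrable_cong_AE) auto
    moreover have "integrable M (\<lambda>x. (Y x)\<^sup>2) \<longleftrightarrow> integrable M (\<lambda>x. 0::real)" using AE by (intro integrable_cong_AE) auto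
    moreover have "(LINT x|M. (Y x)\<^sup>2) = (LINT x|M. 0)" using AE by (intro integral_cong_AE) auto
    moreover have "(CLINT x|M. iexp (Y x)) = (CLINT x|M. 1)" using AE by (intro integral_cong_AE) auto
    ultimately show ?thesis by (simp add: prob_space)
  qed
  then show "Y \<in> borel_measurable M" "integrable M Y" "integrable M (\<lambda>x. (Y x)\<^sup>2)"
    "(CLINT x|M. iexp (Y x)) = exp (- (LINT x|M. (Y x)\<^sup>2) / 2)"
    "(LINT x|M. (Y x)\<^sup>2) > 0 \<Longrightarrow> distributed M lborel Y (normal_density 0 (sqrt (LINT x|M. (Y x)\<^sup>2)))"
    by blast+
qed

lemma integrable_mult_of_squares:
  fixes X Y :: "'a \<Rightarrow> real"
  assumes [measurable]: "X \<in> borel_measurable M" "Y \<in> borel_measurable M"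
    and "integrable M (\<lambda>x. (X x)\<^sup>2)" "integrable M (\<lambda>x. (Y x)\<^sup>2)"
  shows "integrable M (\<lambda>x. X x * Y x)"
proof (rule Bochner_Integration.integrable_bound)
  show "integrable M (\<lambda>x. (X x)\<^sup>2 + (Y x)\<^sup>2)" using assms by simp
  have "\<bar>a * b\<bar> \<le> a\<^sup>2 + b\<^sup>2" for a b :: real
    using sum_squares_bound[of "\<bar>a\<bar>" "\<bar>b\<bar>"] mult_nonneg_nonneg[OF abs_ge_zero[of a] abs_ge_zero[of b]]
    unfolding abs_mult power2_abs by linarith
  then show "AE x in M. norm (X x * Y x) \<le> norm ((X x)\<^sup>2 + (Y x)\<^sup>2)" by (simp add: abs_mult)
qed simp

text \<open>Joint normality is encoded through linear combinations, which admits degenerate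
  families. Those do occur: the families used below contain the value at time 0, of variance
  0.\<close>

locale centered_gaussian_family = prob_space +
  fixes I :: "'i set" and V :: "'i \<Rightarrow> 'a \<Rightarrow> real"
  assumes finite_I: "finite I"
    and gauss: "\<And>c. gaussian_rv M (\<lambda>x. \<Sum>i\<in>I. c i * V i x)"
    and mean: "\<And>i. i \<in> I \<Longrightarrow> integral\<^sup>L M (V i) = 0"
begin

lemma gaussian_component: "i \<in> I \<Longrightarrow> gaussian_rv M (V i)"
  using gauss[of "\<lambda>j. if j = i then 1 else 0"] finite_I by (simp add: if_distrib[of "\<lambda>x. x * _"] cong: if_cong)

lemma
  assumes "i \<in> I"
  shows measurable_component: "V i \<in> borel_measurable M"
    and integrable_component: "integrable M (V i)"
    and integrable_component_square: "integrable M (\<lambda>x. (V i x)\<^sup>2)"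
  using gaussian_rv_measurable[OF prob_space_axioms gaussian_component[OF assms] mean[OF assms]]
    gaussian_rv_integrable[OF prob_space_axioms gaussian_component[OF assms] mean[OF assms]]
    gaussian_rv_integrable_square[OF prob_space_axioms gaussian_component[OF assms] mean[OF assms]]
  by auto

lemma integrable_component_mult: "i \<in> I \<Longrightarrow> j \<in> I \<Longrightarrow> integrable M (\<lambda>x. V i x * V j x)"
  by (intro integrable_mult_of_squares measurable_component integrable_component_square)

lemma mean_combination: "integral\<^sup>L M (\<lambda>x. \<Sum>i\<in>I. c i * V i x) = 0"
  using integrable_component mean by (simp add: Bochner_Integration.integral_sum)

lemma char_combination:
  "(CLINT x|M. iexp (\<Sum>i\<in>I. c i * V i x)) = exp (- (\<Sum>i\<in>I. \<Sum>j\<in>I. c i * c j * (LINT x|M. V i x * V j x)) / 2)"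
proof -
  have "(LINT x|M. (\<Sum>i\<in>I. c i * V i x)\<^sup>2) = (LINT x|M. (\<Sum>i\<in>I. \<Sum>j\<in>I. c i * c j * (V i x * V j x)))"
    by (simp add: power2_eq_square sum_product mult_ac)
  also have "\<dots> = (\<Sum>i\<in>I. \<Sum>j\<in>I. c i * c j * (LINT x|M. V i x * V j x))"
    using integrable_component_mult by (simp add: Bochner_Integration.integral_sum)
  finally show ?thesis
    using gaussian_rv_char(4)[OF prob_space_axioms gauss mean_combination] by simp
qed

lemma subfamily: "J \<subseteq> I \<Longrightarrow> centered_gaussian_family M J V"
proof
  assume J: "J \<subseteq> I"
  then show "finite J" using finite_I finite_subset by blast
  show "integral\<^sup>L M (V i) = 0" if "i \<in> J" for i using mean that J by auto
  show "gaussian_rv M (\<lambda>x. \<Sum>i\<in>J. c i * V i x)" for c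
  proof -
    have "(\<Sum>i\<in>I. (if i \<in> J then c i else 0) * V i x) = (\<Sum>i\<in>J. c i * V i x)" for x
      using J finite_I by (intro sum.mono_neutral_cong_right) auto
    then show ?thesis using gauss[of "\<lambda>i. if i \<in> J then c i else 0"] by simp
  qed
qed

text \<open>Uncorrelated blocks are independent, since the quadratic form in the characteristic
  function has no mixed terms. Independence is expressed by drawing block \<open>K\<close> and its
  complement from two copies of \<open>M\<close>, which prepares for Fubini.\<close>

lemma distr_uncorrelated_blocks:
  assumes K: "K \<subseteq> I" and cov: "\<And>i j. i \<in> K \<Longrightarrow> j \<in> I - K \<Longrightarrow> (LINT x|M. V i x * V j x) = 0"
  shows "distr M (PiM I (\<lambda>_. borel)) (\<lambda>x. \<lambda>i\<in>I. V i x) =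
    distr (M \<Otimes>\<^sub>M M) (PiM I (\<lambda>_. borel)) (\<lambda>z. \<lambda>i\<in>I. if i \<in> K then V i (fst z) else V i (snd z))"
proof -
  interpret P: pair_prob_space M M ..
  note [measurable] = measurable_component
  show ?thesis
  proof (rule distr_PiM_eqI_char)
    show "prob_space M" by (rule prob_space_axioms)
    show "prob_space (M \<Otimes>\<^sub>M M)" by (rule P.prob_space_axioms)
    show "finite I" by (rule finite_I)
    show "V i \<in> borel_measurable M" if "i \<in> I" for i using that by measurable
    show "(\<lambda>z. if i \<in> K then V i (fst z) else V i (snd z)) \<in> borel_measurable (M \<Otimes>\<^sub>M M)" if "i \<in> I" for i
      using that by measurable
    fix c :: "'i \<Rightarrow> real"
    interpret A: centered_gaussian_family M K V using subfamily[OF K] .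
    interpret B: centered_gaussian_family M "I - K" V using subfamily[of "I - K"] by simp
    define q where "q i j = c i * c j * (LINT x|M. V i x * V j x)" for i j
    have q0: "q i j = 0" "q j i = 0" if "i \<in> K" "j \<in> I - K" for i j
      using cov[OF that] by (simp_all add: q_def mult.commute)
    have split: "(\<Sum>i\<in>I. f i) = (\<Sum>i\<in>K. f i) + (\<Sum>i\<in>I-K. f i)" for f :: "'i \<Rightarrow> real"
      using sum.subset_diff[OF K finite_I, of f] by simp
    have "(\<Sum>i\<in>I. \<Sum>j\<in>I. q i j) = (\<Sum>i\<in>K. \<Sum>j\<in>I. q i j) + (\<Sum>i\<in>I-K. \<Sum>j\<in>I. q i j)"
      by (rule split)
    also have "(\<Sum>i\<in>K. \<Sum>j\<in>I. q i j) = (\<Sum>i\<in>K. \<Sum>j\<in>K. q i j)"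
      unfolding split by (intro sum.cong refl) (use q0 in \<open>auto intro!: sum.neutral\<close>)
    also have "(\<Sum>i\<in>I-K. \<Sum>j\<in>I. q i j) = (\<Sum>i\<in>I-K. \<Sum>j\<in>I-K. q i j)"
      unfolding split by (intro sum.cong refl) (use q0 in \<open>auto intro!: sum.neutral\<close>)
    finally have q: "(\<Sum>i\<in>I. \<Sum>j\<in>I. q i j) = (\<Sum>i\<in>K. \<Sum>j\<in>K. q i j) + (\<Sum>i\<in>I-K. \<Sum>j\<in>I-K. q i j)" .
    define S where "S x = (\<Sum>i\<in>K. c i * V i x)" for x
    define R where "R x = (\<Sum>i\<in>I-K. c i * V i x)" for x
    have [measurable]: "S \<in> borel_measurable M" "R \<in> borel_measurable M"
      unfolding S_def R_def using K by (auto intro!: borel_measurable_sum borel_measurable_times measurable_component)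
    have "(\<Sum>i\<in>I. c i * (if i \<in> K then V i (fst z) else V i (snd z))) = S (fst z) + R (snd z)" for z
      unfolding split S_def R_def by simp
    then have "(CLINT z|M \<Otimes>\<^sub>M M. iexp (\<Sum>i\<in>I. c i * (if i \<in> K then V i (fst z) else V i (snd z))))
       = (CLINT z|M \<Otimes>\<^sub>M M. iexp (S (fst z)) * iexp (R (snd z)))"
      by (simp add: distrib_left exp_add)
    also have "\<dots> = (CLINT x|M. CLINT y|M. iexp (S x) * iexp (R y))"
    proof (subst P.integral_fst'[symmetric])
      show "integrable (M \<Otimes>\<^sub>M M) (\<lambda>z. iexp (S (fst z)) * iexp (R (snd z)))"
        by (rule P.integrable_const_bound[of _ 1]) (auto simp: norm_mult)
    qed simp
    also have "\<dots> = (CLINT x|M. iexp (S x)) * (CLINT x|M. iexp (R x))" by simp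
    also have "\<dots> = exp (- (\<Sum>i\<in>I. \<Sum>j\<in>I. q i j) / 2)"
      unfolding q S_def R_def A.char_combination B.char_combination
      by (simp add: q_def mult_exp_exp flip: of_real_exp of_real_mult)
    also have "\<dots> = (CLINT x|M. iexp (\<Sum>i\<in>I. c i * V i x))"
      unfolding char_combination q_def ..
    finally show "(CLINT x|M. iexp (\<Sum>i\<in>I. c i * V i x)) =
      (CLINT z|M \<Otimes>\<^sub>M M. iexp (\<Sum>i\<in>I. c i * (if i \<in> K then V i (fst z) else V i (snd z))))" ..
  qed
qed

text \<open>Conditioning without conditional probabilities: the complement of \<open>K\<close> is
  frozen at \<open>y\<close>, only block \<open>K\<close> remains random, and the result is averaged
  over \<open>y\<close>.\<close>

lemma emeasure_uncorrelated_blocks: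
  assumes K: "K \<subseteq> I" and cov: "\<And>i j. i \<in> K \<Longrightarrow> j \<in> I - K \<Longrightarrow> (LINT x|M. V i x * V j x) = 0"
    and A: "A \<in> sets (PiM I (\<lambda>_. borel))"
  shows "emeasure M {x \<in> space M. (\<lambda>i\<in>I. V i x) \<in> A} =
    (\<integral>\<^sup>+y. emeasure M {x \<in> space M. (\<lambda>i\<in>I. if i \<in> K then V i x else V i y) \<in> A} \<partial>M)"
proof -
  interpret P: pair_prob_space M M ..
  note [measurable] = measurable_component
  have m1: "(\<lambda>x. \<lambda>i\<in>I. V i x) \<in> measurable M (PiM I (\<lambda>_. borel))"
    by (intro measurable_restrict) measurable
  have m2: "(\<lambda>z. \<lambda>i\<in>I. if i \<in> K then V i (fst z) else V i (snd z)) \<in> measurable (M \<Otimes>\<^sub>M M) (PiM I (\<lambda>_. borel))"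
    (is "?f \<in> _") by (intro measurable_restrict) measurable
  have "emeasure M {x \<in> space M. (\<lambda>i\<in>I. V i x) \<in> A} = emeasure (distr M (PiM I (\<lambda>_. borel)) (\<lambda>x. \<lambda>i\<in>I. V i x)) A"
    unfolding emeasure_distr[OF m1 A] by (intro arg_cong[of _ _ "emeasure M"]) auto
  also have "\<dots> = emeasure (M \<Otimes>\<^sub>M M) (?f -` A \<inter> space (M \<Otimes>\<^sub>M M))"
  proof -
    have "distr M (PiM I (\<lambda>_. borel)) (\<lambda>x. \<lambda>i\<in>I. V i x) = distr (M \<Otimes>\<^sub>M M) (PiM I (\<lambda>_. borel)) ?f"
      using K cov by (rule distr_uncorrelated_blocks)
    then show ?thesis by (simp only: emeasure_distr[OF m2 A])
  qed
  also have "\<dots> = (\<integral>\<^sup>+y. emeasure M ((\<lambda>x. (x, y)) -` (?f -` A \<inter> space (M \<Otimes>\<^sub>M M))) \<partial>M)"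
    by (rule P.emeasure_pair_measure_alt2) (rule measurable_sets[OF m2 A])
  also have "\<dots> = (\<integral>\<^sup>+y. emeasure M {x \<in> space M. (\<lambda>i\<in>I. if i \<in> K then V i x else V i y) \<in> A} \<partial>M)"
    by (intro nn_integral_cong arg_cong[of _ _ "emeasure M"]) (auto simp: space_pair_measure cong: if_cong)
  finally show ?thesis .
qed

lemma emeasure_component_interval_le:
  assumes i: "i \<in> I" and v: "(LINT x|M. (V i x)\<^sup>2) = v" "v > 0" and R: "R \<ge> 0"
  shows "emeasure M {x \<in> space M. V i x \<in> {a - R..a + R}} \<le> ennreal (2 * R / sqrt (2 * pi * v))"
proof -
  have D: "distributed M lborel (V i) (normal_density 0 (sqrt v))"
    using gaussian_rv_distributed[OF prob_space_axioms gaussian_component[OF i] mean[OF i]] v by simp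
  have "emeasure M {x \<in> space M. V i x \<in> {a - R..a + R}} = emeasure M (V i -` {a - R..a + R} \<inter> space M)"
    by (intro arg_cong[of _ _ "emeasure M"]) auto
  also have "\<dots> = (\<integral>\<^sup>+x. ennreal (normal_density 0 (sqrt v) x) * indicator {a - R..a + R} x \<partial>lborel)"
    by (rule distributed_emeasure[OF D]) simp
  also have "\<dots> \<le> (\<integral>\<^sup>+x. ennreal (1 / sqrt (2 * pi * v)) * indicator {a - R..a + R} x \<partial>lborel)"
  proof (intro nn_integral_mono mult_right_mono ennreal_leI)
    fix x :: real
    have "exp (- (x\<^sup>2) / (2 * v)) \<le> 1" using v by simp
    then show "normal_density 0 (sqrt v) x \<le> 1 / sqrt (2 * pi * v)"
      using v unfolding normal_density_def by (simp add: divide_right_mono)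
  qed simp
  also have "\<dots> = ennreal (1 / sqrt (2 * pi * v)) * ennreal (2 * R)"
    using R by (simp add: nn_integral_cmult_indicator)
  also have "\<dots> = ennreal (2 * R / sqrt (2 * pi * v))"
    using R v by (simp flip: ennreal_mult)
  finally show ?thesis .
qed

text \<open>Orthogonal components are independent, so the one-dimensional bounds multiply. The
  centre \<open>a\<close> is arbitrary because the density is estimated by its maximum.\<close>

lemma emeasure_orthogonal_box_le:
  assumes "J \<subseteq> I" and v: "v > 0"
    and "\<And>i. i \<in> J \<Longrightarrow> (LINT x|M. (V i x)\<^sup>2) = v"
    and "\<And>i j. i \<in> J \<Longrightarrow> j \<in> J \<Longrightarrow> i \<noteq> j \<Longrightarrow> (LINT x|M. V i x * V j x) = 0"
    and R: "R \<ge> 0"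
  shows "emeasure M {x \<in> space M. \<forall>i\<in>J. V i x \<in> {a i - R..a i + R}} \<le> ennreal (2 * R / sqrt (2 * pi * v)) ^ card J"
proof -
  have "finite J" using assms(1) finite_I finite_subset by blast
  then show ?thesis using assms(1,3,4)
  proof induction
    case empty
    then show ?case by (simp add: emeasure_space_1)
  next
    case (insert i J)
    interpret B: centered_gaussian_family M "insert i J" V using subfamily insert.prems by blast
    define A where "A = Pi\<^sub>E (insert i J) (\<lambda>i. {a i - R..a i + R})"
    have A: "A \<in> sets (PiM (insert i J) (\<lambda>_. borel))"
      unfolding A_def using insert by (intro sets_PiM_I_finite) auto
    have [measurable]: "V j \<in> borel_measurable M" if "j \<in> insert i J" for j
      using that by (rule B.measurable_component)
    have mJ: "{x \<in> space M. \<forall>j\<in>J. V j x \<in> {a j - R..a j + R}} \<in> sets M"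
      using insert.hyps by measurable
    have "{x \<in> space M. \<forall>i\<in>insert i J. V i x \<in> {a i - R..a i + R}} =
        {x \<in> space M. (\<lambda>i\<in>insert i J. V i x) \<in> A}"
      by (auto simp: A_def PiE_iff)
    also have "emeasure M \<dots> = (\<integral>\<^sup>+y. emeasure M {x \<in> space M. (\<lambda>j\<in>insert i J. if j \<in> {i} then V j x else V j y) \<in> A} \<partial>M)"
      using insert.prems(3) by (intro B.emeasure_uncorrelated_blocks A) auto
    also have "\<dots> \<le> (\<integral>\<^sup>+y. ennreal (2 * R / sqrt (2 * pi * v)) *
        indicator {x \<in> space M. \<forall>j\<in>J. V j x \<in> {a j - R..a j + R}} y \<partial>M)"
    proof (intro nn_integral_mono)
      fix y assume y: "y \<in> space M"
      \<comment> \<open>With the coordinates in \<open>J\<close> frozen at \<open>y\<close>, the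
        event either is empty or constrains \<open>V i\<close> alone.\<close>
      let ?E = "{x \<in> space M. (\<lambda>j\<in>insert i J. if j \<in> {i} then V j x else V j y) \<in> A}"
      show "emeasure M ?E \<le> ennreal (2 * R / sqrt (2 * pi * v)) *
        indicator {x \<in> space M. \<forall>j\<in>J. V j x \<in> {a j - R..a j + R}} y"
      proof (cases "\<forall>j\<in>J. V j y \<in> {a j - R..a j + R}")
        case True
        have "emeasure M ?E \<le> emeasure M {x \<in> space M. V i x \<in> {a i - R..a i + R}}"
          by (intro emeasure_mono) (auto simp: A_def PiE_iff)
        also have "\<dots> \<le> ennreal (2 * R / sqrt (2 * pi * v))"
          using insert.prems v R by (intro B.emeasure_component_interval_le) auto
        finally show ?thesis using True y by simp
      next
        case False
        then obtain j where "j \<in> J" "V j y \<notin> {a j - R..a j + R}" by blast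
        moreover from this have "j \<noteq> i" using insert.hyps by auto
        ultimately have "?E = {}" by (auto simp: A_def PiE_iff)
        then show ?thesis by (simp only: emeasure_empty) simp
      qed
    qed
    also have "\<dots> = ennreal (2 * R / sqrt (2 * pi * v)) * emeasure M {x \<in> space M. \<forall>j\<in>J. V j x \<in> {a j - R..a j + R}}"
      using mJ by (rule nn_integral_cmult_indicator)
    also have "\<dots> \<le> ennreal (2 * R / sqrt (2 * pi * v)) * ennreal (2 * R / sqrt (2 * pi * v)) ^ card J"
      using insert by (intro mult_left_mono) auto
    finally show ?case using insert.hyps by simp
  qed
qed

end

subsection \<open>Discrete Gronwall estimates and the Euler scheme\<close>

text \<open>The time average of \<open>d\<close> is bounded by the time average of \<open>a\<close>,
  not by its supremum: a forcing term that is large only during a short window then costs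
  little.\<close>

lemma discrete_gronwall:
  fixes d a :: "nat \<Rightarrow> real" and L h :: real
  assumes L: "L \<ge> 0" and h: "h \<ge> 0"
    and d: "\<And>j. j < k \<Longrightarrow> d j \<le> a j + L * (h * (\<Sum>i<j. d i))" and a: "\<And>j. j < k \<Longrightarrow> a j \<ge> 0"
  shows "h * (\<Sum>i<k. d i) \<le> exp (L * h * k) * (h * (\<Sum>i<k. a i))"
  using d a
proof (induction k)
  case 0
  then show ?case by simp
next
  case (Suc k)
  define S where "S = h * (\<Sum>i<k. d i)"
  define A where "A = h * (\<Sum>i<k. a i)"
  have IH: "S \<le> exp (L * h * k) * A" unfolding S_def A_def using Suc by simp
  have A0: "A \<ge> 0" unfolding A_def using Suc.prems h by (intro mult_nonneg_nonneg sum_nonneg) auto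
  have "d k \<le> a k + L * S" using Suc.prems(1)[of k] by (simp add: S_def)
  then have "h * (\<Sum>i<Suc k. d i) \<le> S + h * (a k + L * S)"
    using mult_left_mono[OF _ h, of "d k" "a k + L * S"] by (simp add: S_def distrib_left)
  also have "\<dots> = (1 + L * h) * S + h * a k" by (simp add: algebra_simps)
  also have "\<dots> \<le> (1 + L * h) * (exp (L * h * k) * A) + h * a k"
    using IH L h by (intro add_right_mono mult_left_mono) auto
  also have "\<dots> \<le> exp (L * h) * (exp (L * h * k) * A) + h * a k"
    using A0 by (intro add_right_mono mult_right_mono) (auto simp: exp_ge_add_one_self)
  also have "\<dots> \<le> exp (L * h) * (exp (L * h * k) * A) + exp (L * h * Suc k) * (h * a k)"
    using mult_right_mono[of 1 "exp (L * h * Suc k)" "h * a k"] L h Suc.prems(2)[of k] by simp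
  also have "\<dots> = exp (L * h * Suc k) * (h * (\<Sum>i<Suc k. a i))"
    by (simp add: A_def algebra_simps flip: exp_add)
  finally show ?case .
qed

text \<open>The drift \<open>f j\<close> already contains the step size and \<open>z j\<close> the
  factor \<sigma>, so the scheme is a deterministic function of its noise sequence.\<close>

fun euler :: "(nat \<Rightarrow> 'v \<Rightarrow> 'v) \<Rightarrow> 'v \<Rightarrow> (nat \<Rightarrow> 'v) \<Rightarrow> nat \<Rightarrow> 'v::real_normed_vector" where
  "euler f x z 0 = x"
| "euler f x z (Suc j) = euler f x z j + f j (euler f x z j) + z j"

lemma euler_eq_sum: "euler f x z j = x + (\<Sum>i<j. f i (euler f x z i)) + (\<Sum>i<j. z i)"
  by (induction j) (auto simp: algebra_simps)

text \<open>Up to a Gronwall term the runs differ by exactly the difference of their accumulated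
  noises \<open>u\<close> and \<open>w\<close>. Stating it for any sequences with the summed
  recursion allows two uses: two Euler runs with different \<xi>, and an Euler run against the
  sampled exact solution.\<close>

lemma euler_perturbation:
  fixes p q :: "nat \<Rightarrow> 'v::real_normed_vector"
  assumes L: "L \<ge> 0" and h: "h \<ge> 0"
    and f: "\<And>i y y'. i < k \<Longrightarrow> norm (f i y - f i y') \<le> L * h * norm (y - y')"
    and p: "\<And>j. j \<le> k \<Longrightarrow> p j = x + (\<Sum>i<j. f i (p i)) + u j"
    and q: "\<And>j. j \<le> k \<Longrightarrow> q j = x + (\<Sum>i<j. f i (q i)) + w j"
  shows "norm (p k - q k - (u k - w k)) \<le> L * exp (L * h * k) * (h * (\<Sum>i<k. norm (u i - w i)))"
proof -
  have 1: "norm (p j - q j - (u j - w j)) \<le> L * (h * (\<Sum>i<j. norm (p i - q i)))" if "j \<le> k" for j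
  proof -
    have "p j - q j - (u j - w j) = (\<Sum>i<j. f i (p i) - f i (q i))"
      using p[OF that] q[OF that] by (simp add: sum_subtractf algebra_simps)
    also have "norm \<dots> \<le> (\<Sum>i<j. L * h * norm (p i - q i))"
      using f that by (intro sum_norm_le) auto
    finally show ?thesis by (simp add: sum_distrib_left mult.assoc)
  qed
  have "h * (\<Sum>i<k. norm (p i - q i)) \<le> exp (L * h * k) * (h * (\<Sum>i<k. norm (u i - w i)))"
  proof (rule discrete_gronwall[OF L h])
    fix j assume "j < k"
    then show "norm (p j - q j) \<le> norm (u j - w j) + L * (h * (\<Sum>i<j. norm (p i - q i)))"
      using 1[of j] norm_triangle_sub[of "p j - q j" "u j - w j"] by simp
  qed simp
  then show ?thesis using 1[of k] L by (smt (verit) mult_left_mono mult.assoc order_refl)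
qed

lemma borel_measurable_euler:
  fixes z :: "nat \<Rightarrow> 'a \<Rightarrow> 'v::euclidean_space"
  assumes f: "\<And>i. i < k \<Longrightarrow> f i \<in> borel_measurable borel" and z: "\<And>i. i < k \<Longrightarrow> z i \<in> borel_measurable N"
  shows "(\<lambda>y. euler f x (\<lambda>i. z i y) k) \<in> borel_measurable N"
  using f z
proof (induction k)
  case (Suc k)
  have "(\<lambda>y. euler f x (\<lambda>i. z i y) k) \<in> borel_measurable N" using Suc by auto
  then show ?case
    using Suc.prems by (auto intro!: borel_measurable_add measurable_compose[of _ _ borel "f k"])
qed simp

lemma euler_cong: "(\<And>i. i < k \<Longrightarrow> z i = z' i) \<Longrightarrow> euler f x z k = euler f x z' k"
  by (induction k) auto

section \<open>Absolute continuity from a bound on balls\<close>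

text \<open>A null set lies in an open set of small Lebesgue measure. Inside that set it is covered
  by countably many non-overlapping dyadic cubes, and on a cube the bound on balls gives a multiple
  of Lebesgue measure.\<close>

lemma absolutely_continuous_lborelI_ball:
  fixes \<mu> :: "'e::euclidean_space measure"
  assumes sets: "sets \<mu> = sets borel"
    and C0: "C \<ge> 0" and C: "\<And>y r. r > 0 \<Longrightarrow> emeasure \<mu> (ball y r) \<le> ennreal (C * r ^ DIM('e))"
  shows "absolutely_continuous lborel \<mu>"
proof -
  let ?n = "DIM('e)"
  \<comment> \<open>By the l1 estimate a cube of side \<open>s\<close> has points at distance at
    most \<open>DIM('e) * s\<close> from its corner \<open>u\<close>; the factor 2 makes the
    inequality strict, as an open ball requires.\<close>
  have cube: "emeasure \<mu> (cbox u v) \<le> ennreal (C * (2 * ?n) ^ ?n) * emeasure lborel (cbox u v)"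
    if s: "s > 0" and uv: "\<And>i. i \<in> Basis \<Longrightarrow> v \<bullet> i - u \<bullet> i = s" for u v :: 'e and s
  proof -
    have "cbox u v \<subseteq> ball u (2 * ?n * s)"
    proof
      fix x assume x: "x \<in> cbox u v"
      have "norm (x - u) \<le> (\<Sum>i\<in>Basis. \<bar>(x - u) \<bullet> i\<bar>)" by (rule norm_le_l1)
      also have "\<dots> \<le> (\<Sum>i\<in>(Basis::'e set). s)"
        using x uv by (intro sum_mono) (fastforce simp: mem_box inner_diff_left)
      also have "\<dots> = ?n * s" by simp
      also have "\<dots> < 2 * ?n * s" using s by simp
      finally show "x \<in> ball u (2 * ?n * s)" by (simp add: dist_norm norm_minus_commute)
    qed
    then have "emeasure \<mu> (cbox u v) \<le> emeasure \<mu> (ball u (2 * ?n * s))"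
      by (intro emeasure_mono) (auto simp: sets)
    also have "\<dots> \<le> ennreal (C * (2 * ?n * s) ^ ?n)" using s by (intro C) simp
    also have "\<dots> = ennreal (C * (2 * ?n) ^ ?n) * ennreal (s ^ ?n)"
      using C0 s by (simp add: power_mult_distrib mult.assoc flip: ennreal_mult)
    also have "ennreal (s ^ ?n) = emeasure lborel (cbox u v)"
      using s uv by (subst emeasure_lborel_cbox) (auto simp: inner_diff_left intro: less_imp_le, smt (verit))
    finally show ?thesis .
  qed
  have bounded_null: "emeasure \<mu> S = 0" if S: "S \<in> null_sets lborel" and sub: "S \<subseteq> cbox (- c *\<^sub>R One) (c *\<^sub>R One)" and c: "c > 0"
    for S :: "'e set" and c
  proof -
    let ?a = "- c *\<^sub>R One :: 'e" and ?b = "c *\<^sub>R One :: 'e"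
    have le: "emeasure \<mu> S \<le> ennreal (C * (2 * ?n) ^ ?n) * ennreal e" if e: "e > 0" for e
    proof -
      have "S \<in> sets lebesgue" using S by auto
      then obtain U where U: "open U" "S \<subseteq> U" "U - S \<in> lmeasurable" "emeasure lebesgue (U - S) < ennreal e"
        using sets_lebesgue_outer_open[OF _ e] by metis
      have "emeasure lborel U = emeasure lebesgue U" using U(1) by (simp add: emeasure_completion)
      also have "\<dots> \<le> emeasure lebesgue (U - S) + emeasure lebesgue S"
        using U(1) \<open>S \<in> sets lebesgue\<close> emeasure_subadditive[of "U - S" lebesgue S] U(2)
        by (metis Diff_partition Un_commute fmeasurableD U(3))
      also have "emeasure lebesgue S = 0" by (rule null_setsD1[OF null_sets_completionI[OF S]])
      finally have mU: "emeasure lborel U \<le> ennreal e" using U(4) by simp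
      obtain r where r: "\<And>x. x \<in> U \<Longrightarrow> r x > 0 \<and> ball x (r x) \<subseteq> U"
        using U(1) unfolding open_contains_ball by metis
      \<comment> \<open>The gauge forces every cube tagged by a point of \<open>S\<close> into
        \<open>U\<close>; off \<open>U\<close> the radius 1 is a default value.\<close>
      define g where "g x = (if x \<in> U then ball x (r x) else ball x 1)" for x
      have g: "gauge g" unfolding gauge_def g_def using r by auto
      have box: "box ?a ?b \<noteq> {}" using c by (auto simp: box_ne_empty inner_Basis)
      obtain D where D: "countable D" "\<Union>D \<subseteq> cbox ?a ?b"
        "\<And>K. K \<in> D \<Longrightarrow> interior K \<noteq> {} \<and> (\<exists>c d. K = cbox c d)"
        "pairwise (\<lambda>A B. interior A \<inter> interior B = {}) D"
        "\<And>K. K \<in> D \<Longrightarrow> \<exists>x\<in>S \<inter> K. K \<subseteq> g x"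
        "\<And>u v. cbox u v \<in> D \<Longrightarrow> \<exists>n. \<forall>i\<in>Basis. v \<bullet> i - u \<bullet> i = (?b \<bullet> i - ?a \<bullet> i) / 2 ^ n"
        "S \<subseteq> \<Union>D"
        using covering_lemma[OF sub box g] by force
      have KU: "K \<subseteq> U" if K: "K \<in> D" for K
      proof -
        obtain z where z: "z \<in> S" "K \<subseteq> g z" using D(5)[OF K] by blast
        then have "z \<in> U" using U(2) by blast
        then show ?thesis using z(2) r[of z] by (auto simp: g_def)
      qed
      have Kb: "emeasure \<mu> K \<le> ennreal (C * (2 * ?n) ^ ?n) * emeasure lborel (interior K)" "K \<in> sets borel" if K: "K \<in> D" for K
      proof -
        obtain u v where uv: "K = cbox u v" using D(3)[OF K] by blast
        obtain n where n: "\<forall>i\<in>Basis. v \<bullet> i - u \<bullet> i = (?b \<bullet> i - ?a \<bullet> i) / 2 ^ n"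
          using D(6) K uv by blast
        have "emeasure \<mu> K \<le> ennreal (C * (2 * ?n) ^ ?n) * emeasure lborel (cbox u v)"
          unfolding uv using c n by (intro cube[of "2 * c / 2 ^ n"]) auto
        \<comment> \<open>The cubes may share faces; passing to interiors makes them disjoint at no
          cost in Lebesgue measure.\<close>
        also have "emeasure lborel (cbox u v) = emeasure lborel (interior K)"
          unfolding uv interior_cbox by (simp add: emeasure_lborel_box_eq emeasure_lborel_cbox_eq)
        finally show "emeasure \<mu> K \<le> ennreal (C * (2 * ?n) ^ ?n) * emeasure lborel (interior K)" .
        show "K \<in> sets borel" unfolding uv by simp
      qed
      \<comment> \<open>An enumeration of the possibly finite family \<open>D\<close>, padded with
        the empty set.\<close>
      define F where "F m = (if m \<in> to_nat_on D ` D then inv_into D (to_nat_on D) m else {})" for m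
      have FD: "F m \<in> D \<or> F m = {}" for m
        unfolding F_def using inv_into_into[of m "to_nat_on D" D] by auto
      have FS: "F m \<in> sets borel" for m
        using FD[of m] Kb(2)[of "F m"] by auto
      have DF: "K \<in> range F" if "K \<in> D" for K
      proof
        show "K = F (to_nat_on D K)"
          using that D(1) by (simp add: F_def inv_into_f_f[OF inj_on_to_nat_on])
      qed simp
      have Fdisj: "interior (F m) \<inter> interior (F m') = {}" if "m \<noteq> m'" for m m'
      proof (cases "F m = {} \<or> F m' = {}")
        case False
        then have "m \<in> to_nat_on D ` D" "m' \<in> to_nat_on D ` D" by (auto simp: F_def split: if_splits)
        then have "F m \<noteq> F m'"
          using that by (simp add: F_def) (metis f_inv_into_f)
        then show ?thesis using FD[of m] FD[of m'] False D(4) by (auto simp: pairwise_def)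
      qed auto
      have "emeasure \<mu> S \<le> emeasure \<mu> (\<Union>m. F m)"
      proof (rule emeasure_mono)
        show "S \<subseteq> (\<Union>m. F m)" using D(7) DF by blast
        show "(\<Union>m. F m) \<in> sets \<mu>" using FS by (auto simp: sets)
      qed
      also have "\<dots> \<le> (\<Sum>m. emeasure \<mu> (F m))"
        using FS by (intro emeasure_subadditive_countably) (auto simp: sets)
      also have "\<dots> \<le> (\<Sum>m. ennreal (C * (2 * ?n) ^ ?n) * emeasure lborel (interior (F m)))"
      proof (intro suminf_le summableI)
        show "emeasure \<mu> (F m) \<le> ennreal (C * (2 * ?n) ^ ?n) * emeasure lborel (interior (F m))" for m
          using FD[of m] Kb(1)[of "F m"] by (cases "F m = {}") auto
      qed
      also have "\<dots> = ennreal (C * (2 * ?n) ^ ?n) * (\<Sum>m. emeasure lborel (interior (F m)))"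
        by (rule ennreal_suminf_cmult)
      also have "(\<Sum>m. emeasure lborel (interior (F m))) = emeasure lborel (\<Union>m. interior (F m))"
        using Fdisj by (intro suminf_emeasure) (auto simp: disjoint_family_on_def)
      also have "emeasure lborel (\<Union>m. interior (F m)) \<le> emeasure lborel U"
      proof (intro emeasure_mono UN_least)
        show "interior (F m) \<subseteq> U" for m
          using FD[of m] KU[of "F m"] interior_subset[of "F m"] by auto
      qed (use U(1) in simp)
      also note mU
      finally show ?thesis by (simp add: mult_left_mono)
    qed
    have small: "emeasure \<mu> S \<le> 0 + ennreal d" if d: "d > 0" for d
    proof -
      define c' where "c' = C * (2 * ?n) ^ ?n"
      have c': "c' \<ge> 0" using C0 by (simp add: c'_def)
      \<comment> \<open>The constant \<open>c'\<close> may be 0, hence the division by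
        \<open>c' + 1\<close>.\<close>
      have "emeasure \<mu> S \<le> ennreal c' * ennreal (d / (c' + 1))"
        unfolding c'_def[symmetric] using le[of "d / (c' + 1)"] d c' by (simp add: c'_def)
      also have "\<dots> = ennreal (c' * (d / (c' + 1)))" using c' d by (intro ennreal_mult[symmetric]) auto
      also have "\<dots> \<le> ennreal d" using c' d by (intro ennreal_leI) (simp add: field_simps)
      finally show ?thesis by simp
    qed
    have "emeasure \<mu> S \<le> 0" by (rule ennreal_le_epsilon) (rule small)
    then show ?thesis by simp
  qed
  show ?thesis
    unfolding absolutely_continuous_def
  proof
    fix S :: "'e set" assume S: "S \<in> null_sets lborel"
    have "S \<inter> cbox (- real (Suc n) *\<^sub>R One) (real (Suc n) *\<^sub>R One) \<in> null_sets \<mu>" for n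
    proof -
      have "S \<inter> cbox (- real (Suc n) *\<^sub>R One) (real (Suc n) *\<^sub>R One) \<in> null_sets lborel"
        by (rule null_set_Int2[OF S]) simp
      then have "emeasure \<mu> (S \<inter> cbox (- real (Suc n) *\<^sub>R One) (real (Suc n) *\<^sub>R One)) = 0"
        by (rule bounded_null[of _ "real (Suc n)"]) auto
      then show ?thesis using S by (intro null_setsI) (auto simp: sets)
    qed
    then have "(\<Union>n. S \<inter> cbox (- real (Suc n) *\<^sub>R One) (real (Suc n) *\<^sub>R One)) \<in> null_sets \<mu>"
      by (intro null_sets_UN)
    moreover have "(\<Union>n. S \<inter> cbox (- real (Suc n) *\<^sub>R One) (real (Suc n) *\<^sub>R One)) = S"
    proof (intro set_eqI iffI)
      fix x assume x: "x \<in> S"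
      obtain n where n: "norm x < real n" using reals_Archimedean2 by blast
      have "x \<in> cbox (- real (Suc n) *\<^sub>R One) (real (Suc n) *\<^sub>R One)"
        using Basis_le_norm[of _ x] n by (fastforce simp: mem_box)
      then show "x \<in> (\<Union>n. S \<inter> cbox (- real (Suc n) *\<^sub>R One) (real (Suc n) *\<^sub>R One))" using x by blast
    qed auto
    ultimately show "S \<in> null_sets \<mu>" by simp
  qed
qed

subsection \<open>Second differences of a power\<close>

text \<open>With \<open>p = 2 * H\<close> and \<open>u\<close> the time remaining until t, this is
  the kernel in the covariance of \<xi> with \<open>B (t - u)\<close>. The absolute values matter in
  the last stretch of length \<open>2 * e\<close>, where the differences change sign.\<close>

definition second_diff :: "real \<Rightarrow> real \<Rightarrow> real \<Rightarrow> real" where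
  "second_diff p e u = \<bar>u\<bar> powr p - 2 * \<bar>u - e\<bar> powr p + \<bar>u - 2 * e\<bar> powr p"

lemma powr_subadditive:
  fixes a b r :: real
  assumes "a \<ge> 0" "b \<ge> 0" "r \<le> 1"
  shows "(a + b) powr r \<le> a powr r + b powr r"
proof (cases "a = 0 \<or> b = 0")
  case False
  then have a: "a > 0" and b: "b > 0" using assms by auto
  have "(a + b) powr r = (a + b) * (a + b) powr (r - 1)"
    using a b by (simp add: powr_diff)
  also have "\<dots> = a * (a + b) powr (r - 1) + b * (a + b) powr (r - 1)" by (simp add: algebra_simps)
  also have "\<dots> \<le> a * a powr (r - 1) + b * b powr (r - 1)"
    using a b assms by (intro add_mono mult_left_mono powr_mono2') auto
  also have "\<dots> = a powr r + b powr r" using a b by (simp add: powr_diff)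
  finally show ?thesis .
qed auto

context
  fixes p e :: real
  assumes p: "1 < p" "p < 2" and e: "e > 0"
begin

lemma second_diff_reflect: "second_diff p e (2 * e - u) = second_diff p e u"
  by (simp add: second_diff_def abs_minus_commute)

lemma second_diff_0: "second_diff p e 0 = (2 powr p - 2) * e powr p"
  using e by (simp add: second_diff_def powr_mult algebra_simps)

lemma second_diff_e: "second_diff p e e = 2 * e powr p"
  using e by (simp add: second_diff_def)

lemma continuous_on_second_diff: "continuous_on A (second_diff p e)"
  unfolding second_diff_def using p by (intro continuous_intros continuous_on_powr') auto

text \<open>The sign of the derivative follows from subadditivity of \<open>x powr (p - 1)\<close>,
  applied to the splittings z = (z - e) + e and e = (z - e) + (2e - z).\<close>

lemma second_diff_antimono1:
  assumes "e \<le> u" "u \<le> w" "w \<le> 2 * e"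
  shows "second_diff p e w \<le> second_diff p e u"
proof (cases "u = w")
  case False
  then have "u \<le> w" using assms by simp
  then show ?thesis
  proof (rule DERIV_nonpos_imp_decreasing_open)
    fix z assume z: "u < z" "z < w"
    define d where "d = p * z powr (p - 1) - 2 * (p * (z - e) powr (p - 1)) - p * (2 * e - z) powr (p - 1)"
    have "((\<lambda>z. z powr p - 2 * (z - e) powr p + (2 * e - z) powr p) has_real_derivative d) (at z)"
      unfolding d_def using z assms e by (auto intro!: derivative_eq_intros)
    then have "(second_diff p e has_real_derivative d) (at z)"
      by (rule has_field_derivative_transform_within_open[of _ _ _ "{e<..<2 * e}"])
         (use z assms e in \<open>auto simp: second_diff_def\<close>)
    moreover have "d \<le> 0"
    proof -
      have "z powr (p - 1) \<le> (z - e) powr (p - 1) + e powr (p - 1)"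
        using powr_subadditive[of "z - e" e "p - 1"] z assms e p by simp
      moreover have "e powr (p - 1) \<le> (z - e) powr (p - 1) + (2 * e - z) powr (p - 1)"
        using powr_subadditive[of "z - e" "2 * e - z" "p - 1"] z assms e p by simp
      ultimately have "p * (z powr (p - 1) - 2 * (z - e) powr (p - 1) - (2 * e - z) powr (p - 1)) \<le> 0"
        using p by (intro mult_nonneg_nonpos) auto
      then show ?thesis by (simp add: d_def algebra_simps)
    qed
    ultimately show "\<exists>y. (second_diff p e has_real_derivative y) (at z) \<and> y \<le> 0" by blast
  qed (rule continuous_on_second_diff)
qed simp

text \<open>Beyond \<open>2 * e\<close> the derivative is \<open>p\<close> times a second difference
  of the concave function \<open>x powr (p - 1)\<close>; concavity is used through two mean
  values.\<close>

lemma second_diff_antimono2: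
  assumes "2 * e \<le> u" "u \<le> w"
  shows "second_diff p e w \<le> second_diff p e u"
proof (cases "u = w")
  case False
  then have "u \<le> w" using assms by simp
  then show ?thesis
  proof (rule DERIV_nonpos_imp_decreasing_open)
    fix z assume z: "u < z" "z < w"
    define d where "d = p * z powr (p - 1) - 2 * (p * (z - e) powr (p - 1)) + p * (z - 2 * e) powr (p - 1)"
    have "((\<lambda>z. z powr p - 2 * (z - e) powr p + (z - 2 * e) powr p) has_real_derivative d) (at z)"
      unfolding d_def using z assms e by (auto intro!: derivative_eq_intros)
    then have "(second_diff p e has_real_derivative d) (at z)"
      by (rule has_field_derivative_transform_within_open[of _ _ _ "{2 * e<..}"])
         (use z assms e in \<open>auto simp: second_diff_def\<close>)
    moreover have "d \<le> 0"
    proof -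
      have D: "((\<lambda>x. x powr (p - 1)) has_real_derivative (p - 1) * x powr (p - 2)) (at x)" if "x > 0" for x
        using that by (auto intro!: derivative_eq_intros simp: algebra_simps)
      obtain x1 where x1: "z - e < x1" "x1 < z" "z powr (p - 1) - (z - e) powr (p - 1) = (z - (z - e)) * ((p - 1) * x1 powr (p - 2))"
        using MVT2[of "z - e" z "\<lambda>x. x powr (p - 1)" "\<lambda>x. (p - 1) * x powr (p - 2)"] D z assms e by auto
      obtain x2 where x2: "z - 2 * e < x2" "x2 < z - e"
        "(z - e) powr (p - 1) - (z - 2 * e) powr (p - 1) = ((z - e) - (z - 2 * e)) * ((p - 1) * x2 powr (p - 2))"
        using MVT2[of "z - 2 * e" "z - e" "\<lambda>x. x powr (p - 1)" "\<lambda>x. (p - 1) * x powr (p - 2)"] D z assms e by auto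
      have "x1 powr (p - 2) \<le> x2 powr (p - 2)" using x1 x2 z assms e p by (intro powr_mono2') auto
      then have "e * ((p - 1) * x1 powr (p - 2)) \<le> e * ((p - 1) * x2 powr (p - 2))"
        using e p by (intro mult_left_mono) auto
      then have "p * (z powr (p - 1) - 2 * (z - e) powr (p - 1) + (z - 2 * e) powr (p - 1)) \<le> 0"
        using p x1(3) x2(3) by (intro mult_nonneg_nonpos) auto
      then show ?thesis by (simp add: d_def algebra_simps)
    qed
    ultimately show "\<exists>y. (second_diff p e has_real_derivative y) (at z) \<and> y \<le> 0" by blast
  qed (rule continuous_on_second_diff)
qed simp

lemma second_diff_antimono: "e \<le> u \<Longrightarrow> u \<le> w \<Longrightarrow> second_diff p e w \<le> second_diff p e u"
  using second_diff_antimono1[of u w] second_diff_antimono2[of u w]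
    second_diff_antimono1[of u "2 * e"] second_diff_antimono2[of "2 * e" w]
  by (cases "w \<le> 2 * e"; cases "u \<le> 2 * e") auto

lemma second_diff_mono: "0 \<le> u \<Longrightarrow> u \<le> w \<Longrightarrow> w \<le> e \<Longrightarrow> second_diff p e u \<le> second_diff p e w"
  using second_diff_antimono[of "2 * e - w" "2 * e - u"] by (simp add: second_diff_reflect)

text \<open>Two mean value steps produce \<open>e\<^sup>2\<close> times the second derivative of the
  power at some point above \<open>u - 2 * e\<close>. Compared with \<open>e powr p\<close>, where
  \<open>p < 2\<close>, this factor is the decorrelation from the past.\<close>

lemma second_diff_bounds:
  assumes u: "2 * e < u"
  shows "0 \<le> second_diff p e u" "second_diff p e u \<le> p * (p - 1) * (u - 2 * e) powr (p - 2) * e\<^sup>2"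
proof -
  have D: "((\<lambda>x. x powr p - (x - e) powr p) has_real_derivative p * x powr (p - 1) - p * (x - e) powr (p - 1)) (at x)" if "x > e" for x
    using that e by (auto intro!: derivative_eq_intros)
  obtain x where x: "u - e < x" "x < u" and x':
    "(u powr p - (u - e) powr p) - ((u - e) powr p - (u - e - e) powr p) = (u - (u - e)) * (p * x powr (p - 1) - p * (x - e) powr (p - 1))"
    using MVT2[of "u - e" u "\<lambda>x. x powr p - (x - e) powr p" "\<lambda>x. p * x powr (p - 1) - p * (x - e) powr (p - 1)"] D e u by auto
  have D: "((\<lambda>x. x powr (p - 1)) has_real_derivative (p - 1) * x powr (p - 2)) (at x)" if "x > 0" for x
    using that by (auto intro!: derivative_eq_intros simp: algebra_simps)
  obtain y where y: "x - e < y" "y < x" and y': "x powr (p - 1) - (x - e) powr (p - 1) = (x - (x - e)) * ((p - 1) * y powr (p - 2))"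
    using MVT2[of "x - e" x "\<lambda>x. x powr (p - 1)" "\<lambda>x. (p - 1) * x powr (p - 2)"] D x u e by auto
  have "second_diff p e u = e * (p * (x powr (p - 1) - (x - e) powr (p - 1)))"
    using x' u e by (simp add: second_diff_def algebra_simps)
  then have eq: "second_diff p e u = p * (p - 1) * y powr (p - 2) * e\<^sup>2"
    unfolding y' by (simp add: power2_eq_square)
  show "0 \<le> second_diff p e u" unfolding eq using p by simp
  have "y powr (p - 2) \<le> (u - 2 * e) powr (p - 2)" using y x u p by (intro powr_mono2') auto
  then show "second_diff p e u \<le> p * (p - 1) * (u - 2 * e) powr (p - 2) * e\<^sup>2"
    unfolding eq using p by (intro mult_right_mono mult_left_mono) auto
qed

text \<open>\<open>second_diff p e\<close> increases on \<open>[0, e]\<close> and decreases afterwards, so up to a constant this is its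
  variation function on \<open>[0, \<infinity>)\<close>.\<close>

definition second_diff_var :: "real \<Rightarrow> real" where
  "second_diff_var u = second_diff p e (min u e) - second_diff p e (max u e)"

lemma second_diff_var_mono: "0 \<le> u \<Longrightarrow> u \<le> w \<Longrightarrow> second_diff_var u \<le> second_diff_var w"
  unfolding second_diff_var_def
  using e by (intro diff_mono second_diff_mono second_diff_antimono) auto

lemma abs_second_diff_le_var:
  assumes "0 \<le> u" "u \<le> w"
  shows "\<bar>second_diff p e w - second_diff p e u\<bar> \<le> second_diff_var w - second_diff_var u"
proof -
  \<comment> \<open>The function is its rising part in \<open>min z e\<close> plus its falling part
    in \<open>max z e\<close>; \<open>second_diff_var\<close> is their difference and dominates the
    increments of both.\<close>
  have dec: "second_diff p e z = second_diff p e (min z e) + second_diff p e (max z e) - second_diff p e e" for z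
    by (simp add: min_def max_def)
  show ?thesis
    unfolding dec[of u] dec[of w] second_diff_var_def
    using second_diff_mono[of "min u e" "min w e"] second_diff_antimono[of "max u e" "max w e"] assms e
    by (simp add: abs_le_iff)
qed

end

section \<open>Lower bound for sums against the second difference\<close>

text \<open>Measures the grid times within \<eta> of t. Read backwards from t, grid time
  \<open>k - Suc i\<close> is at distance \<open>Suc i * h\<close>, hence the \<open>Suc\<close>.
  The second bound inside the proof carries the induction while the indicator is 1.\<close>

lemma count_small_multiples:
  fixes h \<eta> :: real
  assumes "h > 0" "\<eta> > 0"
  shows "h * (\<Sum>i<n. if real (Suc i) * h < \<eta> then 1 else 0) \<le> \<eta>"
proof -
  have "h * (\<Sum>i<n. if real (Suc i) * h < \<eta> then 1 else 0) \<le> \<eta> \<and>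
      h * (\<Sum>i<n. if real (Suc i) * h < \<eta> then 1 else 0) \<le> real n * h"
  proof (induction n)
    case (Suc n)
    have *: "real (Suc n) * h = real n * h + h" by (simp add: algebra_simps)
    show ?case
      using Suc assms by (cases "real (Suc n) * h < \<eta>") (simp_all only: sum.lessThan_Suc distrib_left if_True if_False * mult_1_right mult_zero_right, linarith+)
  qed (use assms in simp)
  then show ?thesis ..
qed

text \<open>With \<sigma> for \<open>A\<close>, \<psi> is \<open>2 * v\<close> times the sum of
  \<sigma> against the increments of \<phi>, and the subtracted sum is the most that the Gronwall
  term can take back. Replacing \<open>A s\<close> by \<open>A t\<close> leaves a telescoping sum of
  size about \<open>(2 powr p - 2) * e powr p\<close>. Both error terms are split at distance \<eta>
  from t: nearby the window is short, farther away only variation \<kappa> is available.\<close>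

lemma second_diff_sum_lower_bound:
  fixes A :: "real \<Rightarrow> 'v::real_normed_vector \<Rightarrow> 'w::real_normed_vector"
    and p e \<eta> t \<delta> S K \<Lambda> m \<theta> h :: real
  assumes p: "1 < p" "p < 2" and e: "0 < e" "8 * e \<le> \<eta>" and \<eta>: "\<eta> \<le> t"
    and cs: "\<delta> > 0" "S \<ge> 0" "K \<ge> 0" "\<Lambda> \<ge> 0" "m > 0"
    and AS: "\<And>s w. s \<in> {0..t} \<Longrightarrow> norm (A s w) \<le> S * norm w"
    and AK: "\<And>s w. s \<in> {0..t} \<Longrightarrow> norm (A s w - A t w) \<le> K * (t - s) powr \<delta> * norm w"
    and Am: "\<And>w. m * norm w \<le> norm (A t w)"
    and \<kappa>: "second_diff p e (\<eta> / 2) \<le> \<theta> * e powr p"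
    and \<theta>: "\<theta> * (m + K * t powr \<delta> + \<Lambda> * S * t) \<le> m * (2 powr p - 2) / 4"
    and \<eta>': "4 * (K * \<eta> powr \<delta> + \<Lambda> * S * \<eta>) \<le> m * (2 powr p - 2) / 4"
    and k: "k > 0" and h: "h = t / real k" "h \<le> \<eta> / 2"
  defines "\<psi> \<equiv> \<lambda>j w. \<Sum>i<j. (second_diff p e (t - i * h) - second_diff p e (t - Suc i * h)) *\<^sub>R A (i * h) w"
  shows "m * (2 powr p - 2) / 2 * e powr p * norm w \<le> norm (\<psi> k w) - \<Lambda> * (h * (\<Sum>j<k. norm (\<psi> j w)))"
proof -
  note var_mono = second_diff_var_mono[OF p e(1)]
  note abs_le_var = abs_second_diff_le_var[OF p e(1)]
  note var_def = second_diff_var_def[OF p e(1)]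
  have t: "t > 0" and \<eta>0: "\<eta> > 0" using e \<eta> by auto
  have h0: "h > 0" using t k h by simp
  have kh: "real k * h = t" using k h by simp
  define g where "g = second_diff p e"
  define V where "V = second_diff_var p e"
  define E where "E = e powr p"
  define \<kappa> where "\<kappa> = g (\<eta> / 2)"
  define a where "a = (2 powr p - 2 :: real)"
  have E: "E > 0" using e by (simp add: E_def)
  have "2 powr 1 \<le> (2::real) powr p" using p by (intro powr_mono) auto
  then have a: "a \<ge> 0" by (simp add: a_def)
  have gt: "g t \<ge> 0" unfolding g_def using e \<eta> by (intro second_diff_bounds p) auto
  have gtk: "g t \<le> \<kappa>" unfolding g_def \<kappa>_def using e \<eta> by (intro second_diff_antimono p) auto
  have k0: "\<kappa> \<ge> 0" using gt gtk by simp
  have g0: "g 0 = a * E" unfolding g_def a_def E_def using second_diff_0[OF p e(1)] .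
  have ge: "g e = 2 * E" unfolding g_def E_def using second_diff_e[OF p e(1)] .
  \<comment> \<open>The resulting budget: total variation at most \<open>4 * E\<close>, and at most
    \<kappa> of it at distance more than \<open>\<eta> / 2\<close> from t.\<close>
  have Vt: "V t = g e - g t" and V0: "V 0 = g 0 - g e" and V\<eta>: "V (\<eta> / 2) = g e - \<kappa>"
    unfolding V_def var_def g_def \<kappa>_def using e \<eta> by (simp_all add: min_def max_def)
  have V1: "V t - V 0 \<le> 4 * E"
    unfolding Vt V0 ge g0 using gt mult_nonneg_nonneg[OF a less_imp_le[OF E]] by linarith
  have V2: "V t - V (\<eta> / 2) \<le> \<kappa>" unfolding Vt V\<eta> using gt by simp
  define \<Delta> where "\<Delta> i = g (t - real i * h) - g (t - real (Suc i) * h)" for i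
  define D where "D i = V (t - real i * h) - V (t - real (Suc i) * h)" for i
  have s_le: "real i * h \<le> t" if "i \<le> k" for i
    using that h0 unfolding kh[symmetric] by (simp add: mult_right_mono)
  have D: "\<bar>\<Delta> i\<bar> \<le> D i" if "i < k" for i
    unfolding \<Delta>_def D_def g_def V_def using s_le[of "Suc i"] that h0
    by (intro abs_le_var) (auto simp: algebra_simps)
  have D0: "D i \<ge> 0" if "i < k" for i using D[OF that] by linarith
  have sumD: "(\<Sum>i<j. D i) = V t - V (t - real j * h)" for j
    unfolding D_def using sum_lessThan_telescope'[of "\<lambda>i. V (t - real i * h)" j] by simp
  have \<psi>_le: "norm (\<psi> j w) \<le> (\<Sum>i<j. D i) * S * norm w" if "j \<le> k" for j
  proof -
    have "norm (\<psi> j w) \<le> (\<Sum>i<j. D i * (S * norm w))"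
      unfolding \<psi>_def
    proof (intro sum_norm_le)
      fix i assume "i \<in> {..<j}"
      then have i: "i < k" using that by simp
      have "norm (\<Delta> i *\<^sub>R A (real i * h) w) = \<bar>\<Delta> i\<bar> * norm (A (real i * h) w)" by simp
      also have "\<dots> \<le> D i * (S * norm w)"
        using D[OF i] D0[OF i] s_le[of i] i h0 by (intro mult_mono AS) auto
      finally show "norm ((second_diff p e (t - i * h) - second_diff p e (t - Suc i * h)) *\<^sub>R A (i * h) w) \<le> D i * (S * norm w)"
        by (simp only: \<Delta>_def g_def)
    qed
    then show ?thesis by (simp add: sum_distrib_right mult.assoc)
  qed
  \<comment> \<open>Up to step \<open>j\<close> only the variation between remaining times
    \<open>t - j * h\<close> and \<open>t\<close> has been spent: at most \<kappa> before the
    window, at most everything within it.\<close>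
  have \<psi>_le2: "norm (\<psi> j w) \<le> (\<kappa> + 4 * E * (if t - real j * h < \<eta> then 1 else 0)) * (S * norm w)" if "j < k" for j
  proof -
    have "V t - V (t - real j * h) \<le> \<kappa> + 4 * E * (if t - real j * h < \<eta> then 1 else 0)"
    proof (cases "t - real j * h < \<eta>")
      case True
      have "V 0 \<le> V (t - real j * h)" unfolding V_def using s_le[of j] that by (intro var_mono) auto
      then show ?thesis using True V1 k0 by simp
    next
      case False
      then have "V (\<eta> / 2) \<le> V (t - real j * h)" unfolding V_def using \<eta>0 by (intro var_mono) auto
      then show ?thesis using False V2 by simp
    qed
    then have "(V t - V (t - real j * h)) * (S * norm w) \<le> (\<kappa> + 4 * E * (if t - real j * h < \<eta> then 1 else 0)) * (S * norm w)"
      using cs by (intro mult_right_mono) auto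
    then show ?thesis using \<psi>_le[of j] that by (simp add: sumD mult.assoc)
  qed
  have "(\<Sum>j<k. norm (\<psi> j w)) \<le> (\<Sum>j<k. (\<kappa> + 4 * E * (if t - real j * h < \<eta> then 1 else 0)) * (S * norm w))"
    using \<psi>_le2 by (intro sum_mono) auto
  also have "\<dots> = (real k * \<kappa> + 4 * E * (\<Sum>j<k. if t - real j * h < \<eta> then 1 else 0)) * (S * norm w)"
    by (simp add: sum.distrib sum_distrib_left sum_distrib_right distrib_right)
  also have "(\<Sum>j<k. if t - real j * h < \<eta> then 1 else 0) = (\<Sum>i<k. if real (Suc i) * h < \<eta> then 1 else (0::real))"
  proof (subst sum.nat_diff_reindex[symmetric], intro sum.cong refl)
    fix i assume "i \<in> {..<k}"
    then have "t - real (k - Suc i) * h = real (Suc i) * h"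
      unfolding kh[symmetric] by (simp add: of_nat_diff algebra_simps)
    then show "(if t - real (k - Suc i) * h < \<eta> then 1 else 0) = (if real (Suc i) * h < \<eta> then 1 else (0::real))" by simp
  qed
  finally have "h * (\<Sum>j<k. norm (\<psi> j w)) \<le> h * ((real k * \<kappa> + 4 * E * (\<Sum>i<k. if real (Suc i) * h < \<eta> then 1 else 0)) * (S * norm w))"
    using h0 by (intro mult_left_mono) auto
  also have "\<dots> = (t * \<kappa> + 4 * E * (h * (\<Sum>i<k. if real (Suc i) * h < \<eta> then 1 else 0))) * (S * norm w)"
    unfolding kh[symmetric] by (simp only: algebra_simps)
  also have "\<dots> \<le> (t * \<kappa> + 4 * E * \<eta>) * (S * norm w)"
    using count_small_multiples[OF h0 \<eta>0, of k] E cs by (intro mult_right_mono add_left_mono mult_left_mono) auto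
  finally have B1: "\<Lambda> * (h * (\<Sum>j<k. norm (\<psi> j w))) \<le> \<Lambda> * ((t * \<kappa> + 4 * E * \<eta>) * (S * norm w))"
    using cs by (intro mult_left_mono) auto

  \<comment> \<open>The part of the variation \<open>D i\<close> at distance more than
    \<open>\<eta> / 2\<close> from t. Truncation by \<open>max\<close> keeps the sum telescoping,
    with total at most \<kappa>.\<close>
  define C where "C i = V (max (t - real i * h) (\<eta> / 2)) - V (max (t - real (Suc i) * h) (\<eta> / 2))" for i
  have C0: "C i \<ge> 0" if "i < k" for i
    unfolding C_def V_def using s_le[of "Suc i"] that \<eta>0 h0
    by (simp, intro var_mono) (auto simp: algebra_simps)
  have sumC: "(\<Sum>i<k. C i) \<le> \<kappa>"
  proof -
    have "(\<Sum>i<k. C i) = V (max t (\<eta> / 2)) - V (max (t - real k * h) (\<eta> / 2))"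
      unfolding C_def using sum_lessThan_telescope'[of "\<lambda>i. V (max (t - real i * h) (\<eta> / 2))" k] by simp
    also have "\<dots> = V t - V (\<eta> / 2)" using kh \<eta> \<eta>0 by (simp add: max_def)
    finally show ?thesis using V2 by simp
  qed
  have sumD': "(\<Sum>i<k. D i) \<le> 4 * E" unfolding sumD kh using V1 by simp
  \<comment> \<open>Inside the window the Hoelder factor is small, outside the variation is. As
    \<open>h \<le> \<eta> / 2\<close>, a step that starts at distance at least \<eta> ends at
    distance at least \<open>\<eta> / 2\<close>, and then \<open>C i = D i\<close>.\<close>
  have Dd: "D i * (t - real i * h) powr \<delta> \<le> \<eta> powr \<delta> * D i + t powr \<delta> * C i" if i: "i < k" for i
  proof (cases "t - real i * h < \<eta>")
    case True
    have "D i * (t - real i * h) powr \<delta> \<le> D i * \<eta> powr \<delta>"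
      using D0[OF i] True s_le[of i] i cs by (intro mult_left_mono powr_mono2) auto
    moreover have "0 \<le> t powr \<delta> * C i" using C0[OF i] by simp
    ultimately show ?thesis by (simp add: mult.commute)
  next
    case False
    then have "t - real (Suc i) * h \<ge> \<eta> / 2" using h(2) by (simp add: algebra_simps)
    then have CD: "C i = D i" using False \<eta>0 unfolding C_def D_def by (simp add: max_absorb1)
    have "(t - real i * h) powr \<delta> \<le> t powr \<delta>"
      using s_le[of i] i cs h0 by (intro powr_mono2) auto
    then have "D i * (t - real i * h) powr \<delta> \<le> D i * t powr \<delta>" using D0[OF i] by (rule mult_left_mono)
    moreover have "0 \<le> \<eta> powr \<delta> * D i" using D0[OF i] by simp
    ultimately show ?thesis using CD by (simp add: mult.commute)
  qed
  have "norm (\<Sum>i<k. \<Delta> i *\<^sub>R (A (real i * h) w - A t w)) \<le> (\<Sum>i<k. (\<eta> powr \<delta> * D i + t powr \<delta> * C i) * (K * norm w))"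
  proof (intro sum_norm_le)
    fix i assume "i \<in> {..<k}"
    then have i: "i < k" by simp
    have "norm (\<Delta> i *\<^sub>R (A (real i * h) w - A t w)) = \<bar>\<Delta> i\<bar> * norm (A (real i * h) w - A t w)" by simp
    also have "\<dots> \<le> D i * (K * (t - real i * h) powr \<delta> * norm w)"
      using D[OF i] D0[OF i] s_le[of i] i h0 by (intro mult_mono AK) auto
    also have "\<dots> = D i * (t - real i * h) powr \<delta> * (K * norm w)" by simp
    also have "\<dots> \<le> (\<eta> powr \<delta> * D i + t powr \<delta> * C i) * (K * norm w)"
      using Dd[OF i] cs by (intro mult_right_mono) auto
    finally show "norm (\<Delta> i *\<^sub>R (A (real i * h) w - A t w)) \<le> (\<eta> powr \<delta> * D i + t powr \<delta> * C i) * (K * norm w)" .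
  qed
  also have "\<dots> = (\<eta> powr \<delta> * (\<Sum>i<k. D i) + t powr \<delta> * (\<Sum>i<k. C i)) * (K * norm w)"
    by (simp add: sum.distrib sum_distrib_left sum_distrib_right distrib_right)
  also have "\<dots> \<le> (\<eta> powr \<delta> * (4 * E) + t powr \<delta> * \<kappa>) * (K * norm w)"
    using sumC sumD' cs by (intro mult_right_mono add_mono mult_left_mono) auto
  finally have B2: "norm (\<Sum>i<k. \<Delta> i *\<^sub>R (A (real i * h) w - A t w)) \<le> (\<eta> powr \<delta> * (4 * E) + t powr \<delta> * \<kappa>) * (K * norm w)" .
  have \<psi>_eq: "\<psi> k w = (\<Sum>i<k. \<Delta> i *\<^sub>R A (real i * h) w)"
    by (simp only: \<psi>_def \<Delta>_def g_def)
  have "(\<Sum>i<k. \<Delta> i) = g t - g 0"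
    unfolding \<Delta>_def using sum_lessThan_telescope'[of "\<lambda>i. g (t - real i * h)" k] kh by simp
  then have "\<psi> k w = (g t - g 0) *\<^sub>R A t w + (\<Sum>i<k. \<Delta> i *\<^sub>R (A (real i * h) w - A t w))"
    using \<psi>_eq by (simp add: scaleR_diff_right sum_subtractf flip: scaleR_sum_left)
  then have "norm (\<psi> k w) \<ge> \<bar>g t - g 0\<bar> * norm (A t w) - norm (\<Sum>i<k. \<Delta> i *\<^sub>R (A (real i * h) w - A t w))"
    by (metis norm_diff_ineq norm_scaleR)
  moreover have "(a * E - \<kappa>) * (m * norm w) \<le> \<bar>g t - g 0\<bar> * norm (A t w)"
  proof -
    have "(a * E - \<kappa>) * (m * norm w) \<le> \<bar>g t - g 0\<bar> * (m * norm w)"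
      using g0 gtk cs by (intro mult_right_mono) auto
    also have "\<dots> \<le> \<bar>g t - g 0\<bar> * norm (A t w)" using Am by (intro mult_left_mono) auto
    finally show ?thesis .
  qed
  ultimately have B3: "(a * E - \<kappa>) * (m * norm w) - (\<eta> powr \<delta> * (4 * E) + t powr \<delta> * \<kappa>) * (K * norm w) \<le> norm (\<psi> k w)"
    using B2 by linarith
  \<comment> \<open>The main term is \<open>a * E * m\<close>. All terms with \<kappa> together
    consume one quarter of it by the condition on \<theta>, the terms with \<eta> another
    quarter.\<close>
  have "a * E * m / 2 \<le> (a * E - \<kappa>) * m - (\<eta> powr \<delta> * (4 * E) + t powr \<delta> * \<kappa>) * K - \<Lambda> * ((t * \<kappa> + 4 * E * \<eta>) * S)"
  proof -
    have "\<kappa> * (m + K * t powr \<delta> + \<Lambda> * S * t) \<le> (\<theta> * E) * (m + K * t powr \<delta> + \<Lambda> * S * t)"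
      using \<kappa> cs t by (intro mult_right_mono add_nonneg_nonneg) (auto simp: \<kappa>_def g_def E_def)
    also have "\<dots> = E * (\<theta> * (m + K * t powr \<delta> + \<Lambda> * S * t))" by simp
    also have "\<dots> \<le> E * (m * a / 4)" using \<theta> E unfolding a_def by (intro mult_left_mono) auto
    finally have 1: "\<kappa> * (m + K * t powr \<delta> + \<Lambda> * S * t) \<le> E * (m * a / 4)" .
    have 2: "E * (4 * (K * \<eta> powr \<delta> + \<Lambda> * S * \<eta>)) \<le> E * (m * a / 4)"
      using \<eta>' E unfolding a_def by (intro mult_left_mono) auto
    show ?thesis using 1 2 by (simp add: algebra_simps)
  qed
  then have "a * E * m / 2 * norm w \<le> ((a * E - \<kappa>) * m - (\<eta> powr \<delta> * (4 * E) + t powr \<delta> * \<kappa>) * K - \<Lambda> * ((t * \<kappa> + 4 * E * \<eta>) * S)) * norm w"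
    by (intro mult_right_mono) auto
  then show ?thesis using B1 B3 unfolding a_def E_def by (simp add: algebra_simps)
qed

text \<open>The condition on \<eta> does not involve \<open>e\<close>, so \<eta> can be fixed before
  \<open>e\<close>; \<open>N\<close> then guarantees a mesh of at most \<open>\<eta> / 2\<close>.
  Neither \<open>e\<close> nor \<open>c\<close> depends on the mesh, as the later limit
  requires.\<close>

lemma second_diff_sum_nondegenerate:
  fixes A :: "real \<Rightarrow> 'v::real_normed_vector \<Rightarrow> 'w::real_normed_vector"
    and p t \<delta> S K \<Lambda> m :: real
  assumes p: "1 < p" "p < 2" and t: "t > 0"
    and cs: "\<delta> > 0" "S \<ge> 0" "K \<ge> 0" "\<Lambda> \<ge> 0" "m > 0"
    and AS: "\<And>s w. s \<in> {0..t} \<Longrightarrow> norm (A s w) \<le> S * norm w"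
    and AK: "\<And>s w. s \<in> {0..t} \<Longrightarrow> norm (A s w - A t w) \<le> K * (t - s) powr \<delta> * norm w"
    and Am: "\<And>w. m * norm w \<le> norm (A t w)"
  shows "\<exists>e c N. 0 < e \<and> 2 * e < t \<and> c > 0 \<and> (\<forall>k\<ge>N. \<forall>(h::real) w. k > 0 \<longrightarrow> h = t / real k \<longrightarrow>
      c * norm w \<le> norm (\<Sum>i<k. (second_diff p e (t - i * h) - second_diff p e (t - Suc i * h)) *\<^sub>R A (i * h) w)
        - \<Lambda> * (h * (\<Sum>j<k. norm (\<Sum>i<j. (second_diff p e (t - i * h) - second_diff p e (t - Suc i * h)) *\<^sub>R A (i * h) w))))"
proof -
  define a where "a = (2 powr p - 2 :: real)"
  have "2 powr 1 < (2::real) powr p" using p by (intro powr_less_mono) auto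
  then have a: "a > 0" by (simp add: a_def)
  have ma: "m * a / 4 > 0" using a cs by simp
  have lim: "((\<lambda>\<eta>. 4 * (K * \<eta> powr \<delta> + \<Lambda> * S * \<eta>)) \<longlongrightarrow> 4 * (K * 0 powr \<delta> + \<Lambda> * S * 0)) (at_right 0)"
    using cs by (auto intro!: tendsto_eq_intros tendsto_powr' eventually_at_right_less simp: eventually_at_filter)
  then have "\<forall>\<^sub>F \<eta> in at_right 0. 4 * (K * \<eta> powr \<delta> + \<Lambda> * S * \<eta>) < m * a / 4"
    using order_tendstoD(2)[OF lim, of "m * a / 4"] ma cs by simp
  moreover have "\<forall>\<^sub>F \<eta> in at_right 0. \<eta> < t" using t by (simp add: eventually_at_right_field) blast
  ultimately have "\<forall>\<^sub>F \<eta> in at_right 0. 0 < \<eta> \<and> \<eta> < t \<and> 4 * (K * \<eta> powr \<delta> + \<Lambda> * S * \<eta>) < m * a / 4"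
    using eventually_at_right_less[of 0] by eventually_elim auto
  then obtain \<eta> where \<eta>: "0 < \<eta>" "\<eta> < t" "4 * (K * \<eta> powr \<delta> + \<Lambda> * S * \<eta>) < m * a / 4"
    using eventually_happens' trivial_limit_at_right_real by (metis (mono_tags, lifting))
  \<comment> \<open>\<open>e < \<eta> / 8\<close> gives
    \<open>\<eta> / 2 - 2 * e \<ge> \<eta> / 4\<close>, so \<open>second_diff_bounds\<close> at
    \<open>\<eta> / 2\<close> yields \<open>G * e\<^sup>2\<close>. Splitting off
    \<open>e powr p\<close> leaves \<theta> = \<open>G * e powr (2 - p)\<close>, which tends to 0
    with \<open>e\<close>.\<close>
  define G where "G = p * (p - 1) * (\<eta> / 4) powr (p - 2)"
  define B where "B = m + K * t powr \<delta> + \<Lambda> * S * t"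
  have B: "B > 0" unfolding B_def using cs t by (intro add_pos_nonneg) auto
  have lim': "((\<lambda>e. G * e powr (2 - p) * B) \<longlongrightarrow> G * 0 powr (2 - p) * B) (at_right 0)"
    using p by (auto intro!: tendsto_eq_intros tendsto_powr' simp: eventually_at_filter)
  then have "\<forall>\<^sub>F e in at_right 0. G * e powr (2 - p) * B < m * a / 4"
    using order_tendstoD(2)[OF lim', of "m * a / 4"] ma p by simp
  moreover have "\<forall>\<^sub>F e in at_right 0. e < \<eta> / 8" using \<eta> by (intro eventually_at_rightI[of 0 "\<eta> / 8"]) auto
  ultimately have "\<forall>\<^sub>F e in at_right 0. 0 < e \<and> e < \<eta> / 8 \<and> G * e powr (2 - p) * B < m * a / 4"
    using eventually_at_right_less[of 0] by eventually_elim auto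
  then obtain e where e: "0 < e" "e < \<eta> / 8" "G * e powr (2 - p) * B < m * a / 4"
    using eventually_happens' trivial_limit_at_right_real by (metis (mono_tags, lifting))
  have "second_diff p e (\<eta> / 2) \<le> p * (p - 1) * (\<eta> / 2 - 2 * e) powr (p - 2) * e\<^sup>2"
    using e by (intro second_diff_bounds p) auto
  also have "\<dots> \<le> p * (p - 1) * (\<eta> / 4) powr (p - 2) * e\<^sup>2"
    using p e \<eta> by (intro mult_right_mono mult_left_mono powr_mono2') auto
  also have "e\<^sup>2 = e powr (2 - p) * e powr p" using e by (simp flip: powr_add)
  finally have \<kappa>: "second_diff p e (\<eta> / 2) \<le> (G * e powr (2 - p)) * e powr p" by (simp add: G_def mult.assoc)
  obtain N where N: "real N > t / (\<eta> / 2)" using reals_Archimedean2 by blast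
  have "m * a / 2 * e powr p * norm w \<le> norm (\<Sum>i<k. (second_diff p e (t - i * h) - second_diff p e (t - Suc i * h)) *\<^sub>R A (i * h) w)
        - \<Lambda> * (h * (\<Sum>j<k. norm (\<Sum>i<j. (second_diff p e (t - i * h) - second_diff p e (t - Suc i * h)) *\<^sub>R A (i * h) w)))"
    if k: "N \<le> k" "k > 0" and h: "h = t / real k" for k w and h :: real
  proof -
    have "t < real N * (\<eta> / 2)" using N \<eta>(1) by (simp add: pos_divide_less_eq)
    also have "\<dots> \<le> real k * (\<eta> / 2)" using k(1) \<eta>(1) by (intro mult_right_mono) auto
    finally have "h \<le> \<eta> / 2" unfolding h using k(2) by (simp add: pos_divide_le_eq mult.commute)
    then show ?thesis
      unfolding a_def using p e \<eta> cs k h \<kappa>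
      by (intro second_diff_sum_lower_bound[where \<eta> = \<eta> and \<delta> = \<delta> and S = S and K = K and \<theta> = "G * e powr (2 - p)"] AS AK Am)
         (auto simp: a_def B_def)
  qed
  then show ?thesis
    using e \<eta> cs a by (intro exI[of _ e] exI[of _ "m * a / 2 * e powr p"] exI[of _ N]) auto
qed

subsection \<open>Pathwise integrals and convergence of the Euler scheme\<close>

lemma has_pathwise_integralE:
  assumes "has_pathwise_integral f g a b J" "e > 0"
  obtains d where "d > 0" "\<forall>p. p tagged_division_of {a..b} \<longrightarrow> (\<lambda>\<xi>. ball \<xi> d) fine p \<longrightarrow>
    norm ((\<Sum>(\<xi>, K)\<in>p. f \<xi> *v (g (Sup K) - g (Inf K))) - J) < e"
  using assms unfolding has_pathwise_integral_def by blast

lemma sum_lessThan_add: "(\<Sum>i<n + m. F i) = (\<Sum>i<n. F i) + (\<Sum>i<m. F (n + i))"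
  for F :: "nat \<Rightarrow> 'a::comm_monoid_add"
  by (induction m) (auto simp: add.assoc)

lemma increasing_sequence_less:
  fixes x :: "nat \<Rightarrow> real"
  assumes x: "\<And>i. i < n \<Longrightarrow> x i < x (Suc i)" and "i < j" "j \<le> n"
  shows "x i < x j"
  using assms(2,3)
proof (induction j)
  case (Suc j)
  then show ?case using x[of j] by (cases "i = j") auto
qed simp

lemma tagged_division_of_increasing_sequence:
  fixes x :: "nat \<Rightarrow> real"
  assumes "n > 0" "\<And>i. i < n \<Longrightarrow> x i < x (Suc i)"
  shows "(\<lambda>i. (x i, {x i..x (Suc i)})) ` {..<n} tagged_division_of {x 0..x n}"
  using assms
proof (induction n)
  case (Suc n)
  show ?case
  proof (cases "n = 0")
    case True
    then show ?thesis using Suc.prems(2)[of 0] tagged_division_of_self[of "x 0" "x 0" "x 1"]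
      by (simp add: cbox_interval lessThan_Suc)
  next
    case False
    have mono: "x 0 \<le> x n"
      using increasing_sequence_less[of n x 0 n] Suc.prems False by simp
    have "(\<lambda>i. (x i, {x i..x (Suc i)})) ` {..<n} \<union> {(x n, {x n..x (Suc n)})} tagged_division_of {x 0..x n} \<union> {x n..x (Suc n)}"
    proof (rule tagged_division_Un)
      show "(\<lambda>i. (x i, {x i..x (Suc i)})) ` {..<n} tagged_division_of {x 0..x n}" using Suc False by auto
      show "{(x n, {x n..x (Suc n)})} tagged_division_of {x n..x (Suc n)}"
        using tagged_division_of_self[of "x n" "x n" "x (Suc n)"] Suc.prems(2)[of n] by (simp add: cbox_interval)
      show "interior {x 0..x n} \<inter> interior {x n..x (Suc n)} = {}" by (auto simp: interior_atLeastAtMost_real)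
    qed
    moreover have "{x 0..x n} \<union> {x n..x (Suc n)} = {x 0..x (Suc n)}"
      using mono Suc.prems(2)[of n] by (intro ivl_disj_un_two_touch) auto
    ultimately show ?thesis by (simp add: lessThan_Suc insert_commute)
  qed
qed simp

text \<open>Left-point sums along a grid are among the admissible Riemann sums. Strict increase
  makes the tagged intervals distinct, so that a sum over a set of pairs becomes a sum over
  indices.\<close>

lemma pathwise_sum_of_increasing_sequence:
  fixes x :: "nat \<Rightarrow> real"
  assumes d: "\<And>p. p tagged_division_of {a..b} \<Longrightarrow> (\<lambda>\<xi>. ball \<xi> d) fine p \<Longrightarrow>
        norm ((\<Sum>(\<xi>, K)\<in>p. f \<xi> *v (g (Sup K) - g (Inf K))) - J) < e"
    and n: "n > 0" and x: "\<And>i. i < n \<Longrightarrow> x i < x (Suc i)" "\<And>i. i < n \<Longrightarrow> x (Suc i) < x i + d"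
    and ab: "x 0 = a" "x n = b"
  shows "norm ((\<Sum>i<n. f (x i) *v (g (x (Suc i)) - g (x i))) - J) < e"
proof -
  have smono: "x i < x j" if "i < j" "j \<le> n" for i j
    using increasing_sequence_less[of n x i j] x(1) that by blast
  let ?P = "(\<lambda>i. (x i, {x i..x (Suc i)})) ` {..<n}"
  have "?P tagged_division_of {a..b}"
    using tagged_division_of_increasing_sequence[of n x] n x(1) ab by simp
  moreover have "(\<lambda>\<xi>. ball \<xi> d) fine ?P"
    using x by (fastforce simp: fine_def dist_real_def)
  ultimately have "norm ((\<Sum>(\<xi>, K)\<in>?P. f \<xi> *v (g (Sup K) - g (Inf K))) - J) < e" by (rule d)
  moreover have "inj_on (\<lambda>i. (x i, {x i..x (Suc i)})) {..<n}"
    using smono by (intro inj_onI) (metis Pair_inject lessThan_iff less_imp_le linorder_neqE_nat order_less_irrefl)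
  ultimately show ?thesis
    using x(1) by (simp add: sum.reindex less_imp_le)
qed

text \<open>One Riemann sum over \<open>[0, t]\<close> is compared with another one that agrees with it on \<open>[s, t]\<close> and
  is much finer on \<open>[0, s]\<close>; this makes the convergence uniform in the upper limit \<open>s\<close>.\<close>

lemma pathwise_sums_uniform:
  fixes f :: "real \<Rightarrow> real ^ 'n ^ 'm" and t e :: real
  assumes t: "t > 0" and e: "e > 0"
    and J: "\<And>s. s \<in> {0..t} \<Longrightarrow> has_pathwise_integral f g 0 s (J s)"
  obtains N where "\<And>k j (h::real). k \<ge> N \<Longrightarrow> j \<le> k \<Longrightarrow> k > 0 \<Longrightarrow> h = t / real k \<Longrightarrow>
    norm ((\<Sum>i<j. f (i * h) *v (g (Suc i * h) - g (i * h))) - J (j * h)) < 3 * e"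
proof -
  have J_t: "has_pathwise_integral f g 0 t (J t)" using J[of t] t by auto
  obtain d where d: "d > 0" "\<forall>p. p tagged_division_of {0..t} \<longrightarrow> (\<lambda>\<xi>. ball \<xi> d) fine p \<longrightarrow>
        norm ((\<Sum>(\<xi>, K)\<in>p. f \<xi> *v (g (Sup K) - g (Inf K))) - J t) < e"
    by (rule has_pathwise_integralE[OF J_t e])
  obtain N where N: "real N > t / d" using reals_Archimedean2 by blast
  have "norm ((\<Sum>i<j. f (i * h) *v (g (Suc i * h) - g (i * h))) - J (j * h)) < 3 * e"
    if k: "N \<le> k" "k > 0" and j: "j \<le> k" and h: "h = t / real k" for k j and h :: real
  proof (cases "j = 0")
    case True
    \<comment> \<open>The integral over \<open>{0..0}\<close> vanishes: its single degenerate tagged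
      interval contributes 0.\<close>
    have "norm (J 0) < e'" if "e' > 0" for e'
    proof -
      have J_0: "has_pathwise_integral f g 0 0 (J 0)" using J[of 0] t by auto
  obtain d' where d': "d' > 0" "\<forall>p. p tagged_division_of {0..0} \<longrightarrow> (\<lambda>\<xi>. ball \<xi> d') fine p \<longrightarrow>
        norm ((\<Sum>(\<xi>, K)\<in>p. f \<xi> *v (g (Sup K) - g (Inf K))) - J 0) < e'"
      by (rule has_pathwise_integralE[OF J_0 \<open>e' > 0\<close>])
      show ?thesis
        using d'(2)[rule_format, of "{(0, {0})}"] d'(1) tagged_division_of_self[of "0::real" 0 0] by (simp add: fine_def)
    qed
    then have "norm (J 0) < 3 * e" using e by simp
    then show ?thesis using True by simp
  next
    case False
    have h0: "h > 0" using t k h by simp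
    have kh: "real k * h = t" using k h by simp
    have "t < real N * d" using N d(1) by (simp add: pos_divide_less_eq)
    also have "\<dots> \<le> real k * d" using k(1) d(1) by (intro mult_right_mono) auto
    finally have hd: "h < d" unfolding h using k(2) by (simp add: pos_divide_less_eq mult.commute)
    define s where "s = real j * h"
    have s0: "s > 0" using False h0 by (simp add: s_def)
    have st: "s \<le> t" using j h0 unfolding s_def kh[symmetric] by (intro mult_right_mono) auto
    have J_s: "has_pathwise_integral f g 0 s (J s)" using J[of s] s0 st by auto
  obtain d' where d': "d' > 0" "\<forall>p. p tagged_division_of {0..s} \<longrightarrow> (\<lambda>\<xi>. ball \<xi> d') fine p \<longrightarrow>
        norm ((\<Sum>(\<xi>, K)\<in>p. f \<xi> *v (g (Sup K) - g (Inf K))) - J s) < e"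
    by (rule has_pathwise_integralE[OF J_s e])
    \<comment> \<open>The fine mesh must satisfy two gauges: \<open>d'\<close> for the integral up
      to \<open>s\<close> and \<open>d\<close> for the composite grid on \<open>[0, t]\<close>. Only
      \<open>d'\<close> depends on \<open>s\<close>, and \<open>N\<close> was chosen from
      \<open>d\<close> alone.\<close>
    obtain n where n: "real n > s / min d d'" using reals_Archimedean2 by blast
    have "s / min d d' > 0" using s0 d(1) d'(1) by simp
    then have n0: "n > 0" using n by (intro Nat.gr0I) auto
    define h' where "h' = s / real n"
    have h'0: "h' > 0" using s0 n0 by (simp add: h'_def)
    have nh': "real n * h' = s" using n0 by (simp add: h'_def)
    have "s < real n * min d d'" using n d(1) d'(1) by (simp add: pos_divide_less_eq del: min_less_iff_conj)
    then have hd': "h' < min d d'" unfolding h'_def using n0 by (subst pos_divide_less_eq) (simp_all only: mult.commute of_nat_0_less_iff)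
    define F where "F u v = f u *v (g v - g u)" for u v
    have A1: "norm ((\<Sum>i<k. F (i * h) (Suc i * h)) - J t) < e"
      unfolding F_def
      by (rule pathwise_sum_of_increasing_sequence[of 0 t d f g "J t" e k "\<lambda>i. real i * h", OF d(2)[rule_format]])
         (use k h0 hd kh in \<open>auto simp: algebra_simps\<close>)
    have A2: "norm ((\<Sum>i<n. F (i * h') (Suc i * h')) - J s) < e"
      unfolding F_def
      by (rule pathwise_sum_of_increasing_sequence[of 0 s d' f g "J s" e n "\<lambda>i. real i * h'", OF d'(2)[rule_format]])
         (use n0 h'0 hd' nh' in \<open>auto simp: algebra_simps\<close>)
    \<comment> \<open>The composite grid: \<open>n\<close> fine steps up to \<open>s\<close>, then
      the original steps up to \<open>t\<close>.\<close>
    define y where "y i = (if i \<le> n then real i * h' else s + real (i - n) * h)" for i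
    have A3: "norm ((\<Sum>i<n + (k - j). F (y i) (y (Suc i))) - J t) < e"
      unfolding F_def
    proof (rule pathwise_sum_of_increasing_sequence[of 0 t d f g "J t" e "n + (k - j)" y, OF d(2)[rule_format]])
      have ys: "y (Suc i) = y i + (if i < n then h' else h)" for i
        using nh' by (cases "i = n") (auto simp: y_def Suc_diff_le algebra_simps)
      show "y i < y (Suc i)" "y (Suc i) < y i + d" for i using ys[of i] h0 h'0 hd hd' by auto
      have "s + real (k - j) * h = t" unfolding s_def kh[symmetric] using j by (simp add: of_nat_diff algebra_simps)
      then show "y (n + (k - j)) = t" using nh' by (auto simp: y_def)
    qed (use n0 in \<open>auto simp: y_def\<close>)
    have "(\<Sum>i<n + (k - j). F (y i) (y (Suc i))) = (\<Sum>i<n. F (y i) (y (Suc i))) + (\<Sum>i<k - j. F (y (n + i)) (y (Suc (n + i))))"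
      by (rule sum_lessThan_add)
    also have "(\<Sum>i<n. F (y i) (y (Suc i))) = (\<Sum>i<n. F (i * h') (Suc i * h'))"
      by (intro sum.cong refl) (auto simp: y_def)
    also have "(\<Sum>i<k - j. F (y (n + i)) (y (Suc (n + i)))) = (\<Sum>i<k - j. F ((j + i) * h) (Suc (j + i) * h))"
      using nh' by (intro sum.cong refl) (auto simp: y_def s_def algebra_simps)
    finally have B1: "(\<Sum>i<n + (k - j). F (y i) (y (Suc i))) = (\<Sum>i<n. F (i * h') (Suc i * h')) + (\<Sum>i<k - j. F ((j + i) * h) (Suc (j + i) * h))" .
    have "(\<Sum>i<j + (k - j). F (i * h) (Suc i * h)) = (\<Sum>i<j. F (i * h) (Suc i * h)) + (\<Sum>i<k - j. F ((j + i) * h) (Suc (j + i) * h))"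
      by (rule sum_lessThan_add)
    then have B2: "(\<Sum>i<k. F (i * h) (Suc i * h)) = (\<Sum>i<j. F (i * h) (Suc i * h)) + (\<Sum>i<k - j. F ((j + i) * h) (Suc (j + i) * h))"
      using j by simp
    \<comment> \<open>The common tail over \<open>[s, t]\<close> cancels, which leaves three errors,
      each below \<open>e\<close>.\<close>
    have "(\<Sum>i<j. F (i * h) (Suc i * h)) - J s =
       ((\<Sum>i<k. F (i * h) (Suc i * h)) - J t) - ((\<Sum>i<n + (k - j). F (y i) (y (Suc i))) - J t) + ((\<Sum>i<n. F (i * h') (Suc i * h')) - J s)"
      unfolding B1 B2 by simp
    also have "norm \<dots> < e + e + e"
      using A1 A2 A3 by (smt (verit) norm_triangle_ineq norm_triangle_ineq4)
    finally show ?thesis unfolding F_def s_def by simp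
  qed
  then show thesis by (rule that)
qed

lemma integral_left_sum_error:
  fixes \<beta> :: "real \<Rightarrow> 'v::euclidean_space"
  assumes I: "\<And>s. s \<in> {0..t} \<Longrightarrow> (\<beta> has_integral I s) {0..s}"
    and h: "h > 0" "real k * h \<le> t"
    and \<omega>: "\<And>r s. r \<in> {0..t} \<Longrightarrow> s \<in> {0..t} \<Longrightarrow> \<bar>r - s\<bar> \<le> h \<Longrightarrow> norm (\<beta> r - \<beta> s) \<le> \<omega>" and "\<omega> \<ge> 0"
  shows "norm (I (real k * h) - h *\<^sub>R (\<Sum>i<k. \<beta> (real i * h))) \<le> real k * h * \<omega>"
  using h(2)
proof (induction k)
  case 0
  then have "I 0 = 0" using I[of 0] has_integral_refl(1)[of \<beta> 0] by (auto dest: has_integral_unique)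
  then show ?case by simp
next
  case (Suc k)
  define a b where "a = real k * h" and "b = real (Suc k) * h"
  have ab: "0 \<le> a" "a \<le> b" "b \<le> t" "b - a = h" using h Suc.prems by (auto simp: a_def b_def algebra_simps)
  have int: "\<beta> integrable_on {a..b}"
    using I[of b] ab by (intro integrable_subinterval_real[of \<beta> 0 b a b]) auto
  have "(\<beta> has_integral I a + integral {a..b} \<beta>) {0..b}"
    using ab I[of a] int by (intro has_integral_combine[of 0 a b]) (auto simp: integrable_integral)
  then have "I b = I a + integral {a..b} \<beta>" using I[of b] ab by (auto dest: has_integral_unique)
  then have "((\<lambda>r. \<beta> r - \<beta> a) has_integral (I b - I a) - h *\<^sub>R \<beta> a) {a..b}"
    using int ab has_integral_const_real[of "\<beta> a" a b]
    by (intro has_integral_diff) (auto simp: integrable_integral)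
  then have 1: "norm ((I b - I a) - h *\<^sub>R \<beta> a) \<le> \<omega> * h"
    using has_integral_bound_real[of \<omega> "{}" "\<lambda>r. \<beta> r - \<beta> a" _ a b] ab \<omega> \<open>\<omega> \<ge> 0\<close> by auto
  have 2: "norm (I a - h *\<^sub>R (\<Sum>i<k. \<beta> (real i * h))) \<le> a * \<omega>"
    using Suc ab unfolding a_def b_def by auto
  have "I b - h *\<^sub>R (\<Sum>i<Suc k. \<beta> (real i * h)) = (I a - h *\<^sub>R (\<Sum>i<k. \<beta> (real i * h))) + ((I b - I a) - h *\<^sub>R \<beta> a)"
    by (simp add: a_def scaleR_add_right)
  also have "norm \<dots> \<le> a * \<omega> + \<omega> * h" by (rule norm_triangle_mono[OF 2 1])
  finally show ?case by (simp add: a_def b_def algebra_simps)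
qed

text \<open>The exact solution sampled on the grid is itself an Euler run with modified noise, so
  convergence reduces to convergence of Riemann sums, uniformly in the upper limit.\<close>

lemma euler_tendsto_solution:
  fixes b :: "real \<Rightarrow> real ^ 'n \<Rightarrow> real ^ 'n" and \<sigma> :: "real \<Rightarrow> real ^ 'm ^ 'n"
  assumes t: "t > 0" and L: "L \<ge> 0"
    and Lip: "\<And>s y z. s \<in> {0..t} \<Longrightarrow> norm (b s y - b s z) \<le> L * norm (y - z)"
    and cont: "continuous_on {0..t} (\<lambda>s. b s (X s))"
    and I: "\<And>s. s \<in> {0..t} \<Longrightarrow> ((\<lambda>s. b s (X s)) has_integral I s) {0..s}"
    and J: "\<And>s. s \<in> {0..t} \<Longrightarrow> has_pathwise_integral \<sigma> B 0 s (J s)"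
    and X: "\<And>s. s \<in> {0..t} \<Longrightarrow> X s = x + I s + J s"
  shows "(\<lambda>k. euler (\<lambda>i y. (t / k) *\<^sub>R b (i * (t / k)) y) x
      (\<lambda>i. \<sigma> (i * (t / k)) *v (B (Suc i * (t / k)) - B (i * (t / k)))) k) \<longlonglongrightarrow> X t"
proof -
  define Q where "Q = 1 + L * exp (L * t) * t"
  have Q: "Q > 0" unfolding Q_def using L t by (intro add_pos_nonneg) auto
  show ?thesis
  proof (rule LIMSEQ_I)
    fix r :: real assume r: "r > 0"
    \<comment> \<open>Noise sums contribute \<open>3 * e\<close> and drift sums \<open>e\<close>;
      Gronwall amplifies the total by at most \<open>Q\<close>, which gives
      \<open>r / 2\<close>.\<close>
    define e where "e = r / (8 * Q)"
    define \<omega> where "\<omega> = e / t"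
    have e: "e > 0" "\<omega> > 0" using r Q t by (auto simp: e_def \<omega>_def)
    have "uniformly_continuous_on {0..t} (\<lambda>s. b s (X s))"
      using cont by (intro compact_uniformly_continuous) auto
    then obtain d where d: "d > 0" "\<And>u s. u \<in> {0..t} \<Longrightarrow> s \<in> {0..t} \<Longrightarrow> dist s u < d \<Longrightarrow> dist (b s (X s)) (b u (X u)) < \<omega>"
      using e(2) unfolding uniformly_continuous_on_def by metis
    obtain N1 where N1: "\<And>k j (h::real). k \<ge> N1 \<Longrightarrow> j \<le> k \<Longrightarrow> k > 0 \<Longrightarrow> h = t / real k \<Longrightarrow>
        norm ((\<Sum>i<j. \<sigma> (i * h) *v (B (Suc i * h) - B (i * h))) - J (j * h)) < 3 * e"
      using pathwise_sums_uniform[OF t e(1) J] by blast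
    obtain N2 where N2: "real N2 > t / d" using reals_Archimedean2 by blast
    show "\<exists>N. \<forall>k\<ge>N. norm (euler (\<lambda>i y. (t / k) *\<^sub>R b (i * (t / k)) y) x
      (\<lambda>i. \<sigma> (i * (t / k)) *v (B (Suc i * (t / k)) - B (i * (t / k)))) k - X t) < r"
    proof (intro exI allI impI)
      fix k assume "max 1 (max N1 N2) \<le> k"
      then have k: "k > 0" "N1 \<le> k" "N2 \<le> k" by auto
      define h where "h = t / real k"
      have h0: "h > 0" using t k by (simp add: h_def)
      have kh: "real k * h = t" using k by (simp add: h_def)
      have "t < real N2 * d" using N2 d(1) by (simp add: pos_divide_less_eq)
      also have "\<dots> \<le> real k * d" using k d(1) by (intro mult_right_mono) auto
      finally have hd: "h < d" unfolding h_def using k by (simp add: pos_divide_less_eq mult.commute)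
      define f where "f i y = h *\<^sub>R b (real i * h) y" for i y
      define z where "z i = \<sigma> (real i * h) *v (B (real (Suc i) * h) - B (real i * h))" for i
      define p where "p = euler f x z"
      define q where "q j = X (real j * h)" for j
      \<comment> \<open>The accumulated noise that makes the recursion exact for the sampled
        solution.\<close>
      define w where "w j = q j - x - (\<Sum>i<j. f i (q i))" for j
      have jh: "real j * h \<in> {0..t}" if "j \<le> k" for j
        using that h0 unfolding kh[symmetric] by (auto intro: mult_right_mono)
      have err: "norm ((\<Sum>i<j. z i) - w j) \<le> 4 * e" if j: "j \<le> k" for j
      proof -
        have "norm (I (real j * h) - h *\<^sub>R (\<Sum>i<j. b (real i * h) (X (real i * h)))) \<le> real j * h * \<omega>"
        proof (rule integral_left_sum_error[where t = t and \<beta> = "\<lambda>s. b s (X s)", OF I])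
          fix r s assume "r \<in> {0..t}" "s \<in> {0..t}" "\<bar>r - s\<bar> \<le> h"
          then show "norm (b r (X r) - b s (X s)) \<le> \<omega>"
            using d(2)[of s r] hd by (simp add: dist_norm)
        qed (use h0 jh[OF j] e in auto)
        also have "\<dots> \<le> t * \<omega>" using jh[OF j] e by (intro mult_right_mono) auto
        also have "\<dots> = e" using t by (simp add: \<omega>_def)
        finally have 1: "norm (I (real j * h) - h *\<^sub>R (\<Sum>i<j. b (real i * h) (X (real i * h)))) \<le> e" .
        have 2: "norm ((\<Sum>i<j. z i) - J (real j * h)) < 3 * e"
          unfolding z_def using N1[OF k(2) j k(1) h_def] .
        have "(\<Sum>i<j. z i) - w j = ((\<Sum>i<j. z i) - J (real j * h)) - (I (real j * h) - h *\<^sub>R (\<Sum>i<j. b (real i * h) (X (real i * h))))"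
          unfolding w_def q_def f_def using X[OF jh[OF j]] by (simp add: scaleR_sum_right)
        then show ?thesis using 1 2 norm_triangle_ineq4 by (smt (verit))
      qed
      have "norm (p k - q k - ((\<Sum>i<k. z i) - w k)) \<le> L * exp (L * h * k) * (h * (\<Sum>i<k. norm ((\<Sum>j<i. z j) - w i)))"
      proof (rule euler_perturbation[OF L])
        show "h \<ge> 0" using h0 by simp
        show "norm (f i y - f i y') \<le> L * h * norm (y - y')" if "i < k" for i y y'
        proof -
          have "norm (f i y - f i y') = h * norm (b (real i * h) y - b (real i * h) y')"
            unfolding f_def using h0 by (simp flip: scaleR_diff_right)
          also have "\<dots> \<le> h * (L * norm (y - y'))" using h0 jh[of i] that by (intro mult_left_mono Lip) auto
          finally show ?thesis by (simp add: mult_ac)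
        qed
        show "p j = x + (\<Sum>i<j. f i (p i)) + (\<Sum>i<j. z i)" for j unfolding p_def by (rule euler_eq_sum)
        show "q j = x + (\<Sum>i<j. f i (q i)) + w j" for j by (simp add: w_def)
      qed
      also have "\<dots> \<le> L * exp (L * h * k) * (h * (\<Sum>i<k. 4 * e))"
        using L h0 err by (intro mult_left_mono sum_mono) auto
      also have "\<dots> = L * exp (L * t) * t * (4 * e)"
        using kh by (simp add: mult_ac)
      finally have "norm (p k - q k) \<le> 4 * e + L * exp (L * t) * t * (4 * e)"
        using err[of k] norm_triangle_sub[of "p k - q k" "(\<Sum>i<k. z i) - w k"] by simp
      also have "\<dots> = 4 * e * Q" by (simp add: Q_def algebra_simps)
      also have "\<dots> = r / 2" using Q by (simp add: e_def)
      also have "\<dots> < r" using r by simp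
      finally show "norm (euler (\<lambda>i y. (t / k) *\<^sub>R b (i * (t / k)) y) x
        (\<lambda>i. \<sigma> (i * (t / k)) *v (B (Suc i * (t / k)) - B (i * (t / k)))) k - X t) < r"
        unfolding p_def q_def kh f_def z_def by (simp only: h_def)
    qed
  qed
qed

subsection \<open>Law of an expanding function of a Gaussian vector\<close>

text \<open>The class of variables that are Gaussian by definition of the process. Its closure under
  linear combinations transfers Gaussianity to \<xi> and W without computing their
  coefficients.\<close>

definition linear_functionals :: "'i set \<Rightarrow> ('i \<Rightarrow> 'a \<Rightarrow> 'b::euclidean_space) \<Rightarrow> ('a \<Rightarrow> real) set" where
  "linear_functionals I Z = {Y. \<exists>S c. finite S \<and> S \<subseteq> I \<and> Y = (\<lambda>\<omega>. \<Sum>t\<in>S. c t \<bullet> Z t \<omega>)}"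

lemma linear_functionals_inner: "t \<in> I \<Longrightarrow> (\<lambda>\<omega>. v \<bullet> Z t \<omega>) \<in> linear_functionals I Z"
  unfolding linear_functionals_def by (auto intro!: exI[of _ "{t}"] exI[of _ "\<lambda>_. v"])

lemma linear_functionals_scale: "Y \<in> linear_functionals I Z \<Longrightarrow> (\<lambda>\<omega>. a * Y \<omega>) \<in> linear_functionals I Z"
  unfolding linear_functionals_def
proof clarify
  fix S c assume "finite S" "S \<subseteq> I"
  then show "\<exists>S' c'. finite S' \<and> S' \<subseteq> I \<and> (\<lambda>\<omega>. a * (\<Sum>t\<in>S. c t \<bullet> Z t \<omega>)) = (\<lambda>\<omega>. \<Sum>t\<in>S'. c' t \<bullet> Z t \<omega>)"
    by (intro exI[of _ S] exI[of _ "\<lambda>t. a *\<^sub>R c t"]) (simp add: sum_distrib_left)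
qed

lemma linear_functionals_add:
  assumes "Y \<in> linear_functionals I Z" "Y' \<in> linear_functionals I Z"
  shows "(\<lambda>\<omega>. Y \<omega> + Y' \<omega>) \<in> linear_functionals I Z"
proof -
  obtain S c where S: "finite S" "S \<subseteq> I" "Y = (\<lambda>\<omega>. \<Sum>t\<in>S. c t \<bullet> Z t \<omega>)"
    using assms(1) unfolding linear_functionals_def by blast
  obtain S' c' where S': "finite S'" "S' \<subseteq> I" "Y' = (\<lambda>\<omega>. \<Sum>t\<in>S'. c' t \<bullet> Z t \<omega>)"
    using assms(2) unfolding linear_functionals_def by blast
  define d where "d t = (if t \<in> S then c t else 0) + (if t \<in> S' then c' t else 0)" for t
  have "(\<Sum>t\<in>S \<union> S'. d t \<bullet> Z t \<omega>) = (\<Sum>t\<in>S. c t \<bullet> Z t \<omega>) + (\<Sum>t\<in>S'. c' t \<bullet> Z t \<omega>)" for \<omega>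
  proof -
    have "(\<Sum>t\<in>S \<union> S'. d t \<bullet> Z t \<omega>) = (\<Sum>t\<in>S \<union> S'. (if t \<in> S then c t \<bullet> Z t \<omega> else 0)) + (\<Sum>t\<in>S \<union> S'. (if t \<in> S' then c' t \<bullet> Z t \<omega> else 0))"
      unfolding d_def by (simp add: inner_add_left sum.distrib if_distrib[of "\<lambda>x. x \<bullet> _"] cong: if_cong)
    also have "(\<Sum>t\<in>S \<union> S'. (if t \<in> S then c t \<bullet> Z t \<omega> else 0)) = (\<Sum>t\<in>S. c t \<bullet> Z t \<omega>)"
      using S(1) S'(1) by (intro sum.mono_neutral_cong_right) auto
    also have "(\<Sum>t\<in>S \<union> S'. (if t \<in> S' then c' t \<bullet> Z t \<omega> else 0)) = (\<Sum>t\<in>S'. c' t \<bullet> Z t \<omega>)"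
      using S(1) S'(1) by (intro sum.mono_neutral_cong_right) auto
    finally show ?thesis .
  qed
  then show ?thesis
    using S S' unfolding linear_functionals_def by (intro CollectI exI[of _ "S \<union> S'"] exI[of _ d]) auto
qed

lemma linear_functionals_zero: "(\<lambda>\<omega>. 0) \<in> linear_functionals I Z"
  unfolding linear_functionals_def by (intro CollectI exI[of _ "{}"]) auto

lemma linear_functionals_sum:
  "finite A \<Longrightarrow> (\<And>j. j \<in> A \<Longrightarrow> Y j \<in> linear_functionals I Z) \<Longrightarrow> (\<lambda>\<omega>. \<Sum>j\<in>A. Y j \<omega>) \<in> linear_functionals I Z"
  by (induction A rule: finite_induct) (auto intro: linear_functionals_add linear_functionals_zero)

lemma gaussian_rv_linear_functional:
  "gaussian_process M I Z \<Longrightarrow> Y \<in> linear_functionals I Z \<Longrightarrow> gaussian_rv M Y"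
  unfolding gaussian_process_def linear_functionals_def by auto

text \<open>All coordinates as one scalar family: row 0 is the block to be kept random, and the rows
  shifted by one are the block to be frozen.\<close>

definition stacked :: "('a \<Rightarrow> real ^ 'n) \<Rightarrow> (nat \<Rightarrow> 'a \<Rightarrow> real ^ 'n) \<Rightarrow> nat \<times> 'n \<Rightarrow> 'a \<Rightarrow> real" where
  "stacked \<xi> W = (\<lambda>(j, i) \<omega>. case j of 0 \<Rightarrow> \<xi> \<omega> $ i | Suc j \<Rightarrow> W j \<omega> $ i)"

text \<open>The values of \<open>\<xi>\<close> that send \<open>F \<xi> w\<close> into a given ball lie in a ball of comparable radius, whose
  centre depends on \<open>w\<close>.\<close>

lemma emeasure_expanding_ball_le:
  fixes \<xi> :: "'a \<Rightarrow> real ^ 'n" and W :: "nat \<Rightarrow> 'a \<Rightarrow> real ^ 'n"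
    and F :: "real ^ 'n \<Rightarrow> (nat \<Rightarrow> real ^ 'n) \<Rightarrow> real ^ 'n"
  assumes G: "centered_gaussian_family M ({..Suc k} \<times> UNIV) (stacked \<xi> W)"
    and v: "v > 0"
    and cov1: "\<And>i j. (LINT \<omega>|M. \<xi> \<omega> $ i * \<xi> \<omega> $ j) = (if i = j then v else 0)"
    and cov2: "\<And>i j l. j \<le> k \<Longrightarrow> (LINT \<omega>|M. \<xi> \<omega> $ i * W j \<omega> $ l) = 0"
    and meas: "(\<lambda>z. F (\<chi> i. z (0, i)) (\<lambda>j. \<chi> i. z (Suc j, i))) \<in> borel_measurable (PiM ({..Suc k} \<times> UNIV) (\<lambda>_. borel))"
    and cong: "\<And>a w w'. (\<And>j. j \<le> k \<Longrightarrow> w j = w' j) \<Longrightarrow> F a w = F a w'"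
    and expand: "\<And>a a' w. c * norm (a - a') \<le> norm (F a w - F a' w)" and c: "c > 0" and r: "r > 0"
  shows "emeasure M {\<omega> \<in> space M. F (\<xi> \<omega>) (\<lambda>j. W j \<omega>) \<in> ball y r} \<le> ennreal ((4 / (c * sqrt (2 * pi * v))) ^ CARD('n) * r ^ CARD('n))"
proof -
  let ?I = "{..Suc k} \<times> (UNIV :: 'n set)"
  let ?V = "stacked \<xi> W"
  interpret centered_gaussian_family M ?I ?V by fact
  define K where "K = {0::nat} \<times> (UNIV :: 'n set)"
  define \<Phi> where "\<Phi> z = F (\<chi> i. z (0, i)) (\<lambda>j. \<chi> i. z (Suc j, i))" for z
  define A where "A = \<Phi> -` ball y r \<inter> space (PiM ?I (\<lambda>_. borel))"
  have A: "A \<in> sets (PiM ?I (\<lambda>_. borel))"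
    unfolding A_def \<Phi>_def by (rule measurable_sets[OF meas]) simp
  have split: "(\<lambda>p\<in>?I. if p \<in> K then ?V p \<omega> else ?V p \<omega>') \<in> A \<longleftrightarrow> F (\<xi> \<omega>) (\<lambda>j. W j \<omega>') \<in> ball y r" for \<omega> \<omega>'
  proof -
    have "\<Phi> (\<lambda>p\<in>?I. if p \<in> K then ?V p \<omega> else ?V p \<omega>') = F (\<xi> \<omega>) (\<lambda>j. \<chi> i. (\<lambda>p\<in>?I. if p \<in> K then ?V p \<omega> else ?V p \<omega>') (Suc j, i))"
      unfolding \<Phi>_def by (simp add: K_def stacked_def vec_eq_iff)
    also have "\<dots> = F (\<xi> \<omega>) (\<lambda>j. W j \<omega>')"
      by (rule cong) (simp add: K_def stacked_def vec_eq_iff)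
    finally show ?thesis by (auto simp: A_def space_PiM)
  qed
  have "(\<lambda>p\<in>?I. ?V p \<omega>) \<in> A \<longleftrightarrow> F (\<xi> \<omega>) (\<lambda>j. W j \<omega>) \<in> ball y r" for \<omega>
    using split[of \<omega> \<omega>] by simp
  then have "emeasure M {\<omega> \<in> space M. F (\<xi> \<omega>) (\<lambda>j. W j \<omega>) \<in> ball y r} = emeasure M {\<omega> \<in> space M. (\<lambda>p\<in>?I. ?V p \<omega>) \<in> A}"
    by simp
  also have "\<dots> = (\<integral>\<^sup>+\<omega>'. emeasure M {\<omega> \<in> space M. (\<lambda>p\<in>?I. if p \<in> K then ?V p \<omega> else ?V p \<omega>') \<in> A} \<partial>M)"
  proof (rule emeasure_uncorrelated_blocks[OF _ _ A])
    fix p q assume "p \<in> K" "q \<in> ?I - K"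
    then obtain i j l where "p = (0, i)" "q = (Suc j, l)" "j \<le> k"
      unfolding K_def by (cases q, cases "fst q") auto
    then show "(LINT \<omega>|M. ?V p \<omega> * ?V q \<omega>) = 0" using cov2 by (simp add: stacked_def)
  qed (auto simp: K_def)
  also have "\<dots> = (\<integral>\<^sup>+\<omega>'. emeasure M {\<omega> \<in> space M. F (\<xi> \<omega>) (\<lambda>j. W j \<omega>') \<in> ball y r} \<partial>M)"
    by (simp only: split)
  also have "\<dots> \<le> (\<integral>\<^sup>+\<omega>'. ennreal ((4 / (c * sqrt (2 * pi * v))) ^ CARD('n) * r ^ CARD('n)) \<partial>M)"
  proof (intro nn_integral_mono)
    fix \<omega>'
    show "emeasure M {\<omega> \<in> space M. F (\<xi> \<omega>) (\<lambda>j. W j \<omega>') \<in> ball y r} \<le> ennreal ((4 / (c * sqrt (2 * pi * v))) ^ CARD('n) * r ^ CARD('n))"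
    proof (cases "{\<omega> \<in> space M. F (\<xi> \<omega>) (\<lambda>j. W j \<omega>') \<in> ball y r} = {}")
      case True
      then show ?thesis by (simp only: emeasure_empty) simp
    next
      case False
      \<comment> \<open>Any point of the event serves as centre, a new one for each frozen
        \<omega>'. The resulting bound is the same for every centre, so no measurable choice is
        involved.\<close>
      then obtain \<omega>0 where \<omega>0: "F (\<xi> \<omega>0) (\<lambda>j. W j \<omega>') \<in> ball y r" by blast
      define R where "R = 2 * r / c"
      have R: "R \<ge> 0" using r c by (simp add: R_def)
      have [measurable]: "?V p \<in> borel_measurable M" if "p \<in> K" for p
        using that by (intro measurable_component) (auto simp: K_def)
      have "finite K" by (simp add: K_def)
      have "\<xi> \<omega> $ i \<in> {\<xi> \<omega>0 $ i - R..\<xi> \<omega>0 $ i + R}" if "F (\<xi> \<omega>) (\<lambda>j. W j \<omega>') \<in> ball y r" for \<omega> i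
      proof -
        have "c * norm (\<xi> \<omega> - \<xi> \<omega>0) \<le> dist (F (\<xi> \<omega>) (\<lambda>j. W j \<omega>')) (F (\<xi> \<omega>0) (\<lambda>j. W j \<omega>'))"
          unfolding dist_norm by (rule expand)
        also have "\<dots> \<le> 2 * r"
          using that \<omega>0 dist_triangle_half_r[of y "F (\<xi> \<omega>) (\<lambda>j. W j \<omega>')" "2 * r" "F (\<xi> \<omega>0) (\<lambda>j. W j \<omega>')"] by simp
        finally have "norm (\<xi> \<omega> - \<xi> \<omega>0) \<le> R" using c by (simp add: R_def field_simps)
        then have "\<bar>(\<xi> \<omega> - \<xi> \<omega>0) $ i\<bar> \<le> R" using component_le_norm_cart order_trans by blast
        then show ?thesis by auto
      qed
      then have "emeasure M {\<omega> \<in> space M. F (\<xi> \<omega>) (\<lambda>j. W j \<omega>') \<in> ball y r} \<le>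
          emeasure M {\<omega> \<in> space M. \<forall>p\<in>K. ?V p \<omega> \<in> {\<xi> \<omega>0 $ snd p - R..\<xi> \<omega>0 $ snd p + R}}"
      proof (intro emeasure_mono subsetI)
        show "{\<omega> \<in> space M. \<forall>p\<in>K. ?V p \<omega> \<in> {\<xi> \<omega>0 $ snd p - R..\<xi> \<omega>0 $ snd p + R}} \<in> sets M"
          using \<open>finite K\<close> by measurable
      qed (auto simp: K_def stacked_def)
      also have "\<dots> \<le> ennreal (2 * R / sqrt (2 * pi * v)) ^ card K"
        using cov1 by (intro emeasure_orthogonal_box_le[OF _ v _ _ R]) (auto simp: K_def stacked_def power2_eq_square split: if_splits)
      also have "\<dots> = ennreal ((2 * R / sqrt (2 * pi * v)) ^ CARD('n))"
        using R v by (simp add: ennreal_power K_def card_cartesian_product)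
      \<comment> \<open>Two values in the ball are less than \<open>2 * r\<close> apart, so
        expansion confines \<xi> to intervals of length \<open>4 * r / c\<close>; the other factor
        is the maximal density.\<close>
      also have "2 * R / sqrt (2 * pi * v) = 4 / (c * sqrt (2 * pi * v)) * r" by (simp add: R_def)
      finally show ?thesis by (simp only: power_mult_distrib)
    qed
  qed
  also have "\<dots> = ennreal ((4 / (c * sqrt (2 * pi * v))) ^ CARD('n) * r ^ CARD('n))"
    by (simp add: emeasure_space_1)
  finally show ?thesis .
qed

text \<open>Balls are open, so the approximations eventually lie in any ball that contains their
  limit; Fatou's lemma then passes the bound on.\<close>

lemma emeasure_limit_ball_le:
  fixes Y :: "nat \<Rightarrow> 'a \<Rightarrow> 'e::{second_countable_topology, real_normed_vector}"
  assumes [measurable]: "\<And>k. Y k \<in> borel_measurable M" "Z \<in> borel_measurable M"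
    and lim: "AE \<omega> in M. (\<lambda>k. Y k \<omega>) \<longlonglongrightarrow> Z \<omega>"
    and le: "\<forall>\<^sub>F k in sequentially. emeasure M {\<omega> \<in> space M. Y k \<omega> \<in> ball y r} \<le> C"
  shows "emeasure M {\<omega> \<in> space M. Z \<omega> \<in> ball y r} \<le> C"
proof -
  have ind: "(\<integral>\<^sup>+\<omega>. indicator (ball y r) (U \<omega>) \<partial>M) = emeasure M {\<omega> \<in> space M. U \<omega> \<in> ball y r}"
    if [measurable]: "U \<in> borel_measurable M" for U
  proof -
    have "(\<integral>\<^sup>+\<omega>. indicator (ball y r) (U \<omega>) \<partial>M) = (\<integral>\<^sup>+\<omega>. indicator {\<omega> \<in> space M. U \<omega> \<in> ball y r} \<omega> \<partial>M)"
      by (intro nn_integral_cong) (auto simp: indicator_def)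
    also have "\<dots> = emeasure M {\<omega> \<in> space M. U \<omega> \<in> ball y r}"
    proof (rule nn_integral_indicator)
      have "{\<omega> \<in> space M. U \<omega> \<in> ball y r} = U -` ball y r \<inter> space M" by auto
      then show "{\<omega> \<in> space M. U \<omega> \<in> ball y r} \<in> sets M" using measurable_sets[OF that, of "ball y r"] by simp
    qed
    finally show ?thesis .
  qed
  have "emeasure M {\<omega> \<in> space M. Z \<omega> \<in> ball y r} = (\<integral>\<^sup>+\<omega>. indicator (ball y r) (Z \<omega>) \<partial>M)"
    by (simp only: ind assms)
  also have "\<dots> \<le> (\<integral>\<^sup>+\<omega>. liminf (\<lambda>k. indicator (ball y r) (Y k \<omega>)) \<partial>M)"
  proof (rule nn_integral_mono_AE, use lim in eventually_elim)
    fix \<omega> assume l: "(\<lambda>k. Y k \<omega>) \<longlonglongrightarrow> Z \<omega>"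
    show "indicator (ball y r) (Z \<omega>) \<le> (liminf (\<lambda>k. indicator (ball y r) (Y k \<omega>)) :: ennreal)"
    proof (cases "Z \<omega> \<in> ball y r")
      case True
      then have "\<forall>\<^sub>F k in sequentially. Y k \<omega> \<in> ball y r"
        using l by (intro topological_tendstoD) auto
      then show ?thesis using True by (intro Liminf_bounded) (auto elim!: eventually_mono)
    qed simp
  qed
  also have "\<dots> \<le> liminf (\<lambda>k. \<integral>\<^sup>+\<omega>. indicator (ball y r) (Y k \<omega>) \<partial>M)"
    by (intro nn_integral_liminf measurable_compose[OF assms(1) borel_measurable_indicator]) simp
  also have "(\<lambda>k. \<integral>\<^sup>+\<omega>. indicator (ball y r) (Y k \<omega>) \<partial>M) = (\<lambda>k. emeasure M {\<omega> \<in> space M. Y k \<omega> \<in> ball y r})"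
    by (simp only: ind assms)
  also have "liminf \<dots> \<le> liminf (\<lambda>k. C)" by (rule Liminf_mono[OF le])
  finally show ?thesis by (simp add: Liminf_const)
qed

subsection \<open>Fractional Brownian motion and its second difference\<close>

lemma norm_matrix_vector_mult_le: "norm (A *v x) \<le> norm A * norm x"
  for A :: "real ^ 'n ^ 'm"
proof -
  have "norm (A *v x) = L2_set (\<lambda>i. \<bar>(A $ i) \<bullet> x\<bar>) UNIV"
    by (simp add: norm_vec_def matrix_vector_mult_def inner_vec_def)
  also have "\<dots> \<le> L2_set (\<lambda>i. norm (A $ i) * norm x) UNIV"
    by (intro L2_set_mono Cauchy_Schwarz_ineq2) auto
  also have "\<dots> = norm A * norm x"
    by (simp add: norm_vec_def[of A] L2_set_left_distrib)
  finally show ?thesis .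
qed

lemma lipschitz_of_jacobian_bound:
  fixes f :: "real ^ 'n \<Rightarrow> real ^ 'm"
  assumes "\<And>y. f differentiable (at y)" "\<And>y. norm (jacobian f (at y)) \<le> L"
  shows "norm (f y - f z) \<le> L * norm (y - z)"
proof (rule differentiable_bound[of UNIV])
  show "(f has_derivative (\<lambda>h. jacobian f (at y) *v h)) (at y within UNIV)" for y
    using assms(1)[of y] unfolding jacobian_works by simp
  show "onorm (\<lambda>h. jacobian f (at y) *v h) \<le> L" for y
    using assms(2)[of y] norm_matrix_vector_mult_le[of "jacobian f (at y)"]
    by (intro onorm_le) (meson mult_right_mono norm_ge_zero order_trans)
qed auto

lemma continuous_on_time_space:
  fixes b :: "real \<Rightarrow> 'v::real_normed_vector \<Rightarrow> 'w::real_normed_vector"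
  assumes \<gamma>: "\<gamma> > 0" and Lip: "\<And>s y z. s \<in> D \<Longrightarrow> norm (b s y - b s z) \<le> L * norm (y - z)"
    and time: "\<And>s r y. s \<in> D \<Longrightarrow> r \<in> D \<Longrightarrow> norm (b s y - b r y) \<le> L1 * \<bar>s - r\<bar> powr \<gamma>"
    and X: "continuous_on D X"
  shows "continuous_on D (\<lambda>s. b s (X s))"
  unfolding continuous_on_def
proof
  fix s assume s: "s \<in> D"
  have "((\<lambda>r. b r (X r) - b s (X s)) \<longlongrightarrow> 0) (at s within D)"
  proof (rule Lim_null_comparison)
    show "\<forall>\<^sub>F r in at s within D. norm (b r (X r) - b s (X s)) \<le> L1 * \<bar>r - s\<bar> powr \<gamma> + L * norm (X r - X s)"
    proof (unfold eventually_at_filter, intro always_eventually allI impI)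
      fix r assume "r \<in> D"
      then have "norm (b r (X r) - b s (X r)) \<le> L1 * \<bar>r - s\<bar> powr \<gamma>" using time s by simp
      moreover have "norm (b s (X r) - b s (X s)) \<le> L * norm (X r - X s)" using Lip s by simp
      ultimately show "norm (b r (X r) - b s (X s)) \<le> L1 * \<bar>r - s\<bar> powr \<gamma> + L * norm (X r - X s)"
        using norm_triangle_ineq[of "b r (X r) - b s (X r)" "b s (X r) - b s (X s)"] by simp
    qed
    have "(X \<longlongrightarrow> X s) (at s within D)" using X s by (simp add: continuous_on_def)
    then have "((\<lambda>r. L * norm (X r - X s)) \<longlongrightarrow> L * norm (X s - X s)) (at s within D)"
      by (intro tendsto_intros)
    moreover have "((\<lambda>r. L1 * \<bar>r - s\<bar> powr \<gamma>) \<longlongrightarrow> L1 * \<bar>s - s\<bar> powr \<gamma>) (at s within D)"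
      using \<gamma> by (intro tendsto_intros tendsto_powr') (auto intro!: always_eventually)
    ultimately show "((\<lambda>r. L1 * \<bar>r - s\<bar> powr \<gamma> + L * norm (X r - X s)) \<longlongrightarrow> 0) (at s within D)"
      using tendsto_add by fastforce
  qed
  then show "((\<lambda>r. b r (X r)) \<longlongrightarrow> b s (X s)) (at s within D)"
    by (simp add: Lim_null[symmetric])
qed

locale fbm = prob_space M for M :: "'a measure" +
  fixes T H :: real and B :: "real \<Rightarrow> 'a \<Rightarrow> real ^ 'n"
  assumes H: "1 / 2 < H" "H < 1" and fractional: "fractional_brownian_motion M T H B"
begin

abbreviation functionals :: "('a \<Rightarrow> real) set" where
  "functionals \<equiv> linear_functionals {0..T} B"

lemma B_measurable: "t \<in> {0..T} \<Longrightarrow> B t \<in> borel_measurable M"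
  using fractional unfolding fractional_brownian_motion_def gaussian_process_def by blast

lemma gaussian_functional: "Y \<in> functionals \<Longrightarrow> gaussian_rv M Y"
  using fractional unfolding fractional_brownian_motion_def by (blast intro: gaussian_rv_linear_functional)

lemma component_functional: "t \<in> {0..T} \<Longrightarrow> (\<lambda>\<omega>. B t \<omega> $ i) \<in> functionals"
  using linear_functionals_inner[of t "{0..T}" "axis i 1" B] by (simp add: inner_axis' cart_eq_inner_axis inner_commute)

lemma component_mean: "t \<in> {0..T} \<Longrightarrow> (LINT \<omega>|M. B t \<omega> $ i) = 0"
  and component_cov: "t \<in> {0..T} \<Longrightarrow> s \<in> {0..T} \<Longrightarrow>
    (LINT \<omega>|M. B t \<omega> $ i * B s \<omega> $ j) = (if i = j then fbm_cov H t s else 0)"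
  using fractional unfolding fractional_brownian_motion_def by auto

lemma component_integrable: "t \<in> {0..T} \<Longrightarrow> integrable M (\<lambda>\<omega>. B t \<omega> $ i)"
  by (rule gaussian_rv_integrable[OF prob_space_axioms gaussian_functional[OF component_functional] component_mean])

lemma component_mult_integrable:
  "t \<in> {0..T} \<Longrightarrow> s \<in> {0..T} \<Longrightarrow> integrable M (\<lambda>\<omega>. B t \<omega> $ i * B s \<omega> $ j)"
  by (intro integrable_mult_of_squares
      gaussian_rv_measurable[OF prob_space_axioms gaussian_functional[OF component_functional] component_mean]
      gaussian_rv_integrable_square[OF prob_space_axioms gaussian_functional[OF component_functional] component_mean])

end

locale fbm_second_difference = fbm M T H B
  for M :: "'a measure" and T H :: real and B :: "real \<Rightarrow> 'a \<Rightarrow> real ^ 'n" +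
  fixes t e :: real
  assumes e: "0 < e" "2 * e < t" "t \<le> T"
begin

definition \<xi> :: "'a \<Rightarrow> real ^ 'n" where
  "\<xi> \<omega> = B t \<omega> - 2 *\<^sub>R B (t - e) \<omega> + B (t - 2 * e) \<omega>"

text \<open>The variance of each component of \<xi>, by \<open>cov_xi_xi\<close>; its positivity is
  where \<open>H < 1\<close> enters.\<close>

definition v :: real where "v = (4 - 2 powr (2 * H)) * e powr (2 * H)"

text \<open>The regression coefficient of \<open>B s\<close> on \<xi>, that is, covariance over
  variance, which makes W uncorrelated with \<xi>. One scalar suffices because different coordinates
  of B are uncorrelated and share one covariance function.\<close>

definition \<phi> :: "real \<Rightarrow> real" where
  "\<phi> s = (second_diff (2 * H) e t - second_diff (2 * H) e (t - s)) / (2 * v)"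

definition W :: "real \<Rightarrow> 'a \<Rightarrow> real ^ 'n" where
  "W s \<omega> = B s \<omega> - \<phi> s *\<^sub>R \<xi> \<omega>"

lemma times: "t \<in> {0..T}" "t - e \<in> {0..T}" "t - 2 * e \<in> {0..T}"
  using e by auto

lemma v_pos: "v > 0"
proof -
  have "(2::real) powr (2 * H) < 2 powr 2" using H by (intro powr_less_mono) auto
  then show ?thesis unfolding v_def using e by (intro mult_pos_pos) auto
qed

lemma cov_xi_B:
  assumes s: "s \<in> {0..T}"
  shows "(LINT \<omega>|M. \<xi> \<omega> $ i * B s \<omega> $ j) =
    (if i = j then (second_diff (2 * H) e t - second_diff (2 * H) e (t - s)) / 2 else 0)"
    and "integrable M (\<lambda>\<omega>. \<xi> \<omega> $ i * B s \<omega> $ j)"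
proof -
  note int = component_mult_integrable[OF times(1) s] component_mult_integrable[OF times(2) s] component_mult_integrable[OF times(3) s]
  have eq: "(\<lambda>\<omega>. \<xi> \<omega> $ i * B s \<omega> $ j) = (\<lambda>\<omega>. B t \<omega> $ i * B s \<omega> $ j - 2 * (B (t - e) \<omega> $ i * B s \<omega> $ j) + B (t - 2 * e) \<omega> $ i * B s \<omega> $ j)"
    by (auto simp: \<xi>_def algebra_simps)
  show "integrable M (\<lambda>\<omega>. \<xi> \<omega> $ i * B s \<omega> $ j)"
    unfolding eq using int by auto
  have "(LINT \<omega>|M. \<xi> \<omega> $ i * B s \<omega> $ j) = (LINT \<omega>|M. B t \<omega> $ i * B s \<omega> $ j)
      - 2 * (LINT \<omega>|M. B (t - e) \<omega> $ i * B s \<omega> $ j) + (LINT \<omega>|M. B (t - 2 * e) \<omega> $ i * B s \<omega> $ j)"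
    unfolding eq using int by simp
  also have "\<dots> = (if i = j then fbm_cov H t s - 2 * fbm_cov H (t - e) s + fbm_cov H (t - 2 * e) s else 0)"
    using times s by (simp add: component_cov)
  \<comment> \<open>The powers of \<open>s\<close> alone cancel since 1 - 2 + 1 = 0; the remaining
    terms are second differences at remaining times \<open>t\<close> and
    \<open>t - s\<close>.\<close>
  also have "fbm_cov H t s - 2 * fbm_cov H (t - e) s + fbm_cov H (t - 2 * e) s =
      (second_diff (2 * H) e t - second_diff (2 * H) e (t - s)) / 2"
    using e by (simp add: fbm_cov_def second_diff_def field_simps)
  finally show "(LINT \<omega>|M. \<xi> \<omega> $ i * B s \<omega> $ j) =
    (if i = j then (second_diff (2 * H) e t - second_diff (2 * H) e (t - s)) / 2 else 0)" .
qed

lemma cov_xi_xi: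
  shows "(LINT \<omega>|M. \<xi> \<omega> $ i * \<xi> \<omega> $ j) = (if i = j then v else 0)"
    and "integrable M (\<lambda>\<omega>. \<xi> \<omega> $ i * \<xi> \<omega> $ j)"
proof -
  let ?g = "second_diff (2 * H) e"
  note int = cov_xi_B(2)[OF times(1)] cov_xi_B(2)[OF times(2)] cov_xi_B(2)[OF times(3)]
  have eq: "(\<lambda>\<omega>. \<xi> \<omega> $ i * \<xi> \<omega> $ j) = (\<lambda>\<omega>. \<xi> \<omega> $ i * B t \<omega> $ j - 2 * (\<xi> \<omega> $ i * B (t - e) \<omega> $ j) + \<xi> \<omega> $ i * B (t - 2 * e) \<omega> $ j)"
    by (auto simp: \<xi>_def algebra_simps)
  show "integrable M (\<lambda>\<omega>. \<xi> \<omega> $ i * \<xi> \<omega> $ j)"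
    unfolding eq using int by auto
  have p: "1 < 2 * H" "2 * H < 2" using H by auto
  have "?g 0 = (2 powr (2 * H) - 2) * e powr (2 * H)" "?g e = 2 * e powr (2 * H)" "?g (2 * e) = ?g 0"
    using second_diff_0[OF p e(1)] second_diff_e[OF p e(1)] second_diff_reflect[OF p e(1), of 0] by auto
  \<comment> \<open>The remaining times are 0, \<open>e\<close> and \<open>2 * e\<close>; by
    reflection the combination equals the value at \<open>e\<close> minus the value at 0.\<close>
  then have g: "(?g t - ?g (t - t)) / 2 - 2 * ((?g t - ?g (t - (t - e))) / 2) + (?g t - ?g (t - (t - 2 * e))) / 2 = v"
    by (simp add: v_def field_simps)
  have "(LINT \<omega>|M. \<xi> \<omega> $ i * \<xi> \<omega> $ j) = (LINT \<omega>|M. \<xi> \<omega> $ i * B t \<omega> $ j)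
      - 2 * (LINT \<omega>|M. \<xi> \<omega> $ i * B (t - e) \<omega> $ j) + (LINT \<omega>|M. \<xi> \<omega> $ i * B (t - 2 * e) \<omega> $ j)"
    unfolding eq using int by simp
  also have "\<dots> = (if i = j then v else 0)"
    unfolding cov_xi_B(1)[OF times(1)] cov_xi_B(1)[OF times(2)] cov_xi_B(1)[OF times(3)]
    using g by simp
  finally show "(LINT \<omega>|M. \<xi> \<omega> $ i * \<xi> \<omega> $ j) = (if i = j then v else 0)" .
qed

lemma cov_xi_W:
  assumes s: "s \<in> {0..T}"
  shows "(LINT \<omega>|M. \<xi> \<omega> $ i * W s \<omega> $ j) = 0"
proof -
  have "(LINT \<omega>|M. \<xi> \<omega> $ i * W s \<omega> $ j) = (LINT \<omega>|M. \<xi> \<omega> $ i * B s \<omega> $ j - \<phi> s * (\<xi> \<omega> $ i * \<xi> \<omega> $ j))"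
    by (simp add: W_def algebra_simps)
  also have "\<dots> = 0"
    using cov_xi_B[OF s, of i j] cov_xi_xi[of i j] v_pos by (simp add: \<phi>_def)
  finally show ?thesis .
qed

lemma xi_functional: "(\<lambda>\<omega>. \<xi> \<omega> $ i) \<in> functionals"
proof -
  have "(\<lambda>\<omega>. (B t \<omega> $ i + (-2) * B (t - e) \<omega> $ i) + B (t - 2 * e) \<omega> $ i) \<in> functionals"
    using times by (intro linear_functionals_add linear_functionals_scale component_functional)
  then show ?thesis by (simp add: \<xi>_def)
qed

lemma W_functional:
  assumes "s \<in> {0..T}"
  shows "(\<lambda>\<omega>. W s \<omega> $ i) \<in> functionals"
proof -
  have "(\<lambda>\<omega>. B s \<omega> $ i + (- \<phi> s) * \<xi> \<omega> $ i) \<in> functionals"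
    by (intro linear_functionals_add linear_functionals_scale component_functional xi_functional assms)
  then show ?thesis by (simp add: W_def)
qed

lemma xi_mean: "(LINT \<omega>|M. \<xi> \<omega> $ i) = 0"
  and xi_integrable: "integrable M (\<lambda>\<omega>. \<xi> \<omega> $ i)"
proof -
  have eq: "(\<lambda>\<omega>. \<xi> \<omega> $ i) = (\<lambda>\<omega>. B t \<omega> $ i - 2 * B (t - e) \<omega> $ i + B (t - 2 * e) \<omega> $ i)"
    by (auto simp: \<xi>_def)
  show "integrable M (\<lambda>\<omega>. \<xi> \<omega> $ i)" unfolding eq using component_integrable times by auto
  show "(LINT \<omega>|M. \<xi> \<omega> $ i) = 0"
    unfolding eq using component_integrable times component_mean by simp
qed

lemma W_mean: "s \<in> {0..T} \<Longrightarrow> (LINT \<omega>|M. W s \<omega> $ i) = 0"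
  using component_integrable component_mean xi_integrable xi_mean by (simp add: W_def)

lemma stacked_gaussian:
  assumes r: "\<And>j. j \<le> k \<Longrightarrow> r j \<in> {0..T}"
  shows "centered_gaussian_family M ({..Suc k} \<times> UNIV) (stacked \<xi> (\<lambda>j. W (r j)))"
proof
  let ?V = "stacked \<xi> (\<lambda>j. W (r j))"
  have V: "?V p \<in> functionals \<and> integral\<^sup>L M (?V p) = 0" if p: "p \<in> {..Suc k} \<times> UNIV" for p
  proof (cases p)
    case (Pair j i)
    then show ?thesis
      using p r xi_functional[of i] xi_mean[of i] W_functional[of "r (j - 1)" i] W_mean[of "r (j - 1)" i]
      by (cases j) (auto simp: stacked_def)
  qed
  show "gaussian_rv M (\<lambda>x. \<Sum>p\<in>{..Suc k} \<times> UNIV. c p * ?V p x)" for c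
    using V by (intro gaussian_functional linear_functionals_sum linear_functionals_scale) auto
  show "integral\<^sup>L M (?V p) = 0" if "p \<in> {..Suc k} \<times> UNIV" for p using V[OF that] by simp
qed simp

end

section \<open>Ball estimate for the Euler scheme\<close>

lemma borel_measurable_vec_lambda:
  fixes f :: "'a \<Rightarrow> 'n::finite \<Rightarrow> real"
  assumes "\<And>i. (\<lambda>z. f z i) \<in> borel_measurable N"
  shows "(\<lambda>z. \<chi> i. f z i) \<in> borel_measurable N"
  unfolding borel_measurable_euclidean_space[of "\<lambda>z. \<chi> i. f z i"]
  using assms by (auto simp: Basis_vec_def inner_axis)

lemma borel_measurable_matrix_vector_mult:
  fixes A :: "real ^ 'n ^ 'm"
  assumes "f \<in> borel_measurable N"
  shows "(\<lambda>z. A *v f z) \<in> borel_measurable N"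
  using assms by (rule measurable_compose)
    (intro borel_measurable_continuous_onI matrix_vector_mult_linear_continuous_on)

context fbm_second_difference
begin

lemma B_decompose: "B s \<omega> = \<phi> s *\<^sub>R \<xi> \<omega> + W s \<omega>"
  by (simp add: W_def)

text \<open>Two runs with the same W differ in noise only by increments of \<phi> times
  \<sigma>(\<xi> - \<xi>'), and \<open>lower\<close> says that Gronwall cannot cancel this
  difference. The resulting bound is free of \<open>k\<close>.\<close>

lemma emeasure_euler_ball_le:
  fixes b :: "real \<Rightarrow> real ^ 'n \<Rightarrow> real ^ 'n" and \<sigma> :: "real \<Rightarrow> real ^ 'n ^ 'n" and L c h r :: real
  assumes L: "L \<ge> 0"
    and Lip: "\<And>s y z. s \<in> {0..t} \<Longrightarrow> norm (b s y - b s z) \<le> L * norm (y - z)"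
    and k: "k > 0" and h: "h = t / real k" and c: "c > 0"
    and lower: "\<And>w. c * norm w \<le>
      norm (\<Sum>i<k. (second_diff (2 * H) e (t - i * h) - second_diff (2 * H) e (t - Suc i * h)) *\<^sub>R (\<sigma> (i * h) *v w))
        - L * exp (L * t) * (h * (\<Sum>j<k. norm (\<Sum>i<j. (second_diff (2 * H) e (t - i * h) - second_diff (2 * H) e (t - Suc i * h)) *\<^sub>R (\<sigma> (i * h) *v w))))"
    and r: "r > 0"
  shows "emeasure M {\<omega> \<in> space M. euler (\<lambda>i y. h *\<^sub>R b (i * h) y) x
      (\<lambda>i. \<sigma> (i * h) *v (B (Suc i * h) \<omega> - B (i * h) \<omega>)) k \<in> ball y r}
    \<le> ennreal ((4 / (c / (2 * v) * sqrt (2 * pi * v))) ^ CARD('n) * r ^ CARD('n))"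
proof -
  have h0: "h > 0" using e k by (simp add: h)
  have kh: "real k * h = t" using k by (simp add: h)
  have jh: "real j * h \<in> {0..t}" if "j \<le> k" for j
    using that h0 unfolding kh[symmetric] by (auto intro: mult_right_mono)
  define f where "f i y = h *\<^sub>R b (real i * h) y" for i y
  define \<Delta> where "\<Delta> i = \<phi> (real (Suc i) * h) - \<phi> (real i * h)" for i
  \<comment> \<open>The noise with \<xi> and W replaced by free parameters \<open>a\<close> and
    \<open>w\<close>, so that \<xi> can vary while W is held fixed.\<close>
  define z where "z a w i = \<Delta> i *\<^sub>R (\<sigma> (real i * h) *v a) + \<sigma> (real i * h) *v (w (Suc i) - w i)" for a and w :: "nat \<Rightarrow> real ^ 'n" and i
  define F where "F a w = euler f x (z a w) k" for a w
  have fLip: "norm (f i y - f i y') \<le> L * h * norm (y - y')" if "i < k" for i y y'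
  proof -
    have "norm (f i y - f i y') = h * norm (b (real i * h) y - b (real i * h) y')"
      unfolding f_def using h0 by (simp flip: scaleR_diff_right)
    also have "\<dots> \<le> h * (L * norm (y - y'))" using h0 jh[of i] that by (intro mult_left_mono Lip) auto
    finally show ?thesis by (simp add: mult_ac)
  qed
  have fm: "f i \<in> borel_measurable borel" if "i < k" for i
  proof (rule borel_measurable_continuous_onI)
    have "(L * h)-lipschitz_on UNIV (f i)"
      using fLip[OF that] L h0 by (intro lipschitz_onI) (auto simp: dist_norm)
    then show "continuous_on UNIV (f i)" by (rule lipschitz_on_continuous_on)
  qed
  have eq: "euler (\<lambda>i y. h *\<^sub>R b (i * h) y) x (\<lambda>i. \<sigma> (i * h) *v (B (Suc i * h) \<omega> - B (i * h) \<omega>)) k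
      = F (\<xi> \<omega>) (\<lambda>j. W (real j * h) \<omega>)" for \<omega>
  proof -
    have "z (\<xi> \<omega>) (\<lambda>j. W (real j * h) \<omega>) i = \<sigma> (i * h) *v (B (Suc i * h) \<omega> - B (i * h) \<omega>)" for i
      unfolding z_def \<Delta>_def B_decompose[of "real i * h"] B_decompose[of "real (Suc i) * h"]
      by (simp only: matrix_vector_mult_diff_distrib matrix_vector_right_distrib matrix_vector_mult_scaleR)
         (simp add: algebra_simps)
    then show ?thesis unfolding F_def f_def by presburger
  qed
  have "emeasure M {\<omega> \<in> space M. F (\<xi> \<omega>) (\<lambda>j. W (real j * h) \<omega>) \<in> ball y r}
    \<le> ennreal ((4 / (c / (2 * v) * sqrt (2 * pi * v))) ^ CARD('n) * r ^ CARD('n))"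
  proof (rule emeasure_expanding_ball_le[where F = F and \<xi> = \<xi> and W = "\<lambda>j. W (real j * h)" and k = k])
    show "centered_gaussian_family M ({..Suc k} \<times> UNIV) (stacked \<xi> (\<lambda>j. W (real j * h)))"
      using jh e by (intro stacked_gaussian) fastforce
    show "(LINT \<omega>|M. \<xi> \<omega> $ i * \<xi> \<omega> $ j) = (if i = j then v else 0)" for i j by (rule cov_xi_xi)
    show "(LINT \<omega>|M. \<xi> \<omega> $ i * W (real j * h) \<omega> $ l) = 0" if "j \<le> k" for i j l
      using jh[OF that] e by (intro cov_xi_W) auto
    show "F a w = F a w'" if "\<And>j. j \<le> k \<Longrightarrow> w j = w' j" for a w w'
      unfolding F_def using that by (intro euler_cong) (simp add: z_def)
    show "(\<lambda>z. F (\<chi> i. z (0, i)) (\<lambda>j. \<chi> i. z (Suc j, i))) \<in> borel_measurable (PiM ({..Suc k} \<times> UNIV) (\<lambda>_. borel))"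
    proof -
      have comp: "(\<lambda>y. \<chi> i. y (j, i)) \<in> borel_measurable (PiM ({..Suc k} \<times> (UNIV::'n set)) (\<lambda>_. borel :: real measure))" if "j \<le> Suc k" for j
        using that by (intro borel_measurable_vec_lambda measurable_component_singleton) auto
      show ?thesis
        unfolding F_def
      proof (rule borel_measurable_euler)
        fix i assume "i < k"
        then show "(\<lambda>y. z (\<chi> l. y (0, l)) (\<lambda>j. \<chi> l. y (Suc j, l)) i) \<in> borel_measurable (PiM ({..Suc k} \<times> UNIV) (\<lambda>_. borel))"
          unfolding z_def
          by (intro borel_measurable_add borel_measurable_scaleR borel_measurable_const borel_measurable_matrix_vector_mult
              borel_measurable_diff comp) auto
      qed (rule fm)
    qed
    show "c / (2 * v) * norm (a - a') \<le> norm (F a w - F a' w)" for a a' w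
    proof -
      let ?p = "euler f x (z a w)" and ?q = "euler f x (z a' w)"
      let ?u = "\<lambda>j. \<Sum>i<j. z a w i" and ?w = "\<lambda>j. \<Sum>i<j. z a' w i"
      define \<Psi> where "\<Psi> j = (\<Sum>i<j. (second_diff (2 * H) e (t - i * h) - second_diff (2 * H) e (t - Suc i * h)) *\<^sub>R (\<sigma> (i * h) *v (a - a')))" for j
      have \<Delta>: "\<Delta> i = (second_diff (2 * H) e (t - i * h) - second_diff (2 * H) e (t - Suc i * h)) / (2 * v)" for i
        by (simp add: \<Delta>_def \<phi>_def flip: diff_divide_distrib)
      \<comment> \<open>\<open>lower\<close> is stated for the unnormalized kernel; the
        normalization in \<phi> accounts for the factor \<open>2 * v\<close> throughout.\<close>
      have uw: "?u j - ?w j = (1 / (2 * v)) *\<^sub>R \<Psi> j" for j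
        unfolding \<Psi>_def sum_subtractf[symmetric] scaleR_sum_right
        by (intro sum.cong refl) (simp add: z_def \<Delta> matrix_vector_mult_diff_distrib scaleR_diff_right)
      then have nuw: "norm (?u j - ?w j) = norm (\<Psi> j) / (2 * v)" for j using v_pos by simp
      have "norm (?p k - ?q k - (?u k - ?w k)) \<le> L * exp (L * h * k) * (h * (\<Sum>i<k. norm (?u i - ?w i)))"
      proof (rule euler_perturbation[where f = f and p = ?p and q = ?q and u = ?u and w = ?w and x = x])
        show "?p j = x + (\<Sum>i<j. f i (?p i)) + ?u j" "?q j = x + (\<Sum>i<j. f i (?q i)) + ?w j" for j
          by (rule euler_eq_sum)+
      qed (use L h0 fLip in auto)
      also have "\<dots> = (L * exp (L * t) * (h * (\<Sum>i<k. norm (\<Psi> i)))) / (2 * v)"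
        unfolding nuw using kh by (simp add: sum_divide_distrib[symmetric] mult_ac)
      finally have 1: "norm (?p k - ?q k - (?u k - ?w k)) \<le> (L * exp (L * t) * (h * (\<Sum>i<k. norm (\<Psi> i)))) / (2 * v)" .
      have "c * norm (a - a') / (2 * v) \<le> (norm (\<Psi> k) - L * exp (L * t) * (h * (\<Sum>i<k. norm (\<Psi> i)))) / (2 * v)"
        using lower[of "a - a'"] v_pos unfolding \<Psi>_def by (intro divide_right_mono) auto
      also have "\<dots> = norm (?u k - ?w k) - (L * exp (L * t) * (h * (\<Sum>i<k. norm (\<Psi> i)))) / (2 * v)"
        unfolding nuw by (simp add: diff_divide_distrib)
      also have "\<dots> \<le> norm (?p k - ?q k)"
        using 1 norm_triangle_ineq3[of "?p k - ?q k" "?u k - ?w k"] by linarith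
      finally show ?thesis unfolding F_def by simp
    qed
    show "0 < c / (2 * v)" using c v_pos by simp
  qed (use r v_pos in auto)
  then show ?thesis unfolding eq .
qed

end

section \<open>Absolute continuity of the law at positive times\<close>

theorem corollary4p2:
  fixes M :: "'a measure"
    and T H L1 L2 L3 \<gamma> \<rho> \<delta> K :: real
    and b :: "real \<Rightarrow> real ^ 'n \<Rightarrow> real ^ 'n"
    and \<sigma> :: "real \<Rightarrow> real ^ 'n ^ 'n"
    and B X :: "real \<Rightarrow> 'a \<Rightarrow> real ^ 'n"
    and x :: "real ^ 'n"
  assumes "prob_space M"
    and "T > 0" and "1 / 2 < H" and "H < 1"
    and b_diff: "\<forall>t\<in>{0..T}. \<forall>y. b t differentiable (at y)"
    and \<sigma>_inv: "\<forall>t\<in>{0..T}. invertible (\<sigma> t)"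
    and "L1 > 0" and "L2 > 0" and "L3 > 0"
    and "H - 1 / 2 < \<gamma>" and "\<gamma> \<le> 1"
    and b_time: "\<forall>t\<in>{0..T}. \<forall>s\<in>{0..T}. \<forall>y.
          norm (b t y - b s y) + norm (jacobian (b t) (at y) - jacobian (b s) (at y))
            \<le> L1 * \<bar>t - s\<bar> powr \<gamma>"
    and "1 - 1 / (2 * H) < \<rho>" and "\<rho> < 1"
    and grad_space: "\<forall>t\<in>{0..T}. \<forall>y z.
          norm (jacobian (b t) (at y) - jacobian (b t) (at z)) \<le> L2 * norm (y - z) powr \<rho>"
    and grad_bdd: "\<forall>t\<in>{0..T}. \<forall>y. norm (jacobian (b t) (at y)) \<le> L3"
    and "max (1 - H) (H - 1 / 2) < \<delta>" and "\<delta> \<le> 1" and "K > 0"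
    and \<sigma>_hoelder: "\<forall>t\<in>{0..T}. \<forall>s\<in>{0..T}. norm (\<sigma> t - \<sigma> s) \<le> K * \<bar>t - s\<bar> powr \<delta>"
    and \<sigma>_inv_bdd: "bounded ((\<lambda>t. matrix_inv (\<sigma> t)) ` {0..T})"
    and fbm: "fractional_brownian_motion M T H B"
    and sol: "pathwise_sde_solution M T b \<sigma> B x X"
  shows "\<forall>t\<in>{0<..T}. absolutely_continuous lborel (distr M borel (X t))"
proof
  fix t assume "t \<in> {0<..T}"
  then have t: "0 < t" "t \<le> T" by auto
  interpret fbm M T H B
    using \<open>prob_space M\<close> \<open>1 / 2 < H\<close> \<open>H < 1\<close> fbm by (intro fbm.intro fbm_axioms.intro)
  have Lip: "norm (b s y - b s z) \<le> L3 * norm (y - z)" if "s \<in> {0..T}" for s y z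
    using b_diff grad_bdd that by (intro lipschitz_of_jacobian_bound) auto
  have time: "norm (b s y - b r y) \<le> L1 * \<bar>s - r\<bar> powr \<gamma>" if "s \<in> {0..T}" "r \<in> {0..T}" for s r y
    using b_time that by (smt (verit, best) norm_ge_zero)
  have \<delta>: "\<delta> > 0" using \<open>max (1 - H) (H - 1 / 2) < \<delta>\<close> \<open>H < 1\<close> by simp
  have \<gamma>: "\<gamma> > 0" using \<open>H - 1 / 2 < \<gamma>\<close> \<open>1 / 2 < H\<close> by simp
  define S where "S = norm (\<sigma> t) + K * t powr \<delta>"
  have \<sigma>K: "norm (\<sigma> s *v w - \<sigma> t *v w) \<le> K * (t - s) powr \<delta> * norm w" if "s \<in> {0..t}" for s w
  proof -
    have "norm (\<sigma> s *v w - \<sigma> t *v w) \<le> norm (\<sigma> s - \<sigma> t) * norm w"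
      using norm_matrix_vector_mult_le[of "\<sigma> s - \<sigma> t" w] by (simp add: matrix_vector_mult_diff_rdistrib)
    also have "\<dots> \<le> K * (t - s) powr \<delta> * norm w"
      using \<sigma>_hoelder[rule_format, of s t] that t by (intro mult_right_mono) (auto simp: abs_minus_commute)
    finally show ?thesis .
  qed
  have \<sigma>S: "norm (\<sigma> s *v w) \<le> S * norm w" if s: "s \<in> {0..t}" for s w
  proof -
    have "norm (\<sigma> s *v w) \<le> norm (\<sigma> t *v w) + norm (\<sigma> s *v w - \<sigma> t *v w)"
      by (metis add.commute norm_triangle_sub)
    also have "\<dots> \<le> norm (\<sigma> t) * norm w + K * (t - s) powr \<delta> * norm w"
      by (intro add_mono norm_matrix_vector_mult_le \<sigma>K s)
    also have "\<dots> \<le> norm (\<sigma> t) * norm w + K * t powr \<delta> * norm w"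
      using s \<delta> \<open>K > 0\<close> by (intro add_left_mono mult_right_mono mult_left_mono powr_mono2) auto
    finally show ?thesis by (simp add: S_def algebra_simps)
  qed
  obtain A where A: "A ** \<sigma> t = mat 1" using bspec[OF \<sigma>_inv, of t] t unfolding invertible_def by auto
  \<comment> \<open>A left inverse of \<sigma> at the final time bounds \<sigma> from below there;
    the added 1 keeps the denominator positive.\<close>
  define m where "m = 1 / (norm A + 1)"
  have m: "m * norm w \<le> norm (\<sigma> t *v w)" for w
  proof -
    have "w = A *v (\<sigma> t *v w)"
      by (simp add: matrix_vector_mul_assoc A)
    then have "norm w \<le> norm A * norm (\<sigma> t *v w)"
      by (metis norm_matrix_vector_mult_le)
    also have "\<dots> \<le> (norm A + 1) * norm (\<sigma> t *v w)"
      by (intro mult_right_mono) auto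
    finally have "norm w \<le> (norm A + 1) * norm (\<sigma> t *v w)" .
    moreover have "norm A + 1 > 0" by (simp add: add_nonneg_pos)
    ultimately show ?thesis unfolding m_def by (simp add: pos_divide_le_eq mult.commute)
  qed
  have "S \<ge> 0" using \<open>K > 0\<close> by (simp add: S_def)
  have "m > 0" by (simp add: m_def add_nonneg_pos)
  \<comment> \<open>The exponent is \<open>p = 2 * H\<close>, strictly between 1 and 2, and
    \<open>L3 * exp (L3 * t)\<close> is the factor that \<open>euler_perturbation\<close> produces
    with \<open>h * k = t\<close>.\<close>
  have "\<exists>e c N. 0 < e \<and> 2 * e < t \<and> c > 0 \<and> (\<forall>k\<ge>N. \<forall>(h::real) w. k > 0 \<longrightarrow> h = t / real k \<longrightarrow>
      c * norm w \<le> norm (\<Sum>i<k. (second_diff (2 * H) e (t - i * h) - second_diff (2 * H) e (t - Suc i * h)) *\<^sub>R (\<sigma> (i * h) *v w))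
        - L3 * exp (L3 * t) * (h * (\<Sum>j<k. norm (\<Sum>i<j. (second_diff (2 * H) e (t - i * h) - second_diff (2 * H) e (t - Suc i * h)) *\<^sub>R (\<sigma> (i * h) *v w)))))"
    using H t \<open>L3 > 0\<close> \<open>K > 0\<close>
    by (intro second_diff_sum_nondegenerate[OF _ _ _ \<delta> \<open>S \<ge> 0\<close> _ _ \<open>m > 0\<close> \<sigma>S \<sigma>K m]) simp_all
  then obtain e c N where e: "0 < e" "2 * e < t" and c: "c > 0"
    and lower: "\<forall>k\<ge>N. \<forall>(h::real) w. k > 0 \<longrightarrow> h = t / real k \<longrightarrow>
      c * norm w \<le> norm (\<Sum>i<k. (second_diff (2 * H) e (t - i * h) - second_diff (2 * H) e (t - Suc i * h)) *\<^sub>R (\<sigma> (i * h) *v w))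
        - L3 * exp (L3 * t) * (h * (\<Sum>j<k. norm (\<Sum>i<j. (second_diff (2 * H) e (t - i * h) - second_diff (2 * H) e (t - Suc i * h)) *\<^sub>R (\<sigma> (i * h) *v w))))"
    by (elim exE conjE) (rule that)
  interpret fbm_second_difference M T H B t e
    using e t by unfold_locales auto
  define Y where "Y k \<omega> = euler (\<lambda>i y. (t / real k) *\<^sub>R b (i * (t / k)) y) x
      (\<lambda>i. \<sigma> (i * (t / k)) *v (B (Suc i * (t / k)) \<omega> - B (i * (t / k)) \<omega>)) k" for k \<omega>
  have grid: "real j * (t / real k) \<in> {0..T}" if "j \<le> k" "k > 0" for j k
  proof -
    have "real j * (t / real k) \<le> real k * (t / real k)" using that t by (intro mult_right_mono) auto
    then show ?thesis using that t by auto
  qed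
  have Ym: "Y k \<in> borel_measurable M" for k
    unfolding Y_def[abs_def]
  proof (rule borel_measurable_euler)
    fix i assume i: "i < k"
    then show "(\<lambda>\<omega>. \<sigma> (i * (t / k)) *v (B (Suc i * (t / k)) \<omega> - B (i * (t / k)) \<omega>)) \<in> borel_measurable M"
      using grid[of i k] grid[of "Suc i" k]
      by (intro borel_measurable_matrix_vector_mult borel_measurable_diff B_measurable) auto
    have "L3-lipschitz_on UNIV (b (i * (t / k)))"
      using Lip[OF grid[of i k]] i \<open>L3 > 0\<close> by (intro lipschitz_onI) (auto simp: dist_norm)
    then show "(\<lambda>y. (t / real k) *\<^sub>R b (i * (t / k)) y) \<in> borel_measurable borel"
      by (intro borel_measurable_continuous_onI continuous_intros lipschitz_on_continuous_on)
  qed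
  have Xm: "X t \<in> borel_measurable M" using sol t unfolding pathwise_sde_solution_def by auto
  have lim: "AE \<omega> in M. (\<lambda>k. Y k \<omega>) \<longlonglongrightarrow> X t \<omega>"
  proof -
    have "AE \<omega> in M. continuous_on {0..T} (\<lambda>t. X t \<omega>)"
      and "AE \<omega> in M. \<forall>t\<in>{0..T}. \<exists>I J. ((\<lambda>s. b s (X s \<omega>)) has_integral I) {0..t} \<and>
        has_pathwise_integral \<sigma> (\<lambda>s. B s \<omega>) 0 t J \<and> X t \<omega> = x + I + J"
      using sol unfolding pathwise_sde_solution_def by auto
    then show ?thesis
    proof eventually_elim
      case (elim \<omega>)
      \<comment> \<open>The null set is common to all times, so for a fixed \<omega> both integrals
        can be chosen as functions of the upper limit.\<close>
      from bchoice[OF elim(2)] obtain I where "\<forall>s\<in>{0..T}. \<exists>J. ((\<lambda>s. b s (X s \<omega>)) has_integral I s) {0..s} \<and>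
        has_pathwise_integral \<sigma> (\<lambda>s. B s \<omega>) 0 s J \<and> X s \<omega> = x + I s + J" ..
      from bchoice[OF this] obtain J where IJ: "\<forall>s\<in>{0..T}. ((\<lambda>s. b s (X s \<omega>)) has_integral I s) {0..s} \<and>
        has_pathwise_integral \<sigma> (\<lambda>s. B s \<omega>) 0 s (J s) \<and> X s \<omega> = x + I s + J s" ..
      show ?case
        unfolding Y_def
      proof (rule euler_tendsto_solution[where L = L3 and I = I and J = J and X = "\<lambda>s. X s \<omega>" and B = "\<lambda>s. B s \<omega>"])
        have "continuous_on {0..T} (\<lambda>s. b s (X s \<omega>))"
          by (rule continuous_on_time_space[OF \<gamma> Lip time elim(1)])
        then show "continuous_on {0..t} (\<lambda>s. b s (X s \<omega>))" by (rule continuous_on_subset) (use t in auto)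
      qed (use t \<open>L3 > 0\<close> Lip IJ in auto)
    qed
  qed
  define C where "C = (4 / (c / (2 * v) * sqrt (2 * pi * v))) ^ CARD('n)"
  show "absolutely_continuous lborel (distr M borel (X t))"
  proof (rule absolutely_continuous_lborelI_ball)
    show "C \<ge> 0" unfolding C_def using c v_pos by simp
    fix y :: "real ^ 'n" and r :: real assume r: "r > 0"
    have "\<forall>\<^sub>F k in sequentially. emeasure M {\<omega> \<in> space M. Y k \<omega> \<in> ball y r} \<le> ennreal (C * r ^ CARD('n))"
    proof (rule eventually_sequentiallyI)
      fix k assume "max 1 N \<le> k"
      then show "emeasure M {\<omega> \<in> space M. Y k \<omega> \<in> ball y r} \<le> ennreal (C * r ^ CARD('n))"
        unfolding Y_def C_def using t Lip \<open>L3 > 0\<close> c r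
        by (intro emeasure_euler_ball_le[OF _ _ _ refl c lower[rule_format, OF _ _ refl]]) auto
    qed
    then have "emeasure M {\<omega> \<in> space M. X t \<omega> \<in> ball y r} \<le> ennreal (C * r ^ CARD('n))"
      by (rule emeasure_limit_ball_le[OF Ym Xm lim])
    also have "{\<omega> \<in> space M. X t \<omega> \<in> ball y r} = X t -` ball y r \<inter> space M" by auto
    finally show "emeasure (distr M borel (X t)) (ball y r) \<le> ennreal (C * r ^ DIM(real ^ 'n))"
      using Xm by (simp add: emeasure_distr)
  qed simp
qed

end
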